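(* Let $G$ be a nonplanar ribbon graph admitting a proper witness pair. Then there exists a vertex $q$ of $G$ such that the rotor-routing action $\rho_q$ and the Bernardi action $\beta_q$ of $\mathrm{Pic}^0(G)$ on the set $\mathcal{T}(G)$ of spanning trees of $G$ are different.
   Context: Graphs are finite, connected, loopless multigraphs (parallel edges allowed). A ribbon graph is such a graph with, for each vertex $v$, a cyclic ordering of the edges at $v$. For edges $e_0,e_1$ at $v$ write $e_0\prec e_1$ if $e_1$ immediately succeeds $e_0$; the interval $[e_0,e_1]$ is $\{e_0,f_1,\dots,f_k,e_1\}$ with $e_0\prec f_1\prec\cdots\prec f_k\prec e_1$. A path is the image of a map from a path graph injective on edges; a cycle is the image of a map from a cycle graph injective on vertices and edges. For an oriented cycle $C$ and a vertex $v$ of $C$ with incoming/outgoing edges $e_{\mathrm{in}},e_{\mathrm{out}}$ in $C$, an edge at $v$ is to the left of $C$ if it lies in $[e_{\mathrm{out}},e_{\mathrm{in}}]$ and to the right if it lies in $[e_{\mathrm{in}},e_{\mathrm{out}}]$. A cycle $C$ is nonseparating if for any orientation of $C$ there is a path $P$ meeting $C$ only in its endpoints whose first edge is to the left of $C$ and last edge to the right of $C$; $(C,P)$ is a witness pair, proper if the endpoints of $P$ are distinct. A ribbon graph is nonplanar if it has a nonseparating cycle. Divisors: $\mathrm{Div}(G)$ is the free abelian group on $V(G)$; $\mathrm{Div}^d(G)$ the divisors of degree $d$. The Laplacian of $f:V\to\mathbb{Z}$ is $\Delta f=\sum_v\big(\sum_{e=\{v,w\}}(f(v)-f(w))\big)(v)$;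 its image is $\mathrm{Prin}(G)$, and $\mathrm{Pic}^d(G)=\mathrm{Div}^d(G)/\mathrm{Prin}(G)$. Let $g=|E(G)|-|V(G)|+1$. For a spanning tree $T$ with non-tree edges $f_1,\dots,f_g$, a break divisor for $T$ is $\sum_{i}(s_i)$ with $s_i$ an endpoint of $f_i$; every class in $\mathrm{Pic}^g(G)$ contains exactly one break divisor. Bernardi action: fix a vertex $q$ and an edge $e$ at $q$. For a spanning tree $T$, perform a tour starting at $q$, considering first the edge $e$: at the current vertex, edges are examined in cyclic order starting with the successor of the edge just used (at the start, starting with $e$); an edge not in $T$ is passed over, and the first edge of $T$ found is traversed. The tour ends upon returning to $q$ after traversing every edge of $T$ twice; each non-tree edge is passed over exactly twice, once from each endpoint. Placing a chip at the current vertex the first time each non-tree edge is passed over gives a break divisor $\beta_{(q,e)}(T)$, and $T\mapsto[\beta_{(q,e)}(T)]$ is a bijection $\mathcal{T}(G)\to\mathrm{Pic}^g(G)$. Define $\beta_q([D],T)=\beta_{(q,e)}^{-1}([D]+[\beta_{(q,e)}(T)])$; this does not depend on $e$. Rotor-routing action: fix a sink $q$. A rotor configuration assigns to each vertex $w\neq q$ an incident edge (its rotor) and has a chip at a vertex. A step with chip at $v\neq q$ advances the rotor at $v$ to its successor in the cyclic order at $v$ and moves the chip along this new rotor to its other endpoint. For a spanning tree $T$, let $\sigma_T(w)$ be the first edge of the $T$-path from $w$ to $q$. Starting from $\sigma_T$ with chip at $v$, iterate until the chip reaches $q$; the final rotors form a spanning tree $T'$, and $\rho_q([(v)-(q)],T)=T'$.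 This extends to a well-defined action $\rho_q$ of $\mathrm{Pic}^0(G)$ on $\mathcal{T}(G)$. *)

theory Defs
  imports
    "HOL-Algebra.Free_Abelian_Groups"
    "HOL-Combinatorics.Orbits"
    "HOL-Library.While_Combinator"
begin

section \<open>Ribbon graphs\<close>

record ('v, 'e) ribbon_graph =
  verts :: "'v set"
  edges :: "'e set"
  ends :: "'e \<Rightarrow> 'v set"
  nxt :: "'v \<Rightarrow> 'e \<Rightarrow> 'e"  \<comment> \<open>\<open>nxt G v e\<close> is the immediate successor of \<open>e\<close> in the cyclic order at \<open>v\<close>\<close>

definition inc :: "('v, 'e) ribbon_graph \<Rightarrow> 'v \<Rightarrow> 'e set" where
  "inc G v = {e \<in> edges G. v \<in> ends G e}"

definition opp :: "('v, 'e) ribbon_graph \<Rightarrow> 'v \<Rightarrow> 'e \<Rightarrow> 'v" where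
  "opp G v e = (THE w. ends G e = {v, w})"

text \<open>A path is a pair \<open>(vs, es)\<close>, the vertices and the edges in the order in which they are
  traversed. Edges may not repeat, vertices may; in particular a path may be closed.\<close>

definition path :: "('v, 'e) ribbon_graph \<Rightarrow> 'v list \<times> 'e list \<Rightarrow> bool" where
  "path G = (\<lambda>(vs, es). length vs = Suc (length es) \<and> distinct es \<and>
     set vs \<subseteq> verts G \<and> set es \<subseteq> edges G \<and>
     (\<forall>i < length es. ends G (es ! i) = {vs ! i, vs ! Suc i}))"

definition joined_in :: "('v, 'e) ribbon_graph \<Rightarrow> 'e set \<Rightarrow> 'v \<Rightarrow> 'v \<Rightarrow> bool" where
  "joined_in G F u w \<longleftrightarrow>
     (\<exists>vs es. path G (vs, es) \<and> set es \<subseteq> F \<and> hd vs = u \<and> last vs = w)"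

text \<open>Loops are excluded by requiring two distinct ends; parallel edges are allowed. The single
  condition \<open>cyclic_on\<close> says that \<open>nxt G v\<close> permutes the edges at \<open>v\<close> in one cycle.\<close>

locale ribbon_graph =
  fixes G :: "('v, 'e) ribbon_graph"
  assumes finite_verts: "finite (verts G)"
    and verts_nonempty: "verts G \<noteq> {}"
    and finite_edges: "finite (edges G)"
    and ends_verts: "e \<in> edges G \<Longrightarrow> ends G e \<subseteq> verts G"
    and card_ends: "e \<in> edges G \<Longrightarrow> card (ends G e) = 2"
    and connected: "u \<in> verts G \<Longrightarrow> w \<in> verts G \<Longrightarrow> joined_in G (edges G) u w"
    and cyclic_nxt: "v \<in> verts G \<Longrightarrow> inc G v \<noteq> {} \<Longrightarrow> cyclic_on (nxt G v) (inc G v)"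

text \<open>The interval \<open>[e\<^sub>0, e\<^sub>1]\<close> of edges at \<open>v\<close>, both ends included.\<close>

definition interval :: "('v, 'e) ribbon_graph \<Rightarrow> 'v \<Rightarrow> 'e \<Rightarrow> 'e \<Rightarrow> 'e set" where
  "interval G v e0 e1 =
     (\<lambda>k. (nxt G v ^^ k) e0) ` {.. (LEAST k. (nxt G v ^^ k) e0 = e1)}"


section \<open>Nonseparating cycles and witness pairs\<close>

text \<open>An oriented cycle is a pair \<open>(vs, es)\<close> of lists of the same length \<open>n \<ge> 2\<close> such that
  \<open>es ! i\<close> leads from \<open>vs ! i\<close> to \<open>vs ! (i + 1)\<close>, indices modulo \<open>n\<close>. The underlying cycle is the
  subgraph \<open>(set vs, set es)\<close>, and the oriented cycles with this underlying subgraph (read up to the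
  choice of the starting vertex) are its two orientations.\<close>

definition oriented_cycle :: "('v, 'e) ribbon_graph \<Rightarrow> 'v list \<times> 'e list \<Rightarrow> bool" where
  "oriented_cycle G = (\<lambda>(vs, es). length vs = length es \<and> 2 \<le> length es \<and>
     distinct vs \<and> distinct es \<and> set vs \<subseteq> verts G \<and> set es \<subseteq> edges G \<and>
     (\<forall>i < length es. ends G (es ! i) = {vs ! i, vs ! (Suc i mod length es)}))"

definition underlying :: "'v list \<times> 'e list \<Rightarrow> 'v set \<times> 'e set" where
  "underlying = (\<lambda>(vs, es). (set vs, set es))"

definition orientation_of ::
    "('v, 'e) ribbon_graph \<Rightarrow> 'v list \<times> 'e list \<Rightarrow> 'v set \<times> 'e set \<Rightarrow> bool" where
  "orientation_of G c C \<longleftrightarrow> oriented_cycle G c \<and> underlying c = C"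

definition is_cycle :: "('v, 'e) ribbon_graph \<Rightarrow> 'v set \<times> 'e set \<Rightarrow> bool" where
  "is_cycle G C \<longleftrightarrow> (\<exists>c. orientation_of G c C)"

definition out_edge :: "'v list \<times> 'e list \<Rightarrow> nat \<Rightarrow> 'e" where
  "out_edge = (\<lambda>(vs, es) i. es ! i)"

definition in_edge :: "'v list \<times> 'e list \<Rightarrow> nat \<Rightarrow> 'e" where
  "in_edge = (\<lambda>(vs, es) i. es ! ((i + length es - 1) mod length es))"

definition left_of ::
    "('v, 'e) ribbon_graph \<Rightarrow> 'v list \<times> 'e list \<Rightarrow> 'v \<Rightarrow> 'e \<Rightarrow> bool" where
  "left_of G c v f \<longleftrightarrow>
     (\<exists>i < length (fst c). fst c ! i = v \<and> f \<in> interval G v (out_edge c i) (in_edge c i))"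

definition right_of ::
    "('v, 'e) ribbon_graph \<Rightarrow> 'v list \<times> 'e list \<Rightarrow> 'v \<Rightarrow> 'e \<Rightarrow> bool" where
  "right_of G c v f \<longleftrightarrow>
     (\<exists>i < length (fst c). fst c ! i = v \<and> f \<in> interval G v (in_edge c i) (out_edge c i))"

text \<open>The path meets the cycle only in its endpoints: it shares no edge with the cycle, and of the
  vertices it visits exactly the first and the last one lie on the cycle. The path does not return to
  the cycle in between, not even at one of its endpoints.\<close>

definition meets_only_in_endpoints :: "'v list \<times> 'e list \<Rightarrow> 'v set \<times> 'e set \<Rightarrow> bool" where
  "meets_only_in_endpoints = (\<lambda>(vs, es) (A, F).
     set es \<inter> F = {} \<and> (\<forall>i < length vs. vs ! i \<in> A \<longleftrightarrow> i = 0 \<or> Suc i = length vs))"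

definition crosses ::
    "('v, 'e) ribbon_graph \<Rightarrow> 'v list \<times> 'e list \<Rightarrow> 'v list \<times> 'e list \<Rightarrow> bool" where
  "crosses G P c \<longleftrightarrow> path G P \<and> snd P \<noteq> [] \<and> meets_only_in_endpoints P (underlying c) \<and>
     left_of G c (hd (fst P)) (hd (snd P)) \<and> right_of G c (last (fst P)) (last (snd P))"

definition nonseparating :: "('v, 'e) ribbon_graph \<Rightarrow> 'v set \<times> 'e set \<Rightarrow> bool" where
  "nonseparating G C \<longleftrightarrow>
     is_cycle G C \<and> (\<forall>c. orientation_of G c C \<longrightarrow> (\<exists>P. crosses G P c))"

definition witness_pair ::
    "('v, 'e) ribbon_graph \<Rightarrow> 'v set \<times> 'e set \<Rightarrow> 'v list \<times> 'e list \<Rightarrow> bool" where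
  "witness_pair G C P \<longleftrightarrow>
     nonseparating G C \<and> (\<exists>c. orientation_of G c C \<and> crosses G P c)"

definition proper_witness_pair ::
    "('v, 'e) ribbon_graph \<Rightarrow> 'v set \<times> 'e set \<Rightarrow> 'v list \<times> 'e list \<Rightarrow> bool" where
  "proper_witness_pair G C P \<longleftrightarrow> witness_pair G C P \<and> hd (fst P) \<noteq> last (fst P)"

definition nonplanar :: "('v, 'e) ribbon_graph \<Rightarrow> bool" where
  "nonplanar G \<longleftrightarrow> (\<exists>C. nonseparating G C)"


section \<open>Spanning trees\<close>

definition spanning_trees :: "('v, 'e) ribbon_graph \<Rightarrow> 'e set set" where
  "spanning_trees G = {T. T \<subseteq> edges G \<and>
     (\<forall>u \<in> verts G. \<forall>w \<in> verts G. joined_in G T u w) \<and>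
     \<not> (\<exists>vs es. oriented_cycle G (vs, es) \<and> set es \<subseteq> T)}"


section \<open>Divisors and the Picard group\<close>

definition Div :: "('v, 'e) ribbon_graph \<Rightarrow> ('v \<Rightarrow>\<^sub>0 int) monoid" where
  "Div G = free_Abelian_group (verts G)"

definition deg :: "('v \<Rightarrow>\<^sub>0 int) \<Rightarrow> int" where
  "deg D = (\<Sum>v \<in> Poly_Mapping.keys D. Poly_Mapping.lookup D v)"

definition laplacian :: "('v, 'e) ribbon_graph \<Rightarrow> ('v \<Rightarrow> int) \<Rightarrow> ('v \<Rightarrow>\<^sub>0 int)" where
  "laplacian G f = (\<Sum>v \<in> verts G. frag_cmul (\<Sum>e \<in> inc G v. f v - f (opp G v e)) (frag_of v))"

definition Prin :: "('v, 'e) ribbon_graph \<Rightarrow> ('v \<Rightarrow>\<^sub>0 int) set" where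
  "Prin G = range (laplacian G)"

definition Pic :: "('v, 'e) ribbon_graph \<Rightarrow> ('v \<Rightarrow>\<^sub>0 int) set monoid" where
  "Pic G = Div G Mod Prin G"

definition divisor_class ::
    "('v, 'e) ribbon_graph \<Rightarrow> ('v \<Rightarrow>\<^sub>0 int) \<Rightarrow> ('v \<Rightarrow>\<^sub>0 int) set" where
  "divisor_class G D = Prin G #>\<^bsub>Div G\<^esub> D"

definition Pic_deg :: "('v, 'e) ribbon_graph \<Rightarrow> int \<Rightarrow> ('v \<Rightarrow>\<^sub>0 int) set set" where
  "Pic_deg G d = divisor_class G ` {D \<in> carrier (Div G). deg D = d}"


section \<open>The Bernardi action\<close>

text \<open>A state \<open>(v, f)\<close> of the tour means that \<open>f\<close> is the edge about to be examined at the current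
  vertex \<open>v\<close>.\<close>

definition tour_step :: "('v, 'e) ribbon_graph \<Rightarrow> 'e set \<Rightarrow> 'v \<times> 'e \<Rightarrow> 'v \<times> 'e" where
  "tour_step G T = (\<lambda>(v, f).
     if f \<in> T then (opp G v f, nxt G (opp G v f) f) else (v, nxt G v f))"

text \<open>The tour is not stopped explicitly: it is a cyclic walk through all \<open>2|E|\<close> pairs of a vertex and
  an edge at it, so continuing past its end merely repeats it, and the vertex at which a non-tree edge
  is passed over for the first time is not affected.\<close>

definition chip_position ::
    "('v, 'e) ribbon_graph \<Rightarrow> 'v \<times> 'e \<Rightarrow> 'e set \<Rightarrow> 'e \<Rightarrow> 'v" where
  "chip_position G s T f =
     fst ((tour_step G T ^^ (LEAST n. snd ((tour_step G T ^^ n) s) = f)) s)"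

definition bernardi_divisor ::
    "('v, 'e) ribbon_graph \<Rightarrow> 'v \<times> 'e \<Rightarrow> 'e set \<Rightarrow> ('v \<Rightarrow>\<^sub>0 int)" where
  "bernardi_divisor G s T = (\<Sum>f \<in> edges G - T. frag_of (chip_position G s T f))"

definition bernardi_class ::
    "('v, 'e) ribbon_graph \<Rightarrow> 'v \<times> 'e \<Rightarrow> 'e set \<Rightarrow> ('v \<Rightarrow>\<^sub>0 int) set" where
  "bernardi_class G s T = divisor_class G (bernardi_divisor G s T)"

definition bernardi_action_from ::
    "('v, 'e) ribbon_graph \<Rightarrow> 'v \<times> 'e \<Rightarrow> ('v \<Rightarrow>\<^sub>0 int) set \<Rightarrow> 'e set \<Rightarrow> 'e set" where
  "bernardi_action_from G s x T =
     inv_into (spanning_trees G) (bernardi_class G s) (x \<otimes>\<^bsub>Pic G\<^esub> bernardi_class G s T)"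

text \<open>The action does not depend on the starting edge at \<open>q\<close>.\<close>

definition bernardi_action ::
    "('v, 'e) ribbon_graph \<Rightarrow> 'v \<Rightarrow> ('v \<Rightarrow>\<^sub>0 int) set \<Rightarrow> 'e set \<Rightarrow> 'e set" where
  "bernardi_action G q = bernardi_action_from G (q, SOME e. e \<in> inc G q)"


section \<open>The rotor-routing action\<close>

definition tree_rotors :: "('v, 'e) ribbon_graph \<Rightarrow> 'v \<Rightarrow> 'e set \<Rightarrow> 'v \<Rightarrow> 'e" where
  "tree_rotors G q T w = (THE e. \<exists>vs es. path G (vs, es) \<and> set es \<subseteq> T \<and> es \<noteq> [] \<and>
     hd vs = w \<and> last vs = q \<and> hd es = e)"

definition rotor_step ::
    "('v, 'e) ribbon_graph \<Rightarrow> ('v \<Rightarrow> 'e) \<times> 'v \<Rightarrow> ('v \<Rightarrow> 'e) \<times> 'v" where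
  "rotor_step G = (\<lambda>(\<sigma>, v). let e = nxt G v (\<sigma> v) in (\<sigma>(v := e), opp G v e))"

text \<open>Rotors are read only at vertices other than the sink \<open>q\<close>. For \<open>v = q\<close> no step is made and the
  tree is returned unchanged.\<close>

definition route :: "('v, 'e) ribbon_graph \<Rightarrow> 'v \<Rightarrow> 'v \<Rightarrow> 'e set \<Rightarrow> 'e set" where
  "route G q v T =
     fst (while (\<lambda>(\<sigma>, u). u \<noteq> q) (rotor_step G) (tree_rotors G q T, v)) ` (verts G - {q})"

text \<open>The extension to \<open>Pic\<^sup>0\<close>: as \<open>Pic\<^sup>0\<close> is finite and generated by the classes of \<open>(v) - (q)\<close>, each
  of its elements is the class of a sum of divisors \<open>(v) - (q)\<close>, and it acts by routing the chips of
  such a sum to \<open>q\<close> one after the other. The outcome depends neither on the choice of the sum nor on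
  the order of its terms, which justifies the definite description.\<close>

definition rotor_action ::
    "('v, 'e) ribbon_graph \<Rightarrow> 'v \<Rightarrow> ('v \<Rightarrow>\<^sub>0 int) set \<Rightarrow> 'e set \<Rightarrow> 'e set" where
  "rotor_action G q x T = (THE T'. \<exists>vs. set vs \<subseteq> verts G \<and>
     divisor_class G (\<Sum>v\<leftarrow>vs. frag_of v - frag_of q) = x \<and> T' = fold (route G q) vs T)"

end

theory Submission
  imports Defs
begin

text \<open>Let \<open>b\<close> be a vertex and let \<open>U\<close> be a component of \<open>G - b\<close>. Fix a spanning tree of \<open>U\<close> and one of
  the rest; each edge \<open>g\<close> from \<open>b\<close> to \<open>U\<close> joins them to a spanning tree \<open>T\<^sub>g\<close>. For two such edges \<open>e\<^sub>0\<close>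
  and \<open>f\<close> that are neighbours in the cyclic order at \<open>b\<close> and a sink \<open>q \<in> U\<close>, the trees differ only in
  the rotor at \<open>b\<close>, and turning it from \<open>e\<^sub>0\<close> to \<open>f\<close> sends exactly one chip into \<open>U\<close>, along \<open>f\<close>. If the
  tour from \<open>q\<close> meets \<open>e\<^sub>0\<close> before \<open>f\<close>, then on \<open>U\<close> the Bernardi divisors differ by the endpoints of the
  edges from \<open>b\<close> met from \<open>e\<^sub>0\<close> up to just before \<open>f\<close>. If the two actions agreed, the divisor that counts
  the endpoints in \<open>U\<close> of the edges met from \<open>e\<^sub>0\<close> to \<open>f\<close> would coincide on \<open>U\<close> with a principal divisor.
  The maximum principle excludes this as soon as one edge from \<open>b\<close> to \<open>U\<close> is not among them.

  Such a pair \<open>e\<^sub>0\<close>, \<open>f\<close> exists unless the tour meets the edges from \<open>b\<close> to \<open>U\<close> in the reverse of their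
  cyclic order at \<open>b\<close>. A proper witness pair consists of three paths from \<open>a\<close> to \<open>b\<close> that leave \<open>a\<close> and
  arrive at \<open>b\<close> in the same cyclic order. They survive in \<open>U\<close> because \<open>a \<noteq> b\<close>, and the tour from \<open>q = a\<close>
  of a tree that contains them meets their last edges in the order of their first edges, which rules out
  the reverse order.\<close>

section \<open>Connectivity and forests\<close>

text \<open>The comparison is confined to \<open>U\<close> because there the tours of all the trees
  \<open>T_g\<close> copy one common tour, whereas the chips outside \<open>U\<close> vary with the
  tree in a less controlled way. A Laplacian at a vertex of \<open>U\<close> involves only values on
  \<open>U\<close> and at \<open>b\<close>, which is all that the maximum principle uses. Neighbours
  are meant among the edges to \<open>U\<close>: other edges at \<open>b\<close> may lie between
  them, but the chips sent along those stay outside \<open>U\<close>.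

  The direction of the pair is essential. If the tour met \<open>f\<close> before \<open>e0\<close>,
  the chip sent along \<open>f\<close> would cancel a Bernardi chip, and what remains would count,
  with negative sign, the edges met strictly between \<open>f\<close> and \<open>e0\<close>. When
  there are none, nothing contradicts agreement.

  Rotor-routing is handled through the number of advances of each rotor. A full turn at a vertex is
  a firing of that vertex, so it changes chips by a principal divisor and leaves the rotors alone.
  This one observation yields termination, independence of the chosen chips, and the freedom to
  replace an unknown routing by the obvious turn at \<open>b\<close>.\<close>

context ribbon_graph
begin

lemma inc_edges: "e \<in> inc G v \<Longrightarrow> e \<in> edges G"
  by (simp add: inc_def)

lemma finite_inc: "finite (inc G v)"
  using finite_edges by (simp add: inc_def)

lemma inc_verts: "e \<in> inc G v \<Longrightarrow> v \<in> verts G"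
  using ends_verts by (auto simp: inc_def)

lemma ends_neq: "e \<in> edges G \<Longrightarrow> ends G e = {x, y} \<Longrightarrow> x \<noteq> y"
  using card_ends[of e] by auto

lemma ends_inc:
  assumes "e \<in> edges G" "ends G e = {x, y}"
  shows "e \<in> inc G x" "e \<in> inc G y" "x \<in> verts G" "y \<in> verts G"
  using assms ends_verts[of e] by (auto simp: inc_def)

lemma opp_eq: "ends G e = {v, w} \<Longrightarrow> opp G v e = w"
  unfolding opp_def by (rule the_equality) (auto simp: doubleton_eq_iff)

lemma ends_opp: "e \<in> inc G v \<Longrightarrow> ends G e = {v, opp G v e}"
proof -
  assume e: "e \<in> inc G v"
  then obtain x y where "ends G e = {x, y}"
    using card_ends[of e] by (auto simp: inc_def card_2_iff)
  with e have "\<exists>w. ends G e = {v, w}" by (auto simp: inc_def)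
  then obtain w where "ends G e = {v, w}" by blast
  then show ?thesis by (simp add: opp_eq)
qed

lemma opp_inc: "e \<in> inc G v \<Longrightarrow> e \<in> inc G (opp G v e)"
  using ends_opp inc_edges ends_inc by metis

lemma opp_verts: "e \<in> inc G v \<Longrightarrow> opp G v e \<in> verts G"
  using opp_inc inc_verts by blast

lemma opp_opp: "e \<in> inc G v \<Longrightarrow> opp G (opp G v e) e = v"
  by (rule opp_eq) (use ends_opp in auto)

text \<open>Paths in \<open>joined_in\<close> never repeat an edge and are awkward to concatenate.
  Arbitrary walks give an equivalence relation with induction; \<open>joined_in_iff_conn\<close>
  relates the two.\<close>

definition conn :: "'e set \<Rightarrow> 'v \<Rightarrow> 'v \<Rightarrow> bool" where
  "conn F u w \<longleftrightarrow> (u, w) \<in> {(x, y). \<exists>e\<in>F. ends G e = {x, y}}\<^sup>*"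

lemma conn_refl [simp]: "conn F u u"
  by (simp add: conn_def)

lemma conn_sym: "conn F u w \<Longrightarrow> conn F w u"
proof -
  have "sym {(x, y). \<exists>e\<in>F. ends G e = {x, y}}"
    by (auto simp: sym_def insert_commute)
  then show "conn F u w \<Longrightarrow> conn F w u"
    unfolding conn_def by (meson sym_rtrancl symE)
qed

lemma conn_trans: "conn F u w \<Longrightarrow> conn F w z \<Longrightarrow> conn F u z"
  unfolding conn_def by (rule rtrancl_trans)

lemma conn_mono: "conn F u w \<Longrightarrow> F \<subseteq> F' \<Longrightarrow> conn F' u w"
  unfolding conn_def by (rule rtrancl_mono[THEN subsetD]) auto

lemma conn_edge: "e \<in> F \<Longrightarrow> ends G e = {x, y} \<Longrightarrow> conn F x y"
  unfolding conn_def by (rule r_into_rtrancl) auto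

lemma conn_opp: "e \<in> F \<Longrightarrow> e \<in> inc G x \<Longrightarrow> conn F x (opp G x e)"
  using conn_edge ends_opp by blast

lemma conn_induct [consumes 1, case_names base step]:
  assumes "conn F u w" "P u"
    "\<And>x y e. conn F u x \<Longrightarrow> e \<in> F \<Longrightarrow> ends G e = {x, y} \<Longrightarrow> P x \<Longrightarrow> P y"
  shows "P w"
  using assms(1) unfolding conn_def
proof (induction rule: rtrancl_induct)
  case base then show ?case by (rule assms(2))
next
  case (step y z)
  then show ?case using assms(3)[unfolded conn_def] by blast
qed

lemma conn_minimal:
  assumes "conn F u w" "\<And>e x y. e \<in> F \<Longrightarrow> ends G e = {x, y} \<Longrightarrow> conn F' x y"
  shows "conn F' u w"
  using assms(1) by (induction rule: conn_induct) (auto intro: conn_trans assms(2))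

lemma conn_closed:
  assumes "conn F u w" "\<And>e. e \<in> F \<Longrightarrow> ends G e \<subseteq> W \<or> ends G e \<inter> W = {}"
  shows "u \<in> W \<longleftrightarrow> w \<in> W"
  using assms(1)
proof (induction rule: conn_induct)
  case (step x y e)
  then show ?case using assms(2)[of e] by auto
qed simp

lemma conn_verts:
  assumes "conn F u w" "F \<subseteq> edges G" "u \<in> verts G"
  shows "w \<in> verts G"
  using assms(1)
proof (induction rule: conn_induct)
  case (step x y e)
  then show ?case using ends_verts assms(2) by fastforce
qed fact

text \<open>Of a walk that may use \<open>g\<close> many times, only the first arrival at
  \<open>g\<close> and the last departure from it matter.\<close>

lemma conn_split:
  assumes "conn (insert g F) u w" "ends G g = {x, y}"
  shows "conn F u w \<or> (conn F u x \<and> conn F y w) \<or> (conn F u y \<and> conn F x w)"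
  using assms(1)
proof (induction rule: conn_induct)
  case (step s t e)
  show ?case
  proof (cases "e \<in> F")
    case True
    then have "conn F s t" using step conn_edge by blast
    then show ?thesis using step.IH conn_trans by blast
  next
    case False
    then have "{s, t} = {x, y}" using step assms(2) by auto
    then show ?thesis using step.IH by (auto simp: doubleton_eq_iff)
  qed
qed simp

lemma conn_split_Diff:
  assumes "conn F u w" "ends G g = {x, y}"
  shows "conn (F - {g}) u w \<or> (conn (F - {g}) u x \<and> conn (F - {g}) y w) \<or>
    (conn (F - {g}) u y \<and> conn (F - {g}) x w)"
proof (rule conn_split[OF _ assms(2)])
  show "conn (insert g (F - {g})) u w" by (rule conn_mono[OF assms(1)]) auto
qed

text \<open>Acyclicity in the form that every edge is a cut edge, which avoids lists of vertices;
  \<open>forest_iff_no_cycle\<close> relates it to \<open>oriented_cycle\<close>.\<close>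

definition forest :: "'e set \<Rightarrow> bool" where
  "forest F \<longleftrightarrow> (\<forall>e\<in>F. \<forall>x y. ends G e = {x, y} \<longrightarrow> \<not> conn (F - {e}) x y)"

lemma forestD: "forest F \<Longrightarrow> e \<in> F \<Longrightarrow> ends G e = {x, y} \<Longrightarrow> \<not> conn (F - {e}) x y"
  by (auto simp: forest_def)

lemma forest_subset: "forest F \<Longrightarrow> F' \<subseteq> F \<Longrightarrow> forest F'"
  unfolding forest_def by (meson Diff_mono conn_mono order_refl subsetD)

text \<open>If an old edge \<open>e\<close> stopped being a cut edge, a walk joining its ends
  without \<open>e\<close> would use \<open>g\<close>; closing that walk by \<open>e\<close> would
  join \<open>x\<close> to \<open>y\<close> within \<open>F\<close>.\<close>

lemma forest_insert:
  assumes "forest F" "ends G g = {x, y}" "\<not> conn F x y"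
  shows "forest (insert g F)"
  unfolding forest_def
proof (intro ballI allI impI notI)
  fix e p r assume e: "e \<in> insert g F" "ends G e = {p, r}" "conn (insert g F - {e}) p r"
  have gF: "g \<notin> F" using assms conn_edge by blast
  show False
  proof (cases "e = g")
    case True
    then have "{p, r} = {x, y}" using e assms by simp
    moreover have "conn F p r" using e True gF by simp
    ultimately show False using assms(3) conn_sym by (auto simp: doubleton_eq_iff)
  next
    case False
    then have eF: "e \<in> F" using e by simp
    have "conn (insert g (F - {e})) p r"
      using e(3) by (rule conn_mono) auto
    from conn_split[OF this assms(2)] forestD[OF assms(1) eF e(2)]
    have "(conn (F - {e}) p x \<and> conn (F - {e}) y r) \<or> (conn (F - {e}) p y \<and> conn (F - {e}) x r)"
      by blast
    then have "(conn F p x \<and> conn F y r) \<or> (conn F p y \<and> conn F x r)"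
      using conn_mono[of "F - {e}" _ _ F] by blast
    moreover have "conn F p r" using eF e(2) conn_edge by blast
    ultimately show False using assms(3) by (meson conn_sym conn_trans)
  qed
qed

text \<open>A maximal forest between \<open>Y\<close> and \<open>E\<close> joins the ends of every
  edge of \<open>E\<close>, since otherwise that edge could be added.\<close>

lemma forest_extend:
  assumes "forest Y" "Y \<subseteq> E" "E \<subseteq> edges G"
  obtains F where "forest F" "Y \<subseteq> F" "F \<subseteq> E" "\<And>u w. conn E u w \<Longrightarrow> conn F u w"
proof -
  let ?X = "{F. forest F \<and> Y \<subseteq> F \<and> F \<subseteq> E}"
  have "finite ?X" using finite_subset[OF assms(3) finite_edges] by simp
  moreover have "Y \<in> ?X" using assms by simp
  then have "?X \<noteq> {}" by blast
  ultimately have "\<exists>F\<in>?X. \<forall>F'\<in>?X. F \<subseteq> F' \<longrightarrow> F = F'" by (rule finite_has_maximal)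
  then obtain F where F: "F \<in> ?X" and mx: "\<forall>F'\<in>?X. F \<subseteq> F' \<longrightarrow> F = F'" by (rule bexE)
  have edge: "conn F x y" if "e \<in> E" "ends G e = {x, y}" for e x y
  proof (rule ccontr)
    assume n: "\<not> conn F x y"
    then have "forest (insert e F)" using F that forest_insert by blast
    then have "F = insert e F" using bspec[OF mx, of "insert e F"] F that by auto
    then show False using n that conn_edge by blast
  qed
  show ?thesis
  proof (rule that)
    show "conn F u w" if "conn E u w" for u w
      using conn_minimal[OF that edge] .
  qed (use F in auto)
qed

text \<open>The hypotheses say that \<open>e1\<close> and \<open>e2\<close> both lead from \<open>w\<close> towards \<open>q\<close>.\<close>

lemma forest_first_edge_unique:
  assumes F: "forest F" and e1: "e1 \<in> F" "e1 \<in> inc G w" "conn (F - {e1}) (opp G w e1) q"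
    and e2: "e2 \<in> F" "e2 \<in> inc G w" "conn (F - {e2}) (opp G w e2) q"
  shows "e1 = e2"
proof (rule ccontr)
  assume ne: "e1 \<noteq> e2"
  let ?y1 = "opp G w e1" and ?y2 = "opp G w e2" and ?F = "F - {e2} - {e1}"
  have n1: "\<not> conn (F - {e1}) w ?y1" and n2: "\<not> conn (F - {e2}) w ?y2"
    using forestD[OF F] e1 e2 ends_opp by blast+
  have w2: "conn (F - {e1}) w ?y2" using e2 ne conn_opp by simp
  have le: "?F \<subseteq> F - {e1}" "?F \<subseteq> F - {e2}" by auto
  from conn_split_Diff[OF e2(3) ends_opp[OF e1(2)]]
  consider "conn ?F ?y2 q" | "conn ?F ?y2 w" | "conn ?F w q" by blast
  then show False
  proof cases
    case 1
    then have "conn (F - {e1}) ?y2 q" using conn_mono le by blast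
    then show False using n1 w2 e1(3) by (meson conn_sym conn_trans)
  next
    case 2
    then have "conn (F - {e2}) ?y2 w" using conn_mono le by blast
    then show False using n2 conn_sym by blast
  next
    case 3
    then have "conn (F - {e1}) w q" using conn_mono le by blast
    then show False using n1 e1(3) by (meson conn_sym conn_trans)
  qed
qed

section \<open>Walks, simple paths and cycles\<close>

lemma path_conn_aux:
  assumes "\<forall>i<length es. ends G (es ! i) = {vs ! i, vs ! Suc i}" "i \<le> j" "j \<le> length es"
  shows "conn (set (take j (drop i es))) (vs ! i) (vs ! j)"
  using assms(2,3)
proof (induction j rule: dec_induct)
  case (step n)
  have "conn (set (take (Suc n) (drop i es))) (vs ! i) (vs ! n)" if "n < length es"
    using step that by (intro conn_mono[OF step.IH] set_take_subset_set_take) auto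
  moreover have "es ! n \<in> set (take (Suc n) (drop i es))" if "n < length es"
    using step that by (auto simp: in_set_conv_nth intro!: exI[of _ "n - i"])
  then have "conn (set (take (Suc n) (drop i es))) (vs ! n) (vs ! Suc n)" if "n < length es"
    using conn_edge assms(1) that by blast
  ultimately show ?case using step conn_trans by (meson Suc_le_lessD)
qed simp

lemma path_conn:
  assumes "length vs = Suc (length es)"
    "\<forall>i<length es. ends G (es ! i) = {vs ! i, vs ! Suc i}" "set es \<subseteq> F"
  shows "conn F (hd vs) (last vs)"
proof -
  have "conn (set (take (length es) (drop 0 es))) (vs ! 0) (vs ! length es)"
    using path_conn_aux[OF assms(2), of 0 "length es"] by simp
  moreover have "vs \<noteq> []" using assms(1) by auto
  ultimately have "conn (set es) (hd vs) (last vs)"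
    using assms(1) by (simp add: last_conv_nth hd_conv_nth)
  then show ?thesis using assms(3) conn_mono by blast
qed

text \<open>Loop erasure. The path is grown at its head, from the current vertex back to
  \<open>u\<close>, so that a vertex met again cuts off an initial segment by \<open>drop\<close>; a
  reversal at the end restores the direction.\<close>

lemma conn_simple_path:
  assumes "conn F u w" "F \<subseteq> edges G" "u \<in> verts G"
  obtains vs es where "path G (vs, es)" "distinct vs" "set es \<subseteq> F" "hd vs = u" "last vs = w"
proof -
  have "\<exists>vs es. path G (vs, es) \<and> distinct vs \<and> set es \<subseteq> F \<and> hd vs = w \<and> last vs = u"
    using assms(1)
  proof (induction rule: conn_induct)
    case base
    show ?case by (rule exI[of _ "[u]"], rule exI[of _ "[]"]) (use assms in \<open>auto simp: path_def\<close>)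
  next
    case (step x y e)
    then obtain vs es where p: "path G (vs, es)" "distinct vs" "set es \<subseteq> F" "hd vs = x" "last vs = u"
      by blast
    have pe: "length vs = Suc (length es)" "distinct es" "set vs \<subseteq> verts G" "set es \<subseteq> edges G"
      "\<forall>i<length es. ends G (es ! i) = {vs ! i, vs ! Suc i}" using p by (auto simp: path_def)
    show ?case
    proof (cases "y \<in> set vs")
      case True
      then obtain k where k: "k < length vs" "vs ! k = y" by (auto simp: in_set_conv_nth)
      have "path G (drop k vs, drop k es)"
        using pe k by (auto simp: path_def Suc_diff_le dest: in_set_dropD)
      moreover have "distinct (drop k vs)" using p by simp
      moreover have "set (drop k es) \<subseteq> F" using p by (auto dest: in_set_dropD)
      moreover have "hd (drop k vs) = y" "last (drop k vs) = u" using k p by (auto simp: hd_drop_conv_nth)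
      ultimately show ?thesis by blast
    next
      case False
      have "e \<notin> set es"
      proof
        assume "e \<in> set es"
        then obtain i where "i < length es" "es ! i = e" by (auto simp: in_set_conv_nth)
        then have "ends G e \<subseteq> set vs" using pe by auto
        then show False using step False by auto
      qed
      moreover have "x = vs ! 0" using p pe by (cases vs) auto
      ultimately have "path G (y # vs, e # es)"
        using pe step assms ends_verts[of e] by (auto simp: path_def nth_Cons' insert_commute)
      moreover have "hd (y # vs) = y" "last (y # vs) = u" using p pe by auto
      moreover have "distinct (y # vs)" using False p by simp
      moreover have "set (e # es) \<subseteq> F" using p step by simp
      ultimately show ?thesis by blast
    qed
  qed
  then obtain vs es where p: "path G (vs, es)" "distinct vs" "set es \<subseteq> F" "hd vs = w" "last vs = u"
    by blast
  have l: "length vs = Suc (length es)" using p by (simp add: path_def)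
  have "ends G (rev es ! i) = {rev vs ! i, rev vs ! Suc i}" if "i < length es" for i
  proof -
    have "ends G (es ! (length es - Suc i)) = {vs ! (length es - Suc i), vs ! Suc (length es - Suc i)}"
      using p that by (simp add: path_def)
    then show ?thesis using that l by (auto simp: rev_nth Suc_diff_Suc insert_commute)
  qed
  then have "path G (rev vs, rev es)" using p l by (auto simp: path_def)
  moreover have "vs \<noteq> []" using l by auto
  ultimately show ?thesis using that[of "rev vs" "rev es"] p by (auto simp: hd_rev last_rev)
qed

lemma joined_in_iff_conn:
  assumes "F \<subseteq> edges G" "u \<in> verts G"
  shows "joined_in G F u w \<longleftrightarrow> conn F u w"
proof
  assume "joined_in G F u w"
  then show "conn F u w" unfolding joined_in_def path_def using path_conn by blast
next
  assume "conn F u w"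
  then show "joined_in G F u w"
    using conn_simple_path assms unfolding joined_in_def by metis
qed

lemma forest_iff_no_cycle:
  assumes "F \<subseteq> edges G"
  shows "forest F \<longleftrightarrow> \<not> (\<exists>vs es. oriented_cycle G (vs, es) \<and> set es \<subseteq> F)"
proof
  assume F: "forest F"
  show "\<not> (\<exists>vs es. oriented_cycle G (vs, es) \<and> set es \<subseteq> F)"
  proof
    assume "\<exists>vs es. oriented_cycle G (vs, es) \<and> set es \<subseteq> F"
    then obtain vs es where c: "length vs = length es" "2 \<le> length es" "distinct es" "set es \<subseteq> F"
      "\<forall>i<length es. ends G (es ! i) = {vs ! i, vs ! (Suc i mod length es)}"
      by (auto simp: oriented_cycle_def)
    define n where "n = length es - 1"
    have n: "length es = Suc n" using c n_def by simp
    have "conn (F - {es ! n}) (vs ! 0) (vs ! i)" if "i \<le> n" for i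
      using that
    proof (induction i)
      case (Suc i)
      have "es ! i \<in> F - {es ! n}" using Suc n c nth_eq_iff_index_eq[of es i n]
        by (auto simp: nth_mem subset_iff)
      moreover have "ends G (es ! i) = {vs ! i, vs ! Suc i}" using c n Suc by auto
      ultimately show ?case using Suc conn_edge conn_trans by (meson Suc_leD)
    qed simp
    then have "conn (F - {es ! n}) (vs ! n) (vs ! 0)" using conn_sym by blast
    moreover have "ends G (es ! n) = {vs ! n, vs ! 0}" "es ! n \<in> F" using c n by auto
    ultimately show False using forestD[OF F] by blast
  qed
next
  assume nc: "\<not> (\<exists>vs es. oriented_cycle G (vs, es) \<and> set es \<subseteq> F)"
  show "forest F"
    unfolding forest_def
  proof (intro ballI allI impI notI)
    fix e x y assume e: "e \<in> F" "ends G e = {x, y}" "conn (F - {e}) x y"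
    have xy: "x \<noteq> y" "x \<in> verts G" using e assms ends_neq ends_inc by blast+
    obtain vs es where p: "path G (vs, es)" "distinct vs" "set es \<subseteq> F - {e}" "hd vs = x" "last vs = y"
      using conn_simple_path[OF e(3) _ xy(2)] assms by blast
    have l: "length vs = Suc (length es)" and pe: "distinct es" "set vs \<subseteq> verts G" "set es \<subseteq> edges G"
      "\<forall>i<length es. ends G (es ! i) = {vs ! i, vs ! Suc i}" using p by (auto simp: path_def)
    have "es \<noteq> []" using xy p l by (cases vs) auto
    moreover have "vs \<noteq> []" using l by auto
    then have "vs ! 0 = x" "vs ! length es = y" using p l
      by (simp_all add: last_conv_nth hd_conv_nth)
    ultimately have "oriented_cycle G (vs, es @ [e])"
      using p l pe e assms
      by (auto simp: oriented_cycle_def nth_append less_Suc_eq insert_commute Suc_leI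
          mod_less[OF Suc_mono])
    moreover have "set (es @ [e]) \<subseteq> F" using p e by auto
    ultimately show False using nc by blast
  qed
qed

lemma spanning_trees_iff:
  "T \<in> spanning_trees G \<longleftrightarrow>
     T \<subseteq> edges G \<and> (\<forall>u\<in>verts G. \<forall>w\<in>verts G. conn T u w) \<and> forest T"
  unfolding spanning_trees_def
  by (auto simp: joined_in_iff_conn forest_iff_no_cycle)

lemma conn_edges: "u \<in> verts G \<Longrightarrow> w \<in> verts G \<Longrightarrow> conn (edges G) u w"
  using connected joined_in_iff_conn by blast

end


section \<open>Tours\<close>

lemma cyclic_on_funpow_dist1:
  assumes "cyclic_on f S" "x \<in> S"
  shows "funpow_dist1 f x x = card S"
proof -
  have x: "x \<in> orbit f x" and S: "S = orbit f x" using assms unfolding cyclic_on_alldef by auto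
  have "card S = card ((\<lambda>n. (f ^^ n) x) ` {0..<funpow_dist1 f x x})"
    by (subst S, subst orbit_conv_funpow_dist1[OF x]) (rule refl)
  also have "\<dots> = funpow_dist1 f x x"
    by (subst card_image[OF inj_on_funpow_dist1[OF x]]) simp
  finally show ?thesis ..
qed

lemma cyclic_on_funpow_card:
  assumes "cyclic_on f S" "x \<in> S"
  shows "(f ^^ card S) x = x"
proof -
  have "x \<in> orbit f x" using assms unfolding cyclic_on_alldef by auto
  from funpow_dist1_prop[OF this] show ?thesis unfolding cyclic_on_funpow_dist1[OF assms] .
qed

lemma cyclic_on_funpow_inj:
  assumes "cyclic_on f S" "x \<in> S" "k < card S" "l < card S" "(f ^^ k) x = (f ^^ l) x"
  shows "k = l"
proof -
  have "x \<in> orbit f x" using assms unfolding cyclic_on_alldef by auto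
  from inj_on_funpow_dist1[OF this] have "inj_on (\<lambda>n. (f ^^ n) x) {0..<card S}"
    unfolding cyclic_on_funpow_dist1[OF assms(1,2)] .
  then show ?thesis using assms by (simp add: inj_on_def)
qed

lemma cyclic_on_funpow_ex:
  assumes "cyclic_on f S" "x \<in> S" "y \<in> S"
  obtains k where "k < card S" "(f ^^ k) x = y"
proof -
  have x: "x \<in> orbit f x" and S: "S = orbit f x" using assms unfolding cyclic_on_alldef by auto
  from orbit_conv_funpow_dist1[OF x] have "orbit f x = (\<lambda>n. (f ^^ n) x) ` {0..<card S}"
    unfolding cyclic_on_funpow_dist1[OF assms(1,2)] .
  with assms(3) have "y \<in> (\<lambda>n. (f ^^ n) x) ` {0..<card S}" using S by metis
  then show ?thesis using that by auto
qed

lemma cyclic_on_funpow_mod: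
  assumes "cyclic_on f S" "x \<in> S"
  shows "(f ^^ (k mod card S)) x = (f ^^ k) x"
  by (rule funpow_mod_eq[OF cyclic_on_funpow_card[OF assms]])

lemma cyclic_on_inj:
  assumes "cyclic_on f S"
  shows "inj_on f S"
proof (rule inj_onI)
  fix x y assume xy: "x \<in> S" "y \<in> S" "f x = f y"
  obtain k where k: "k < card S" "(f ^^ k) x = y"
    using cyclic_on_funpow_ex[OF assms xy(1,2)] by blast
  have "card S > 0" using k by simp
  then have c: "Suc (card S - 1) = card S" by simp
  have "(f ^^ (card S - 1)) (f x) = x" "(f ^^ (card S - 1)) (f y) = y"
    using cyclic_on_funpow_card[OF assms xy(1)] cyclic_on_funpow_card[OF assms xy(2)]
    by (metis c comp_apply funpow_Suc_right)+
  then show "x = y" using xy(3) by simp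
qed

lemma funpow_closed: "(\<And>z. z \<in> S \<Longrightarrow> f z \<in> S) \<Longrightarrow> x \<in> S \<Longrightarrow> (f ^^ n) x \<in> S"
  by (induction n) auto

lemma inj_on_funpow_returns:
  assumes "finite S" "\<And>x. x \<in> S \<Longrightarrow> f x \<in> S" "inj_on f S" "x \<in> S"
  obtains n where "0 < n" "(f ^^ n) x = x"
proof -
  have S: "(f ^^ n) y \<in> S" if "y \<in> S" for n y
    using funpow_closed[of S f] assms(2) that by blast
  have "\<not> inj (\<lambda>n. (f ^^ n) x)"
    using S[OF assms(4)] assms(1) by (metis (no_types, lifting) UNIV_I finite_imageD finite_subset
        image_subsetI infinite_UNIV_nat)
  then obtain m n where mn: "m < n" "(f ^^ m) x = (f ^^ n) x"
    unfolding inj_def by (metis nat_neq_iff)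
  have "inj_on (f ^^ m) S"
  proof (induction m)
    case (Suc m)
    then show ?case using assms(3) S by (auto simp: inj_on_def)
  qed simp
  moreover have "(f ^^ m) x = (f ^^ m) ((f ^^ (n - m)) x)"
    using mn by (simp flip: funpow_add comp_apply[of "f ^^ m"])
  ultimately have "x = (f ^^ (n - m)) x" using S assms(4) by (meson inj_onD)
  then show ?thesis using that[of "n - m"] mn by simp
qed

context ribbon_graph
begin

lemma nxt_cyclic: "e \<in> inc G v \<Longrightarrow> cyclic_on (nxt G v) (inc G v)"
  using cyclic_nxt inc_verts by blast

lemma nxt_inc: "e \<in> inc G v \<Longrightarrow> nxt G v e \<in> inc G v"
  using nxt_cyclic cyclic_on_inI by metis

lemma nxt_funpow_inc: "e \<in> inc G v \<Longrightarrow> (nxt G v ^^ k) e \<in> inc G v"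
  using nxt_cyclic cyclic_on_funpow_in by metis

section \<open>The tour as a permutation of half-edges\<close>

definition halfedges :: "('v \<times> 'e) set" where
  "halfedges = (SIGMA v : verts G. inc G v)"

lemma halfedges_iff: "(v, f) \<in> halfedges \<longleftrightarrow> f \<in> inc G v"
  using inc_verts by (auto simp: halfedges_def)

lemma halfedges_case: "z \<in> halfedges \<longleftrightarrow> snd z \<in> inc G (fst z)"
  using halfedges_iff by (cases z) auto

lemma finite_halfedges: "finite halfedges"
  unfolding halfedges_def using finite_verts finite_inc by blast

lemma tour_step_nontree: "f \<notin> F \<Longrightarrow> tour_step G F (v, f) = (v, nxt G v f)"
  by (simp add: tour_step_def)

lemma tour_step_cong: "snd z \<in> F \<longleftrightarrow> snd z \<in> F' \<Longrightarrow> tour_step G F z = tour_step G F' z"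
  by (cases z) (simp add: tour_step_def)

lemma tour_step_halfedges: "z \<in> halfedges \<Longrightarrow> tour_step G F z \<in> halfedges"
  by (cases z) (auto simp: tour_step_def halfedges_iff nxt_inc opp_inc)

lemma tour_halfedges: "z \<in> halfedges \<Longrightarrow> (tour_step G F ^^ n) z \<in> halfedges"
  using funpow_closed[of halfedges] tour_step_halfedges by blast

text \<open>The examined edge is the predecessor of the new edge at the new vertex, and its
  membership in \<open>F\<close> tells whether it was crossed; so a step can be undone.\<close>

lemma tour_step_inj: "inj_on (tour_step G F) halfedges"
proof (rule inj_onI)
  have nx: "f = g" if "nxt G w f = nxt G w g" "f \<in> inc G w" "g \<in> inc G w" for w f g
    using that nxt_cyclic cyclic_on_inj inj_onD by metis
  fix z z' assume z: "z \<in> halfedges" "z' \<in> halfedges" "tour_step G F z = tour_step G F z'"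
  obtain v f v' f' where vf: "z = (v, f)" "z' = (v', f')" by fastforce
  have i: "f \<in> inc G v" "f' \<in> inc G v'" using z vf halfedges_iff by auto
  show "z = z'"
    using z(3) i opp_inc[OF i(1)] opp_inc[OF i(2)] opp_opp[OF i(1)] opp_opp[OF i(2)]
    unfolding vf tour_step_def by (auto split: if_splits dest: nx)
qed

lemma tour_returns:
  assumes "z \<in> halfedges"
  obtains n where "0 < n" "(tour_step G F ^^ n) z = z"
  using inj_on_funpow_returns[OF finite_halfedges tour_step_halfedges tour_step_inj assms] by blast

lemma tour_step_conn: "z \<in> halfedges \<Longrightarrow> conn F (fst z) (fst (tour_step G F z))"
  by (cases z) (auto simp: tour_step_def halfedges_iff conn_opp)

lemma tour_conn: "z \<in> halfedges \<Longrightarrow> conn F (fst z) (fst ((tour_step G F ^^ n) z))"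
proof (induction n)
  case (Suc n)
  then show ?case using tour_step_conn[OF tour_halfedges] conn_trans by fastforce
qed simp

text \<open>Adding an edge between two components splices one component's tour into the other's: after
  entering the far side along \<open>g\<close>, the tour copies the old tour there until it is back at \<open>g\<close>.\<close>

lemma tour_excursion:
  assumes g: "g \<in> inc G x" and nc: "\<not> conn F x (opp G x g)"
  obtains r where "0 < r"
    "(tour_step G (insert g F) ^^ Suc r) (x, g) = (x, nxt G x g)"
    "(tour_step G F ^^ r) (opp G x g, g) = (opp G x g, g)"
    "\<And>m. 0 < m \<Longrightarrow> m \<le> r \<Longrightarrow>
      (tour_step G (insert g F) ^^ m) (x, g) = (tour_step G F ^^ m) (opp G x g, g)"
proof -
  let ?y = "opp G x g" and ?t = "tour_step G (insert g F)" and ?c = "tour_step G F"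
  have gF: "g \<notin> F" using nc conn_opp g by blast
  have yg: "(?y, g) \<in> halfedges" using g opp_inc halfedges_iff by blast
  define r where "r = (LEAST n. 0 < n \<and> (?c ^^ n) (?y, g) = (?y, g))"
  have r: "0 < r" "(?c ^^ r) (?y, g) = (?y, g)"
    using LeastI_ex[of "\<lambda>n. 0 < n \<and> (?c ^^ n) (?y, g) = (?y, g)"] tour_returns[OF yg, of F]
    unfolding r_def by blast+
  have lst: "(?c ^^ m) (?y, g) \<noteq> (?y, g)" if "0 < m" "m < r" for m
    using not_less_Least[of m "\<lambda>n. 0 < n \<and> (?c ^^ n) (?y, g) = (?y, g)"] that
    unfolding r_def by blast
  have eq: "(?t ^^ Suc m) (x, g) = (?c ^^ Suc m) (?y, g)" if "m < r" for m
    using that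
  proof (induction m)
    case 0
    show ?case using gF by (simp add: tour_step_def)
  next
    case (Suc m)
    define z where "z = (?c ^^ Suc m) (?y, g)"
    have z: "z \<in> halfedges" "z \<noteq> (?y, g)" "conn F ?y (fst z)"
      using tour_halfedges[OF yg] lst[of "Suc m"] tour_conn[OF yg] Suc(2) unfolding z_def
      by (auto simp del: funpow.simps)
    \<comment> \<open>Only two half-edges carry \<open>g\<close>: the one at \<open>x\<close> lies
      in the other component, and the one at \<open>?y\<close> is excluded by the minimality of
      \<open>r\<close>.\<close>
    have "snd z \<noteq> g"
    proof
      assume s: "snd z = g"
      then have "fst z \<in> {x, ?y}" using z(1) ends_opp[OF g] halfedges_case[of z] by (auto simp: inc_def)
      moreover have "fst z \<noteq> ?y" using z(2) s by (metis prod.collapse)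
      ultimately show False using nc z(3) conn_sym by auto
    qed
    then have "?t z = ?c z" by (intro tour_step_cong) simp
    then show ?case using Suc.IH Suc.prems z_def by simp
  qed
  have "(?t ^^ m) (x, g) = (?c ^^ m) (?y, g)" if "0 < m" "m \<le> r" for m
    using eq[of "m - 1"] that by (simp del: funpow.simps)
  moreover from this[of r] have "(?t ^^ Suc r) (x, g) = (x, nxt G x g)"
    using r opp_opp[OF g] by (simp add: tour_step_def)
  ultimately show ?thesis using r that by blast
qed

lemma tour_reaches_nxt:
  assumes F: "forest F" and h: "h \<in> inc G z"
  shows "\<exists>n. (tour_step G F ^^ n) (z, h) = (z, nxt G z h)"
proof (cases "h \<in> F")
  case True
  then have "\<not> conn (F - {h}) z (opp G z h)" using forestD[OF F] ends_opp[OF h] by blast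
  moreover have "insert h (F - {h}) = F" using True by auto
  ultimately show ?thesis using tour_excursion[OF h, of "F - {h}"] by metis
next
  case False
  then show ?thesis by (intro exI[of _ 1]) (simp add: tour_step_def)
qed

lemma tour_reaches_vertex:
  assumes F: "forest F" and h: "h \<in> inc G z" "h' \<in> inc G z"
  shows "\<exists>n. (tour_step G F ^^ n) (z, h) = (z, h')"
proof -
  have "\<exists>n. (tour_step G F ^^ n) (z, h) = (z, (nxt G z ^^ k) h)" for k
  proof (induction k)
    case (Suc k)
    then obtain n where "(tour_step G F ^^ n) (z, h) = (z, (nxt G z ^^ k) h)" by blast
    moreover obtain m where "(tour_step G F ^^ m) (z, (nxt G z ^^ k) h) = (z, (nxt G z ^^ Suc k) h)"
      using tour_reaches_nxt[OF F nxt_funpow_inc[OF h(1)], of k] by auto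
    ultimately have "(tour_step G F ^^ (m + n)) (z, h) = (z, (nxt G z ^^ Suc k) h)"
      by (simp add: funpow_add)
    then show ?case by blast
  qed (auto intro: exI[of _ 0])
  then show ?thesis using cyclic_on_funpow_ex[OF nxt_cyclic h] h by metis
qed

text \<open>At each vertex the tour eventually examines every edge, because each excursion returns
  to the next edge; and it crosses every edge of \<open>F\<close>, so it reaches all vertices of the
  component.\<close>

lemma tour_reaches:
  assumes F: "forest F" "F \<subseteq> edges G" and h: "h \<in> inc G z" "h' \<in> inc G z'" and c: "conn F z z'"
  shows "\<exists>n. (tour_step G F ^^ n) (z, h) = (z', h')"
  using c h(2)
proof (induction arbitrary: h' rule: conn_induct)
  case base
  then show ?case using tour_reaches_vertex F h by blast
next
  case (step x y e)
  have e: "e \<in> inc G x" "opp G x e = y" "e \<in> inc G y"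
    using step F ends_inc opp_eq by blast+
  obtain n where "(tour_step G F ^^ n) (z, h) = (x, e)" using step e by blast
  then have "(tour_step G F ^^ Suc n) (z, h) = (y, nxt G y e)"
    using step(2) e by (simp add: tour_step_def)
  moreover obtain m where "(tour_step G F ^^ m) (y, nxt G y e) = (y, h')"
    using tour_reaches_vertex[OF F(1) nxt_inc] e step by blast
  ultimately have "(tour_step G F ^^ (m + Suc n)) (z, h) = (y, h')"
    by (simp only: funpow_add comp_apply)
  then show ?case by blast
qed

text \<open>The excursion along \<open>g\<close> runs through a full period of the old tour on the
  far side, and that tour is a single orbit on the half-edges of its component. So the far side is
  visited completely and nothing else is.\<close>

lemma tour_excursion_forest:
  assumes F: "forest (insert g F)" "F \<subseteq> edges G" "g \<notin> F" and g: "g \<in> inc G x"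
  obtains L where "0 < L" "(tour_step G (insert g F) ^^ L) (x, g) = (x, nxt G x g)"
    "\<And>j. 0 < j \<Longrightarrow> j < L \<Longrightarrow> conn F (opp G x g) (fst ((tour_step G (insert g F) ^^ j) (x, g)))"
    "\<And>z. z \<in> halfedges \<Longrightarrow> conn F (opp G x g) (fst z) \<Longrightarrow>
      \<exists>j. 0 < j \<and> j < L \<and> (tour_step G (insert g F) ^^ j) (x, g) = z"
proof -
  let ?y = "opp G x g" and ?t = "tour_step G (insert g F)" and ?c = "tour_step G F"
  have nc: "\<not> conn F x ?y" using forestD[OF F(1), of g x ?y] ends_opp[OF g] F(3) by simp
  have fF: "forest F" using F forest_subset by blast
  have yg: "g \<in> inc G ?y" using g opp_inc by blast
  obtain r where r: "0 < r" "(?t ^^ Suc r) (x, g) = (x, nxt G x g)" "(?c ^^ r) (?y, g) = (?y, g)"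
    "\<And>m. 0 < m \<Longrightarrow> m \<le> r \<Longrightarrow> (?t ^^ m) (x, g) = (?c ^^ m) (?y, g)"
    using tour_excursion[OF g nc] by blast
  show ?thesis
  proof (rule that[of "Suc r"])
    fix j assume "0 < j" "j < Suc r"
    then show "conn F ?y (fst ((?t ^^ j) (x, g)))"
      using r(4)[of j] tour_conn[of "(?y, g)" F j] yg halfedges_iff by simp
  next
    fix z assume z: "z \<in> halfedges" "conn F ?y (fst z)"
    then obtain n where n: "(?c ^^ n) (?y, g) = z"
      using tour_reaches[OF fF F(2) yg, of "snd z" "fst z"] halfedges_case by (metis prod.collapse)
    \<comment> \<open>The excursion copies the old tour only at positive times, so the residue 0 is
      represented by the full period \<open>r\<close>.\<close>
    define j where "j = (if n mod r = 0 then r else n mod r)"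
    have "(?c ^^ (n mod r)) (?y, g) = z"
      using n funpow_mod_eq[OF r(3)] by simp
    then have "(?c ^^ j) (?y, g) = z" using r(3) by (auto simp: j_def)
    moreover have "0 < j" "j \<le> r" using r(1) by (auto simp: j_def intro: less_imp_le)
    ultimately show "\<exists>j. 0 < j \<and> j < Suc r \<and> (?t ^^ j) (x, g) = z"
      using r(4)[of j] by (intro exI[of _ j]) auto
  qed (use r in auto)
qed

end


section \<open>Spanning trees as rotor configurations\<close>

context ribbon_graph
begin

lemma path_first_edge:
  assumes "path G (vs, es)" "set es \<subseteq> T" "es \<noteq> []" "hd vs = w" "last vs = q"
  shows "hd es \<in> T" "hd es \<in> inc G w" "conn (T - {hd es}) (opp G w (hd es)) q"
proof -
  obtain e es' where es: "es = e # es'" using assms(3) by (cases es) auto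
  have l: "length vs = Suc (Suc (length es'))" and d: "distinct es" "set es \<subseteq> edges G"
    and en: "\<forall>i<length es. ends G (es ! i) = {vs ! i, vs ! Suc i}"
    using assms(1) es by (auto simp: path_def)
  then obtain y vs' where vs: "vs = w # y # vs'"
    using assms(4) by (cases vs; cases "tl vs") auto
  have e: "ends G e = {w, y}" using en[rule_format, of 0] es vs by simp
  have "\<forall>i<length es'. ends G (es' ! i) = {(y # vs') ! i, (y # vs') ! Suc i}"
  proof (intro allI impI)
    fix i assume "i < length es'"
    then show "ends G (es' ! i) = {(y # vs') ! i, (y # vs') ! Suc i}"
      using en[rule_format, of "Suc i"] es vs by simp
  qed
  moreover have "set es' \<subseteq> T - {e}" using d assms(2) es by auto
  ultimately have "conn (T - {e}) (hd (y # vs')) (last (y # vs'))"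
    using path_conn[of "y # vs'" es' "T - {e}"] l vs by simp
  then show "conn (T - {hd es}) (opp G w (hd es)) q"
    using es vs assms(5) opp_eq[OF e] by simp
  show "hd es \<in> T" using assms(2) es by simp
  show "hd es \<in> inc G w" using es e d ends_inc by auto
qed

text \<open>Replaces the definite description over paths by a condition on components; uniqueness is
  \<open>forest_first_edge_unique\<close>.\<close>

lemma tree_rotors_eqI:
  assumes T: "T \<in> spanning_trees G" and e: "e \<in> T" "e \<in> inc G w"
    and c: "conn (T - {e}) (opp G w e) q"
  shows "tree_rotors G q T w = e"
  unfolding tree_rotors_def
proof (rule the_equality)
  have F: "forest T" "T \<subseteq> edges G" using T spanning_trees_iff by auto
  then have "T - {e} \<subseteq> edges G" by auto
  then obtain vs es where p: "path G (vs, es)" "distinct vs" "set es \<subseteq> T - {e}"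
    "hd vs = opp G w e" "last vs = q"
    by (rule conn_simple_path[OF c _ opp_verts[OF e(2)]])
  then obtain vs' where vs: "vs = opp G w e # vs'" by (cases vs) (auto simp: path_def)
  have "path G (w # vs, e # es)"
    using p vs ends_opp[OF e(2)] inc_verts[OF e(2)] e F
    by (auto simp: path_def nth_Cons' less_Suc_eq_0_disj)
  then show "\<exists>vs es. path G (vs, es) \<and> set es \<subseteq> T \<and> es \<noteq> [] \<and> hd vs = w \<and> last vs = q \<and> hd es = e"
    using p vs e by (intro exI[of _ "w # vs"] exI[of _ "e # es"]) auto
  fix e' assume "\<exists>vs es. path G (vs, es) \<and> set es \<subseteq> T \<and> es \<noteq> [] \<and> hd vs = w \<and> last vs = q \<and> hd es = e'"
  then have "e' \<in> T" "e' \<in> inc G w" "conn (T - {e'}) (opp G w e') q"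
    using path_first_edge by metis+
  then show "e' = e" using forest_first_edge_unique F e c by blast
qed

lemma tree_rotors_props:
  assumes T: "T \<in> spanning_trees G" and w: "w \<in> verts G" "q \<in> verts G" "w \<noteq> q"
  shows "tree_rotors G q T w \<in> T" "tree_rotors G q T w \<in> inc G w"
    "conn (T - {tree_rotors G q T w}) (opp G w (tree_rotors G q T w)) q"
proof -
  have F: "T \<subseteq> edges G" and c: "conn T w q" using T w spanning_trees_iff by auto
  obtain vs es where p: "path G (vs, es)" "distinct vs" "set es \<subseteq> T" "hd vs = w" "last vs = q"
    by (rule conn_simple_path[OF c F w(1)])
  have "es \<noteq> []" using p w(3) by (cases vs) (auto simp: path_def)
  note * = path_first_edge[OF p(1,3) this p(4,5)]
  then have "tree_rotors G q T w = hd es" using tree_rotors_eqI[OF T] by blast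
  with * show "tree_rotors G q T w \<in> T" "tree_rotors G q T w \<in> inc G w"
    "conn (T - {tree_rotors G q T w}) (opp G w (tree_rotors G q T w)) q" by auto
qed

text \<open>The sink is made a fixed point, so that no iterate has to be stopped on arrival.\<close>

definition rotor_next :: "'v \<Rightarrow> ('v \<Rightarrow> 'e) \<Rightarrow> 'v \<Rightarrow> 'v" where
  "rotor_next q \<sigma> w = (if w = q then q else opp G w (\<sigma> w))"

definition leads :: "'v \<Rightarrow> ('v \<Rightarrow> 'e) \<Rightarrow> 'v \<Rightarrow> bool" where
  "leads q \<sigma> w \<longleftrightarrow> (\<exists>n. (rotor_next q \<sigma> ^^ n) w = q)"

definition rotor_config :: "'v \<Rightarrow> ('v \<Rightarrow> 'e) \<Rightarrow> bool" where
  "rotor_config q \<sigma> \<longleftrightarrow> (\<forall>w\<in>verts G - {q}. \<sigma> w \<in> inc G w)"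

lemma rotor_next_sink [simp]: "rotor_next q \<sigma> q = q"
  by (simp add: rotor_next_def)

lemma rotor_next_funpow_sink [simp]: "(rotor_next q \<sigma> ^^ n) q = q"
  by (induction n) auto

lemma rotor_next_verts:
  "rotor_config q \<sigma> \<Longrightarrow> q \<in> verts G \<Longrightarrow> w \<in> verts G \<Longrightarrow> rotor_next q \<sigma> w \<in> verts G"
  by (auto simp: rotor_next_def rotor_config_def opp_verts)

lemma leads_sink: "leads q \<sigma> q"
  unfolding leads_def by (rule exI[of _ 0]) simp

lemma leads_next: "leads q \<sigma> (rotor_next q \<sigma> w) \<longleftrightarrow> leads q \<sigma> w"
proof
  assume "leads q \<sigma> (rotor_next q \<sigma> w)"
  then obtain n where "(rotor_next q \<sigma> ^^ n) (rotor_next q \<sigma> w) = q" by (auto simp: leads_def)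
  then have "(rotor_next q \<sigma> ^^ Suc n) w = q" by (simp only: funpow_Suc_right comp_apply)
  then show "leads q \<sigma> w" unfolding leads_def by blast
next
  assume "leads q \<sigma> w"
  then obtain n where n: "(rotor_next q \<sigma> ^^ n) w = q" by (auto simp: leads_def)
  then have "(rotor_next q \<sigma> ^^ n) (rotor_next q \<sigma> w) = q"
    by (simp flip: funpow_swap1)
  then show "leads q \<sigma> (rotor_next q \<sigma> w)" unfolding leads_def by blast
qed

definition sink_dist :: "'v \<Rightarrow> ('v \<Rightarrow> 'e) \<Rightarrow> 'v \<Rightarrow> nat" where
  "sink_dist q \<sigma> w = (LEAST n. (rotor_next q \<sigma> ^^ n) w = q)"

lemma sink_dist_less:
  assumes "leads q \<sigma> w" "w \<noteq> q"
  shows "sink_dist q \<sigma> (rotor_next q \<sigma> w) < sink_dist q \<sigma> w"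
proof -
  have *: "(rotor_next q \<sigma> ^^ sink_dist q \<sigma> w) w = q"
    unfolding sink_dist_def using assms(1) unfolding leads_def by (rule LeastI_ex)
  then have "sink_dist q \<sigma> w \<noteq> 0" using assms(2) by (metis funpow_0)
  then obtain m where m: "sink_dist q \<sigma> w = Suc m" by (cases "sink_dist q \<sigma> w") auto
  have "(rotor_next q \<sigma> ^^ m) (rotor_next q \<sigma> w) = q"
    using * unfolding m by (simp add: funpow_swap1)
  then have "sink_dist q \<sigma> (rotor_next q \<sigma> w) \<le> m" unfolding sink_dist_def by (rule Least_le)
  then show ?thesis using m by simp
qed

lemma sink_dist_funpow_le:
  "leads q \<sigma> w \<Longrightarrow> sink_dist q \<sigma> ((rotor_next q \<sigma> ^^ n) w) \<le> sink_dist q \<sigma> w"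
proof (induction n)
  case (Suc n)
  have "leads q \<sigma> ((rotor_next q \<sigma> ^^ k) w)" for k
    by (induction k) (auto simp: leads_next Suc.prems)
  then show ?case using Suc sink_dist_less[of q \<sigma> "(rotor_next q \<sigma> ^^ n) w"]
    by (cases "(rotor_next q \<sigma> ^^ n) w = q") auto
qed simp

text \<open>The end that the removal of \<open>e\<close> cuts off from \<open>q\<close> is the one
  whose rotor is \<open>e\<close>. This shows that every tree edge is a rotor.\<close>

lemma tree_edge_towards:
  assumes T: "T \<in> spanning_trees G" and q: "q \<in> verts G" and e: "e \<in> T" "ends G e = {x, y}"
  shows "(conn (T - {e}) y q \<and> x \<noteq> q) \<or> (conn (T - {e}) x q \<and> y \<noteq> q)"
proof -
  have F: "forest T" "T \<subseteq> edges G" using T spanning_trees_iff by auto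
  then have "x \<in> verts G" using e ends_inc by blast
  then have "conn T x q" using T q spanning_trees_iff by blast
  then have "conn (T - {e}) y q \<or> conn (T - {e}) x q"
    using conn_split_Diff[OF _ e(2)] by blast
  then show ?thesis using forestD[OF F(1) e] conn_sym by blast
qed

lemma tree_rotors_config:
  assumes "T \<in> spanning_trees G" "q \<in> verts G"
  shows "rotor_config q (tree_rotors G q T)"
  using tree_rotors_props assms by (auto simp: rotor_config_def)

lemma tree_rotors_leads:
  assumes T: "T \<in> spanning_trees G" and q: "q \<in> verts G" "w \<in> verts G"
  shows "leads q (tree_rotors G q T) w"
proof -
  have F: "forest T" "T \<subseteq> edges G" "conn T q w" using T q spanning_trees_iff by auto
  from F(3) show ?thesis
  proof (induction rule: conn_induct)
    case base
    then show ?case by (rule leads_sink)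
  next
    case (step x y e)
    have e: "e \<in> inc G x" "opp G x e = y" "e \<in> inc G y" "opp G y e = x"
      using step F ends_inc opp_eq by (blast, blast, blast) (metis insert_commute opp_eq step.hyps(3))
    from tree_edge_towards[OF T q(1) step(2,3)] show ?case
    proof (elim disjE conjE)
      assume "conn (T - {e}) y q" "x \<noteq> q"
      then have "rotor_next q (tree_rotors G q T) x = y"
        using tree_rotors_eqI[OF T step(2) e(1)] e by (simp add: rotor_next_def)
      then show ?case using step.IH leads_next by metis
    next
      assume "conn (T - {e}) x q" "y \<noteq> q"
      then have "rotor_next q (tree_rotors G q T) y = x"
        using tree_rotors_eqI[OF T step(2) e(3)] e by (simp add: rotor_next_def)
      then show ?case using step.IH leads_next by metis
    qed
  qed
qed

lemma tree_rotors_image: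
  assumes T: "T \<in> spanning_trees G" and q: "q \<in> verts G"
  shows "tree_rotors G q T ` (verts G - {q}) = T"
proof
  show "tree_rotors G q T ` (verts G - {q}) \<subseteq> T" using tree_rotors_props assms by auto
next
  have F: "T \<subseteq> edges G" using T spanning_trees_iff by auto
  show "T \<subseteq> tree_rotors G q T ` (verts G - {q})"
  proof
    fix e assume e: "e \<in> T"
    then obtain x y where xy: "ends G e = {x, y}"
      using F card_ends card_2_iff by (metis subsetD)
    then have i: "e \<in> inc G x" "e \<in> inc G y" "opp G x e = y" "opp G y e = x"
      using e F ends_inc opp_eq by (blast, blast, blast) (metis insert_commute opp_eq xy)
    have "tree_rotors G q T x = e \<and> x \<noteq> q \<or> tree_rotors G q T y = e \<and> y \<noteq> q"
      using tree_edge_towards[OF T q e xy] tree_rotors_eqI[OF T e i(1)] tree_rotors_eqI[OF T e i(2)] i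
      by auto
    then show "e \<in> tree_rotors G q T ` (verts G - {q})" using i inc_verts by blast
  qed
qed

text \<open>Let \<open>D w0\<close> be the set of vertices whose rotor path runs through
  \<open>w0\<close>. Among the rotor edges only \<open>\<sigma> w0\<close> leaves this set, and it
  does leave it because the distance to the sink drops. Hence every edge of \<open>T\<close> is a
  cut edge; the same cut separates \<open>w\<close> from \<open>q\<close>, so \<open>T\<close>
  determines the rotor at \<open>w\<close>.\<close>

lemma leads_spanning_tree:
  assumes \<sigma>: "rotor_config q \<sigma>" and q: "q \<in> verts G"
    and ld: "\<And>w. w \<in> verts G \<Longrightarrow> leads q \<sigma> w"
  defines "T \<equiv> \<sigma> ` (verts G - {q})"
  shows "T \<in> spanning_trees G" "\<And>w. w \<in> verts G - {q} \<Longrightarrow> tree_rotors G q T w = \<sigma> w"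
proof -
  have inc: "\<sigma> w \<in> inc G w" if "w \<in> verts G - {q}" for w using \<sigma> that rotor_config_def by blast
  have T: "T \<subseteq> edges G" using inc inc_edges T_def by blast
  have ends_next: "ends G (\<sigma> w) = {w, rotor_next q \<sigma> w}" if "w \<in> verts G - {q}" for w
    using ends_opp[OF inc[OF that]] that by (simp add: rotor_next_def)
  have cq: "conn T w q" if "(rotor_next q \<sigma> ^^ n) w = q" "w \<in> verts G" for n w
    using that
  proof (induction n arbitrary: w)
    case (Suc n)
    show ?case
    proof (cases "w = q")
      case False
      have "(rotor_next q \<sigma> ^^ n) (rotor_next q \<sigma> w) = q"
        using Suc.prems by (simp add: funpow_swap1)
      then have "conn T (rotor_next q \<sigma> w) q" using Suc rotor_next_verts[OF \<sigma> q] by blast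
      moreover have "conn T w (rotor_next q \<sigma> w)"
        using conn_edge[OF _ ends_next[of w], of T] False Suc.prems T_def by blast
      ultimately show ?thesis using conn_trans by blast
    qed simp
  qed simp
  have conn_T: "conn T u w" if "u \<in> verts G" "w \<in> verts G" for u w
    using cq that ld unfolding leads_def by (meson conn_sym conn_trans)
  define D where "D w0 = {z. \<exists>k. (rotor_next q \<sigma> ^^ k) z = w0}" for w0
  have D_closed: "ends G e' \<subseteq> D w0 \<or> ends G e' \<inter> D w0 = {}"
    if e': "e' \<in> T - {\<sigma> w0}" for w0 e'
  proof -
    obtain z where z: "z \<in> verts G - {q}" "e' = \<sigma> z" using e' T_def by blast
    have zw: "z \<noteq> w0" using z e' by auto
    have "z \<in> D w0 \<longleftrightarrow> rotor_next q \<sigma> z \<in> D w0"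
    proof
      assume "z \<in> D w0"
      then obtain k where k: "(rotor_next q \<sigma> ^^ k) z = w0" using D_def by blast
      then obtain m where "k = Suc m" using zw by (cases k) auto
      then show "rotor_next q \<sigma> z \<in> D w0" using k D_def by (auto simp: funpow_swap1)
    next
      assume "rotor_next q \<sigma> z \<in> D w0"
      then obtain k where "(rotor_next q \<sigma> ^^ k) (rotor_next q \<sigma> z) = w0" using D_def by blast
      then have "(rotor_next q \<sigma> ^^ Suc k) z = w0" by (simp add: funpow_swap1)
      then show "z \<in> D w0" using D_def by blast
    qed
    then show ?thesis using ends_next[OF z(1)] z(2) by auto
  qed
  have w0_D: "w0 \<in> D w0" for w0 unfolding D_def by (auto intro: exI[of _ 0])
  have next_D: "rotor_next q \<sigma> w0 \<notin> D w0" if w0: "w0 \<in> verts G - {q}" for w0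
  proof
    assume "rotor_next q \<sigma> w0 \<in> D w0"
    then obtain k where "(rotor_next q \<sigma> ^^ k) (rotor_next q \<sigma> w0) = w0" using D_def by blast
    then have "sink_dist q \<sigma> w0 \<le> sink_dist q \<sigma> (rotor_next q \<sigma> w0)"
      using sink_dist_funpow_le[of q \<sigma> "rotor_next q \<sigma> w0" k] ld w0 leads_next by auto
    then show False using sink_dist_less[of q \<sigma> w0] ld w0 by auto
  qed
  have "forest T"
    unfolding forest_def
  proof (intro ballI allI impI notI)
    fix e x y assume e: "e \<in> T" "ends G e = {x, y}" "conn (T - {e}) x y"
    then obtain w0 where w0: "w0 \<in> verts G - {q}" "e = \<sigma> w0" using T_def by blast
    have "x \<in> D w0 \<longleftrightarrow> y \<in> D w0"
      using conn_closed[OF e(3), of "D w0"] D_closed w0 by blast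
    moreover have "{x, y} = {w0, rotor_next q \<sigma> w0}" using ends_next[OF w0(1)] e(2) w0(2) by simp
    ultimately show False using w0_D next_D[OF w0(1)] by (auto simp: doubleton_eq_iff)
  qed
  then show tree: "T \<in> spanning_trees G" using T conn_T spanning_trees_iff by blast
  fix w assume w: "w \<in> verts G - {q}"
  have \<sigma>T: "\<sigma> w \<in> T" using w T_def by blast
  have "\<not> conn (T - {\<sigma> w}) w q"
  proof
    assume c: "conn (T - {\<sigma> w}) w q"
    have "w \<in> D w \<longleftrightarrow> q \<in> D w" by (rule conn_closed[OF c D_closed])
    then show False using w0_D[of w] w by (auto simp: D_def)
  qed
  then have c: "conn (T - {\<sigma> w}) (opp G w (\<sigma> w)) q"
    using tree_edge_towards[OF tree q \<sigma>T ends_next[OF w]] w by (auto simp: rotor_next_def)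
  show "tree_rotors G q T w = \<sigma> w"
    by (rule tree_rotors_eqI[OF tree \<sigma>T inc[OF w] c])
qed

end


section \<open>Firing vectors\<close>

lemma sum_lessThan_add:
  fixes f :: "nat \<Rightarrow> 'a::comm_monoid_add"
  shows "(\<Sum>k<a + b. f k) = (\<Sum>k<a. f k) + (\<Sum>k<b. f (a + k))"
  by (induction b) (simp_all add: add.assoc)

context ribbon_graph
begin

text \<open>The value 0 off \<open>verts G\<close> makes this the coefficient function of
  \<open>laplacian\<close> everywhere.\<close>

definition lap :: "('v \<Rightarrow> int) \<Rightarrow> 'v \<Rightarrow> int" where
  "lap \<phi> z = (if z \<in> verts G then \<Sum>e\<in>inc G z. \<phi> z - \<phi> (opp G z e) else 0)"

lemma lap_add: "lap (\<lambda>w. \<phi> w + \<psi> w) z = lap \<phi> z + lap \<psi> z"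
  by (auto simp: lap_def algebra_simps simp flip: sum.distrib)

lemma lap_minus: "lap (\<lambda>w. - \<phi> w) z = - lap \<phi> z"
  by (auto simp: lap_def simp flip: sum_negf)

lemma lap_diff: "lap (\<lambda>w. \<phi> w - \<psi> w) z = lap \<phi> z - lap \<psi> z"
  using lap_add[of \<phi> "\<lambda>w. - \<psi> w"] lap_minus[of \<psi>] by simp

lemma lap_cmul: "lap (\<lambda>w. c * \<phi> w) z = c * lap \<phi> z"
  by (auto simp: lap_def sum_distrib_left right_diff_distrib)

lemma lap_const [simp]: "lap (\<lambda>_. c) z = 0"
  by (simp add: lap_def)

text \<open>The number of chips that \<open>z\<close> loses when one moves from \<open>w\<close> along \<open>e\<close>, so \<open>-1\<close> for a gain.\<close>

definition move :: "'v \<Rightarrow> 'e \<Rightarrow> 'v \<Rightarrow> int" where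
  "move w e z = of_bool (w = z) - of_bool (opp G w e = z)"

text \<open>The half-edges pointing to \<open>z\<close> are the reversals of those based at
  \<open>z\<close>.\<close>

lemma sum_halfedges_swap:
  fixes f :: "'v \<Rightarrow> 'e \<Rightarrow> int"
  assumes z: "z \<in> verts G"
  shows "(\<Sum>w\<in>verts G. \<Sum>e\<in>inc G w. of_bool (opp G w e = z) * f w e) =
    (\<Sum>e\<in>inc G z. f (opp G z e) e)" (is "?L = ?R")
proof -
  have "?L = (\<Sum>(w, e)\<in>(SIGMA w:verts G. inc G w). of_bool (opp G w e = z) * f w e)"
    by (rule sum.Sigma) (auto simp: finite_verts finite_inc)
  also have "\<dots> = (\<Sum>(w, e)\<in>(\<lambda>e. (opp G z e, e)) ` inc G z. of_bool (opp G w e = z) * f w e)"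
  proof (rule sum.mono_neutral_right)
    show "finite (SIGMA w:verts G. inc G w)" using finite_verts finite_inc by blast
    show "(\<lambda>e. (opp G z e, e)) ` inc G z \<subseteq> (SIGMA w:verts G. inc G w)"
      using opp_inc opp_verts by auto
    have "(w, e) \<in> (\<lambda>e. (opp G z e, e)) ` inc G z" if "e \<in> inc G w" "opp G w e = z" for w e
      using opp_inc[OF that(1)] opp_opp[OF that(1)] that(2) by (intro image_eqI[of _ _ e]) auto
    then show "\<forall>x\<in>(SIGMA w:verts G. inc G w) - (\<lambda>e. (opp G z e, e)) ` inc G z.
        (case x of (w, e) \<Rightarrow> of_bool (opp G w e = z) * f w e) = 0"
      by auto
  qed
  also have "\<dots> = (\<Sum>e\<in>inc G z. of_bool (opp G (opp G z e) e = z) * f (opp G z e) e)"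
    by (subst sum.reindex) (auto simp: inj_on_def)
  also have "\<dots> = ?R" by (rule sum.cong) (auto simp: opp_opp)
  finally show ?thesis .
qed

text \<open>A full turn of the rotor at \<open>w\<close> sends one chip along each edge at
  \<open>w\<close>, which is a firing of \<open>w\<close>. This links rotor turns to the
  Laplacian.\<close>

lemma lap_eq_moves:
  "(\<Sum>w\<in>verts G. \<phi> w * (\<Sum>e\<in>inc G w. move w e z)) = lap \<phi> z"
proof (cases "z \<in> verts G")
  case z: True
  have "(\<Sum>w\<in>verts G. \<phi> w * (\<Sum>e\<in>inc G w. move w e z)) =
      (\<Sum>w\<in>verts G. of_bool (w = z) * (\<phi> w * int (card (inc G w)))) -
      (\<Sum>w\<in>verts G. \<Sum>e\<in>inc G w. of_bool (opp G w e = z) * \<phi> w)"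
    by (simp add: move_def sum_subtractf algebra_simps sum_distrib_left)
  also have "(\<Sum>w\<in>verts G. of_bool (w = z) * (\<phi> w * int (card (inc G w)))) = \<phi> z * int (card (inc G z))"
    using z finite_verts by (subst sum.remove[of _ z]) auto
  also have "(\<Sum>w\<in>verts G. \<Sum>e\<in>inc G w. of_bool (opp G w e = z) * \<phi> w) =
      (\<Sum>e\<in>inc G z. \<phi> (opp G z e))"
    by (rule sum_halfedges_swap[OF z])
  finally show ?thesis using z by (simp add: lap_def sum_subtractf algebra_simps)
next
  case False
  then have "move w e z = 0" if "w \<in> verts G" "e \<in> inc G w" for w e
    using that opp_verts by (auto simp: move_def)
  then show ?thesis using False by (simp add: lap_def)
qed

lemma sum_lap: "(\<Sum>z\<in>verts G. lap \<phi> z) = 0"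
proof -
  have "(\<Sum>z\<in>verts G. move w e z) = 0" if "w \<in> verts G" "e \<in> inc G w" for w e
    using that finite_verts opp_verts by (simp add: move_def sum_subtractf)
  then have 0: "(\<Sum>e\<in>inc G w. \<Sum>z\<in>verts G. move w e z) = 0" if "w \<in> verts G" for w
    using that by simp
  have "(\<Sum>z\<in>verts G. lap \<phi> z) = (\<Sum>z\<in>verts G. \<Sum>w\<in>verts G. \<phi> w * (\<Sum>e\<in>inc G w. move w e z))"
    by (simp add: lap_eq_moves)
  also have "\<dots> = (\<Sum>w\<in>verts G. \<phi> w * (\<Sum>z\<in>verts G. \<Sum>e\<in>inc G w. move w e z))"
    by (subst sum.swap) (simp add: sum_distrib_left)
  also have "\<dots> = (\<Sum>w\<in>verts G. \<phi> w * (\<Sum>e\<in>inc G w. \<Sum>z\<in>verts G. move w e z))"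
    by (subst sum.swap) simp
  finally show ?thesis using 0 by simp
qed

text \<open>The chips lost at \<open>z\<close> when each vertex \<open>w \<noteq> q\<close> advances its rotor \<open>u w\<close> times, starting from
  \<open>\<sigma> w\<close> and sending a chip along each new rotor, whether or not a chip is present.\<close>

definition flow :: "'v \<Rightarrow> ('v \<Rightarrow> 'e) \<Rightarrow> ('v \<Rightarrow> nat) \<Rightarrow> 'v \<Rightarrow> int" where
  "flow q \<sigma> u z = (\<Sum>w\<in>verts G - {q}. \<Sum>k<u w. move w ((nxt G w ^^ Suc k) (\<sigma> w)) z)"

lemma flow_add:
  "flow q \<sigma> (\<lambda>w. u w + u' w) z = flow q \<sigma> u z + flow q (\<lambda>w. (nxt G w ^^ u w) (\<sigma> w)) u' z"
proof -
  have *: "nxt G w ((nxt G w ^^ (a + k)) e) = nxt G w ((nxt G w ^^ k) ((nxt G w ^^ a) e))" for w a k e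
    by (simp add: add.commute[of a] funpow_add)
  show ?thesis by (simp add: flow_def sum_lessThan_add sum.distrib *)
qed

lemma flow_cong:
  assumes "\<And>w. w \<in> verts G - {q} \<Longrightarrow> \<sigma> w = \<sigma>' w \<and> u w = u' w"
  shows "flow q \<sigma> u z = flow q \<sigma>' u' z"
  unfolding flow_def using assms by (intro sum.cong) auto

lemma flow_single:
  assumes "v \<in> verts G - {q}"
  shows "flow q \<sigma> (\<lambda>w. of_bool (w = v)) z = move v (nxt G v (\<sigma> v)) z"
  unfolding flow_def using assms finite_verts
  by (subst sum.remove[of _ v]) (auto intro!: sum.neutral)

lemma sum_full_turn:
  fixes f :: "'e \<Rightarrow> int"
  assumes "e \<in> inc G w"
  shows "(\<Sum>k<card (inc G w). f ((nxt G w ^^ Suc k) e)) = (\<Sum>e\<in>inc G w. f e)"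
proof -
  let ?e = "nxt G w e"
  have c: "cyclic_on (nxt G w) (inc G w)" and e: "?e \<in> inc G w" using assms nxt_cyclic nxt_inc by auto
  have "bij_betw (\<lambda>k. (nxt G w ^^ Suc k) e) {..<card (inc G w)} (inc G w)"
    unfolding bij_betw_def
  proof
    show "inj_on (\<lambda>k. (nxt G w ^^ Suc k) e) {..<card (inc G w)}"
      using cyclic_on_funpow_inj[OF c e] by (auto simp: inj_on_def funpow_swap1)
    show "(\<lambda>k. (nxt G w ^^ Suc k) e) ` {..<card (inc G w)} = inc G w"
    proof
      show "(\<lambda>k. (nxt G w ^^ Suc k) e) ` {..<card (inc G w)} \<subseteq> inc G w"
        using nxt_funpow_inc[OF assms] by blast
      show "inc G w \<subseteq> (\<lambda>k. (nxt G w ^^ Suc k) e) ` {..<card (inc G w)}"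
      proof
        fix e' assume "e' \<in> inc G w"
        then obtain k where "k < card (inc G w)" "(nxt G w ^^ k) ?e = e'"
          using cyclic_on_funpow_ex[OF c e] by blast
        then show "e' \<in> (\<lambda>k. (nxt G w ^^ Suc k) e) ` {..<card (inc G w)}"
          by (auto simp: funpow_swap1 intro!: image_eqI[of _ _ k])
      qed
    qed
  qed
  then show ?thesis by (rule sum.reindex_bij_betw)
qed

lemma sum_full_turns:
  fixes f :: "'e \<Rightarrow> int"
  assumes e: "e \<in> inc G w"
  shows "(\<Sum>k<a * card (inc G w). f ((nxt G w ^^ Suc k) e)) = int a * (\<Sum>e\<in>inc G w. f e)"
proof (induction a)
  case (Suc a)
  let ?d = "card (inc G w)"
  have id: "(nxt G w ^^ ?d) e = e" using cyclic_on_funpow_card[OF nxt_cyclic[OF e] e] .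
  have "nxt G w ((nxt G w ^^ (?d + k)) e) = nxt G w ((nxt G w ^^ k) e)" for k
    by (simp add: add.commute[of ?d] funpow_add id)
  then have "(\<Sum>k<?d + a * ?d. f ((nxt G w ^^ Suc k) e)) =
      (\<Sum>k<?d. f ((nxt G w ^^ Suc k) e)) + (\<Sum>k<a * ?d. f ((nxt G w ^^ Suc k) e))"
    by (simp add: sum_lessThan_add)
  then show ?case using Suc sum_full_turn[OF e, of f] by (simp add: distrib_right)
qed simp

lemma nxt_full_turns: "e \<in> inc G w \<Longrightarrow> (nxt G w ^^ (a * card (inc G w))) e = e"
  using cyclic_on_funpow_mod[OF nxt_cyclic, of e w e "a * card (inc G w)"] by simp

lemma flow_full_turns:
  assumes \<sigma>: "rotor_config q \<sigma>" and q: "q \<in> verts G" and a: "a q = 0"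
  shows "flow q \<sigma> (\<lambda>w. a w * card (inc G w)) z = lap (\<lambda>w. int (a w)) z"
proof -
  have "flow q \<sigma> (\<lambda>w. a w * card (inc G w)) z =
      (\<Sum>w\<in>verts G - {q}. int (a w) * (\<Sum>e\<in>inc G w. move w e z))"
    unfolding flow_def using \<sigma> by (intro sum.cong refl sum_full_turns) (auto simp: rotor_config_def)
  also have "\<dots> = (\<Sum>w\<in>verts G. int (a w) * (\<Sum>e\<in>inc G w. move w e z))"
    using q a finite_verts by (subst (2) sum.remove[of _ q]) auto
  finally show ?thesis by (simp add: lap_eq_moves)
qed

lemma flow_turns_add:
  assumes \<sigma>: "rotor_config q \<sigma>" and q: "q \<in> verts G" and a: "a q = 0"
  shows "flow q \<sigma> (\<lambda>w. a w * card (inc G w) + u w) z = lap (\<lambda>w. int (a w)) z + flow q \<sigma> u z"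
proof -
  have "flow q (\<lambda>w. (nxt G w ^^ (a w * card (inc G w))) (\<sigma> w)) u z = flow q \<sigma> u z"
    using nxt_full_turns \<sigma> by (intro flow_cong) (auto simp: rotor_config_def)
  then show ?thesis using flow_full_turns[OF \<sigma> q, of a z] a by (simp add: flow_add)
qed

lemma sum_flow:
  assumes "A \<subseteq> verts G"
  shows "(\<Sum>z\<in>A. flow q \<sigma> u z) = (\<Sum>w\<in>verts G - {q}. \<Sum>k<u w.
    of_bool (w \<in> A) - of_bool (opp G w ((nxt G w ^^ Suc k) (\<sigma> w)) \<in> A))"
proof -
  have A: "finite A" using assms finite_verts finite_subset by blast
  have "(\<Sum>z\<in>A. of_bool (x = z)) = (of_bool (x \<in> A) :: int)" for x
    using A by (auto simp: of_bool_def)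
  then have *: "(\<Sum>z\<in>A. move w e z) = of_bool (w \<in> A) - of_bool (opp G w e \<in> A)" for w e
    by (simp add: move_def sum_subtractf)
  show ?thesis
    unfolding flow_def by (subst sum.swap, subst sum.swap) (simp only: *)
qed

text \<open>If the first firing vector exceeds the second exactly on \<open>A\<close>, then comparing the chips in
  \<open>A\<close> shows that the excess firings stay inside \<open>A\<close>; so do the final rotors, which then never lead out.\<close>

lemma flow_unique_le:
  assumes eq: "\<And>z. z \<in> verts G \<Longrightarrow> flow q \<sigma> u1 z = flow q \<sigma> u2 z"
    and ld: "\<And>w. w \<in> verts G \<Longrightarrow> leads q (\<lambda>w. (nxt G w ^^ u1 w) (\<sigma> w)) w"
    and w: "w \<in> verts G - {q}"
  shows "u1 w \<le> u2 w"
proof (rule ccontr)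
  assume nle: "\<not> u1 w \<le> u2 w"
  define A where "A = {w \<in> verts G - {q}. u2 w < u1 w}"
  define g :: "'v \<Rightarrow> nat \<Rightarrow> int" where
    "g w k = of_bool (w \<in> A) - of_bool (opp G w ((nxt G w ^^ Suc k) (\<sigma> w)) \<in> A)" for w k
  have A: "A \<subseteq> verts G" "q \<notin> A" "w \<in> A" using w nle by (auto simp: A_def)
  have split: "(\<Sum>k<b. f k) - (\<Sum>k<a. f k) = (\<Sum>k\<in>{a..<b}. f k)" if "a \<le> b" for a b and f :: "nat \<Rightarrow> int"
    using that sum.atLeastLessThan_concat[of 0 a b f] by (simp add: atLeast0LessThan)
  have "(\<Sum>w\<in>verts G - {q}. (\<Sum>k<u1 w. g w k) - (\<Sum>k<u2 w. g w k)) =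
      (\<Sum>z\<in>A. flow q \<sigma> u1 z) - (\<Sum>z\<in>A. flow q \<sigma> u2 z)"
    unfolding g_def sum_flow[OF A(1)] by (simp add: sum_subtractf)
  also have "\<dots> = 0" using eq A(1) by (simp add: subset_iff)
  finally have s0: "(\<Sum>w\<in>verts G - {q}. (\<Sum>k<u1 w. g w k) - (\<Sum>k<u2 w. g w k)) = 0" .
  have nn: "0 \<le> (\<Sum>k<u1 w. g w k) - (\<Sum>k<u2 w. g w k)" if "w \<in> verts G - {q}" for w
  proof (cases "w \<in> A")
    case True
    then have "0 \<le> g w k" for k by (simp add: g_def)
    then show ?thesis using True split[of "u2 w" "u1 w" "g w"] by (simp add: A_def sum_nonneg)
  next
    case False
    then have "g w k \<le> 0" for k by (simp add: g_def)
    then have "(\<Sum>k\<in>{u1 w..<u2 w}. g w k) \<le> 0" by (rule sum_nonpos)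
    moreover have "u1 w \<le> u2 w" using False that by (auto simp: A_def)
    ultimately show ?thesis using split[of "u1 w" "u2 w" "g w"] by simp
  qed
  have z: "(\<Sum>k<u1 w. g w k) - (\<Sum>k<u2 w. g w k) = 0" if "w \<in> verts G - {q}" for w
    using s0 nn that finite_verts sum_nonneg_eq_0_iff[of "verts G - {q}"
        "\<lambda>w. (\<Sum>k<u1 w. g w k) - (\<Sum>k<u2 w. g w k)"] by blast
  define \<sigma>1 where "\<sigma>1 = (\<lambda>w. (nxt G w ^^ u1 w) (\<sigma> w))"
  have stay: "rotor_next q \<sigma>1 w \<in> A" if w: "w \<in> A" for w
  proof -
    have wq: "w \<in> verts G - {q}" "u2 w < u1 w" using w by (auto simp: A_def)
    have "0 \<le> g w k" for k using w by (simp add: g_def)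
    moreover have "(\<Sum>k\<in>{u2 w..<u1 w}. g w k) = 0" using z[OF wq(1)] split[of "u2 w" "u1 w" "g w"] wq(2) by simp
    \<comment> \<open>Index \<open>u1 w - 1\<close> is the last advance, and the edge it uses is the
      final rotor \<open>\<sigma>1 w\<close>.\<close>
    ultimately have "g w (u1 w - 1) = 0" using wq(2) by (subst (asm) sum_nonneg_eq_0_iff) auto
    then have "opp G w ((nxt G w ^^ u1 w) (\<sigma> w)) \<in> A"
      using w wq(2) by (cases "u1 w") (auto simp: g_def split: if_splits)
    then show ?thesis using wq by (simp add: rotor_next_def \<sigma>1_def)
  qed
  have "(rotor_next q \<sigma>1 ^^ n) w \<in> A" for n by (induction n) (auto simp: stay A)
  moreover obtain n where "(rotor_next q \<sigma>1 ^^ n) w = q"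
    using ld[of w] w unfolding leads_def \<sigma>1_def by auto
  ultimately show False using A(2) by metis
qed

text \<open>Records only how far each rotor turns and the resulting net loss of chips
  \<open>D\<close>, not the order of the moves or whether a chip was present; this makes different
  routings comparable.\<close>

definition routes :: "'v \<Rightarrow> 'e set \<Rightarrow> ('v \<Rightarrow> int) \<Rightarrow> 'e set \<Rightarrow> bool" where
  "routes q T D T' \<longleftrightarrow> T' \<in> spanning_trees G \<and> (\<exists>u.
     (\<forall>w\<in>verts G - {q}. tree_rotors G q T' w = (nxt G w ^^ u w) (tree_rotors G q T w)) \<and>
     (\<forall>z\<in>verts G. flow q (tree_rotors G q T) u z = D z))"

lemma routes_trans:
  assumes "routes q T D T'" "routes q T' D' T''"
  shows "routes q T (\<lambda>z. D z + D' z) T''"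
proof -
  obtain u where u: "\<And>w. w \<in> verts G - {q} \<Longrightarrow> tree_rotors G q T' w = (nxt G w ^^ u w) (tree_rotors G q T w)"
    "\<And>z. z \<in> verts G \<Longrightarrow> flow q (tree_rotors G q T) u z = D z"
    using assms(1) by (auto simp: routes_def)
  obtain u' where u': "\<And>w. w \<in> verts G - {q} \<Longrightarrow> tree_rotors G q T'' w = (nxt G w ^^ u' w) (tree_rotors G q T' w)"
    "\<And>z. z \<in> verts G \<Longrightarrow> flow q (tree_rotors G q T') u' z = D' z" "T'' \<in> spanning_trees G"
    using assms(2) by (auto simp: routes_def)
  have "tree_rotors G q T'' w = (nxt G w ^^ (u w + u' w)) (tree_rotors G q T w)" if "w \<in> verts G - {q}" for w
    using u(1)[OF that] u'(1)[OF that] by (simp add: funpow_add add.commute[of "u w"])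
  moreover have "flow q (tree_rotors G q T) (\<lambda>w. u w + u' w) z = D z + D' z" if z: "z \<in> verts G" for z
  proof -
    have "flow q (\<lambda>w. (nxt G w ^^ u w) (tree_rotors G q T w)) u' z = flow q (tree_rotors G q T') u' z"
      using u(1) by (intro flow_cong) auto
    then show ?thesis using u(2)[OF z] u'(2)[OF z] by (simp add: flow_add)
  qed
  ultimately show ?thesis using u'(3) unfolding routes_def
    by (intro conjI exI[of _ "\<lambda>w. u w + u' w"] ballI)
qed

lemma routes_refl:
  assumes "T \<in> spanning_trees G"
  shows "routes q T (\<lambda>z. 0) T"
  unfolding routes_def using assms by (intro conjI exI[of _ "\<lambda>_. 0"]) (auto simp: flow_def)

text \<open>This is the well-definedness of the rotor action on classes. The difference
  \<open>lap \<phi>\<close> is absorbed into full turns, which do not affect the rotors; then both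
  firing vectors move the same chips and both end in trees, so \<open>flow_unique_le\<close> applies
  in both directions.\<close>

lemma routes_unique:
  assumes T: "T \<in> spanning_trees G" and q: "q \<in> verts G"
    and r1: "routes q T D1 T1" and r2: "routes q T D2 T2"
    and D: "\<And>z. z \<in> verts G \<Longrightarrow> D1 z - D2 z = lap \<phi> z"
  shows "T1 = T2"
proof -
  let ?s = "tree_rotors G q T" and ?d = "\<lambda>w. card (inc G w)"
  have \<sigma>: "rotor_config q ?s" using T q by (rule tree_rotors_config)
  obtain u1 where u1: "\<And>w. w \<in> verts G - {q} \<Longrightarrow> tree_rotors G q T1 w = (nxt G w ^^ u1 w) (?s w)"
    "\<And>z. z \<in> verts G \<Longrightarrow> flow q ?s u1 z = D1 z" and T1: "T1 \<in> spanning_trees G"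
    using r1 by (auto simp: routes_def)
  obtain u2 where u2: "\<And>w. w \<in> verts G - {q} \<Longrightarrow> tree_rotors G q T2 w = (nxt G w ^^ u2 w) (?s w)"
    "\<And>z. z \<in> verts G \<Longrightarrow> flow q ?s u2 z = D2 z" and T2: "T2 \<in> spanning_trees G"
    using r2 by (auto simp: routes_def)
  \<comment> \<open>The sink never fires, so \<open>\<phi>\<close> is shifted to vanish at
    \<open>q\<close>; turns are natural numbers, so its positive part is charged to one side and its
    negative part to the other.\<close>
  define p n where "p w = nat (\<phi> w - \<phi> q)" and "n w = nat (\<phi> q - \<phi> w)" for w
  define v1 v2 where "v1 w = n w * ?d w + u1 w" and "v2 w = p w * ?d w + u2 w" for w
  have inc: "?s w \<in> inc G w" if "w \<in> verts G - {q}" for w using \<sigma> that rotor_config_def by blast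
  have shift: "(nxt G w ^^ (a * ?d w + b)) (?s w) = (nxt G w ^^ b) (?s w)" if "w \<in> verts G - {q}" for a b w
    using nxt_full_turns[OF inc[OF that], of a] by (simp add: add.commute[of _ b] funpow_add)
  have s1: "(nxt G w ^^ v1 w) (?s w) = tree_rotors G q T1 w" if "w \<in> verts G - {q}" for w
    using shift u1(1) that by (simp add: v1_def)
  have s2: "(nxt G w ^^ v2 w) (?s w) = tree_rotors G q T2 w" if "w \<in> verts G - {q}" for w
    using shift u2(1) that by (simp add: v2_def)
  note fl = flow_turns_add[OF \<sigma> q]
  have eq: "flow q ?s v1 z = flow q ?s v2 z" if z: "z \<in> verts G" for z
  proof -
    have "lap \<phi> z = lap (\<lambda>w. \<phi> w - \<phi> q) z" by (simp add: lap_diff)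
    also have "(\<lambda>w. \<phi> w - \<phi> q) = (\<lambda>w. int (p w) - int (n w))" by (auto simp: p_def n_def)
    finally have "lap \<phi> z = lap (\<lambda>w. int (p w)) z - lap (\<lambda>w. int (n w)) z" by (simp add: lap_diff)
    then show ?thesis
      using fl[of n u1 z] fl[of p u2 z] u1(2)[OF z] u2(2)[OF z] D[OF z]
      unfolding v1_def[abs_def] v2_def[abs_def] by (simp add: p_def n_def)
  qed
  have ld: "leads q (\<lambda>w. (nxt G w ^^ v w) (?s w)) w"
    if v: "\<And>w. w \<in> verts G - {q} \<Longrightarrow> (nxt G w ^^ v w) (?s w) = tree_rotors G q T' w"
      and T': "T' \<in> spanning_trees G" and w: "w \<in> verts G" for v T' w
  proof -
    let ?s' = "\<lambda>w. (nxt G w ^^ v w) (?s w)"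
    have "x \<in> verts G \<Longrightarrow> rotor_next q ?s' x = rotor_next q (tree_rotors G q T') x" for x
      using v by (auto simp: rotor_next_def)
    then have "(rotor_next q ?s' ^^ k) w = (rotor_next q (tree_rotors G q T') ^^ k) w \<and>
      (rotor_next q (tree_rotors G q T') ^^ k) w \<in> verts G" for k
      using rotor_next_verts[OF tree_rotors_config[OF T' q] q] w by (induction k) auto
    then show ?thesis using tree_rotors_leads[OF T' q w] unfolding leads_def by auto
  qed
  have "v1 w = v2 w" if w: "w \<in> verts G - {q}" for w
  proof (rule antisym)
    show "v1 w \<le> v2 w" by (rule flow_unique_le[OF eq _ w]) (use ld[OF s1 T1] in auto)
    show "v2 w \<le> v1 w" by (rule flow_unique_le[OF eq[symmetric] _ w]) (use ld[OF s2 T2] in auto)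
  qed
  then have "tree_rotors G q T1 w = tree_rotors G q T2 w" if "w \<in> verts G - {q}" for w
    using s1[OF that] s2[OF that] that by metis
  then show ?thesis
    using tree_rotors_image[OF T1 q] tree_rotors_image[OF T2 q] by (metis image_cong)
qed

end


section \<open>Termination of rotor-routing\<close>

context ribbon_graph
begin

lemma exists_spanning_tree: "\<exists>T. T \<in> spanning_trees G"
proof -
  have "forest {}" by (simp add: forest_def)
  then obtain F where "forest F" "{} \<subseteq> F" "F \<subseteq> edges G" "\<And>u w. conn (edges G) u w \<Longrightarrow> conn F u w"
    by (rule forest_extend) auto
  then show ?thesis using conn_edges spanning_trees_iff by auto
qed

text \<open>A strictly subharmonic function off the sink: it grows geometrically towards \<open>q\<close> along a
  spanning tree.\<close>

lemma exists_potential: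
  assumes q: "q \<in> verts G"
  obtains \<psi> :: "'v \<Rightarrow> int" where "\<And>w. 0 \<le> \<psi> w" "\<And>w. w \<in> verts G - {q} \<Longrightarrow> lap \<psi> w \<le> -1"
proof -
  obtain T where T: "T \<in> spanning_trees G" using exists_spanning_tree by blast
  define \<sigma> where "\<sigma> = tree_rotors G q T"
  define r where "r = sink_dist q \<sigma>"
  define R where "R = (\<Sum>w\<in>verts G. r w)"
  \<comment> \<open>\<open>N\<close> exceeds every degree, so the single neighbour that is nearer to
    the sink outweighs \<open>card (inc G w)\<close> copies of \<open>\<psi> w\<close>.\<close>
  define N where "N = Suc (card (edges G))"
  define \<psi> where "\<psi> w = int (N ^ (R - r w))" for w
  have rR: "r w \<le> R" if "w \<in> verts G" for w
    unfolding R_def using that finite_verts by (intro member_le_sum) auto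
  have "lap \<psi> w \<le> -1" if w: "w \<in> verts G - {q}" for w
  proof -
    have e: "\<sigma> w \<in> inc G w" using tree_rotors_config[OF T q] w by (simp add: \<sigma>_def rotor_config_def)
    have "r (opp G w (\<sigma> w)) < r w"
      using sink_dist_less[OF tree_rotors_leads[OF T q, of w]] w
      by (simp add: r_def \<sigma>_def rotor_next_def)
    then have "Suc (R - r w) \<le> R - r (opp G w (\<sigma> w))" using rR[of w] w by auto
    then have "N ^ Suc (R - r w) \<le> N ^ (R - r (opp G w (\<sigma> w)))"
      by (rule power_increasing) (simp add: N_def)
    then have 1: "int N * \<psi> w \<le> \<psi> (opp G w (\<sigma> w))" unfolding \<psi>_def by (metis of_nat_le_iff of_nat_mult power_Suc)
    have 2: "\<psi> (opp G w (\<sigma> w)) \<le> (\<Sum>e\<in>inc G w. \<psi> (opp G w e))"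
      by (rule member_le_sum[OF e]) (auto simp: \<psi>_def finite_inc)
    have "card (inc G w) \<le> card (edges G)" by (rule card_mono[OF finite_edges]) (auto simp: inc_def)
    then have "int (card (inc G w)) * \<psi> w \<le> (int N - 1) * \<psi> w"
      by (intro mult_right_mono) (auto simp: N_def \<psi>_def)
    moreover have "1 \<le> \<psi> w" by (simp add: \<psi>_def N_def)
    moreover have "lap \<psi> w = int (card (inc G w)) * \<psi> w - (\<Sum>e\<in>inc G w. \<psi> (opp G w e))"
      using w by (simp add: lap_def sum_subtractf)
    ultimately show ?thesis using 1 2 by (simp add: left_diff_distrib)
  qed
  then show ?thesis using that[of \<psi>] by (simp add: \<psi>_def)
qed

lemma exists_chip_list:
  assumes "finite S"
  shows "\<exists>vs. set vs \<subseteq> S \<and> (\<forall>z\<in>S. count_list vs z = c z)"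
  using assms
proof (induction S rule: finite_induct)
  case (insert x S)
  then obtain vs where vs: "set vs \<subseteq> S" "\<And>z. z \<in> S \<Longrightarrow> count_list vs z = c z" by blast
  have r: "count_list (replicate n x) z = (if x = z then n else 0)" for n z by (induction n) auto
  have "count_list vs x = 0" using vs(1) insert(2) by (auto simp: count_list_0_iff)
  then show ?case using vs insert(2)
    by (intro exI[of _ "replicate (c x) x @ vs"]) (auto simp: r)
qed simp

lemma sum_list_of_bool: "(\<Sum>v\<leftarrow>vs. of_bool (v = z) :: int) = int (count_list vs z)"
  by (induction vs) auto

text \<open>Adding the Laplacian of \<open>- t * \<psi>\<close> puts at least \<open>t\<close> chips
  on every vertex other than \<open>q\<close>, enough to cover every debt there. The coefficient at
  \<open>q\<close> is then forced by degree 0.\<close>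

lemma exists_effective:
  fixes D :: "'v \<Rightarrow> int"
  assumes q: "q \<in> verts G" and D: "(\<Sum>z\<in>verts G. D z) = 0"
  obtains vs \<phi> where "set vs \<subseteq> verts G"
    "\<And>z. z \<in> verts G \<Longrightarrow> (\<Sum>v\<leftarrow>vs. of_bool (v = z) - of_bool (q = z)) = D z + lap \<phi> z"
proof -
  obtain \<psi> where \<psi>: "\<And>w. w \<in> verts G - {q} \<Longrightarrow> lap \<psi> w \<le> -1"
    using exists_potential[OF q] by metis
  define t where "t = (\<Sum>z\<in>verts G. \<bar>D z\<bar>)"
  define \<phi> where "\<phi> = (\<lambda>w. - t * \<psi> w)"
  define c where "c z = D z + lap \<phi> z" for z
  have t: "\<bar>D z\<bar> \<le> t" if "z \<in> verts G" for z
    unfolding t_def using that finite_verts by (intro member_le_sum) auto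
  have c: "0 \<le> c z" if z: "z \<in> verts G - {q}" for z
  proof -
    have "t * 1 \<le> t * (- lap \<psi> z)" using \<psi>[OF z] by (intro mult_left_mono) (auto simp: t_def sum_nonneg)
    moreover have "lap \<phi> z = t * (- lap \<psi> z)" unfolding \<phi>_def by (subst lap_cmul) simp
    ultimately show ?thesis using t[of z] z by (auto simp: c_def)
  qed
  obtain vs where vs: "set vs \<subseteq> verts G - {q}"
    "\<And>z. z \<in> verts G - {q} \<Longrightarrow> count_list vs z = nat (c z)"
    using exists_chip_list[of "verts G - {q}" "\<lambda>z. nat (c z)"] finite_verts by blast
  define s where "s z = (\<Sum>v\<leftarrow>vs. of_bool (v = z) - of_bool (q = z) :: int)" for z
  have s: "s z = int (count_list vs z) - int (length vs) * of_bool (q = z)" for z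
    unfolding s_def by (simp add: sum_list_subtractf sum_list_of_bool sum_list_triv)
  have off: "s z = c z" if "z \<in> verts G - {q}" for z using s[of z] vs(2)[OF that] c[OF that] that by auto
  have "(\<Sum>z\<in>verts G. s z) = 0"
  proof -
    have "(\<Sum>z\<in>verts G. of_bool (v = z) - of_bool (q = z) :: int) = 0" if "v \<in> verts G" for v
      using that q finite_verts by (simp add: sum_subtractf of_bool_def)
    then have "set ws \<subseteq> verts G \<Longrightarrow> (\<Sum>z\<in>verts G. \<Sum>v\<leftarrow>ws. of_bool (v = z) - of_bool (q = z) :: int) = 0" for ws
      by (induction ws) (auto simp: sum.distrib)
    then show ?thesis unfolding s_def using vs(1) by blast
  qed
  moreover have "(\<Sum>z\<in>verts G. c z) = 0" unfolding c_def by (simp add: sum.distrib D sum_lap)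
  moreover have "(\<Sum>z\<in>verts G - {q}. s z) = (\<Sum>z\<in>verts G - {q}. c z)" using off by (rule sum.cong[OF refl])
  ultimately have "s q = c q" using q finite_verts by (simp add: sum.remove)
  then have "s z = D z + lap \<phi> z" if "z \<in> verts G" for z using off that c_def by (cases "z = q") auto
  then show ?thesis using that[of vs \<phi>] vs(1) unfolding s_def by blast
qed

lemma weighted_flow:
  fixes \<psi> :: "'v \<Rightarrow> int"
  assumes \<sigma>: "rotor_config q \<sigma>"
  shows "(\<Sum>z\<in>verts G. \<psi> z * flow q \<sigma> u z) =
    (\<Sum>w\<in>verts G - {q}. \<Sum>k<u w. \<psi> w - \<psi> (opp G w ((nxt G w ^^ Suc k) (\<sigma> w))))"
proof -
  have "(\<Sum>z\<in>verts G. \<psi> z * of_bool (x = z)) = \<psi> x" if "x \<in> verts G" for x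
    using that finite_verts by (simp add: of_bool_def if_distrib cong: if_cong)
  then have *: "(\<Sum>z\<in>verts G. \<psi> z * move w e z) = \<psi> w - \<psi> (opp G w e)" if "e \<in> inc G w" for w e
    using opp_verts[OF that] inc_verts[OF that] by (simp add: move_def sum_subtractf right_diff_distrib)
  have "(\<Sum>z\<in>verts G. \<psi> z * flow q \<sigma> u z) =
      (\<Sum>w\<in>verts G - {q}. \<Sum>k<u w. \<Sum>z\<in>verts G. \<psi> z * move w ((nxt G w ^^ Suc k) (\<sigma> w)) z)"
    unfolding flow_def sum_distrib_left by (subst sum.swap, subst sum.swap) (rule refl)
  also have "\<dots> = (\<Sum>w\<in>verts G - {q}. \<Sum>k<u w. \<psi> w - \<psi> (opp G w ((nxt G w ^^ Suc k) (\<sigma> w))))"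
    using \<sigma> by (intro sum.cong refl * nxt_funpow_inc) (auto simp: rotor_config_def)
  finally show ?thesis .
qed

text \<open>Every full turn contributes \<open>lap \<psi> w\<close>, hence at most -1. The
  incomplete turn has fewer than \<open>card (inc G w)\<close> advances, each contributing at most
  \<open>B\<close>.\<close>

lemma rotor_drift:
  fixes \<psi> :: "'v \<Rightarrow> int"
  assumes e: "e \<in> inc G w" and \<psi>: "\<And>w. 0 \<le> \<psi> w" "\<psi> w \<le> B" "lap \<psi> w \<le> -1"
  shows "(\<Sum>k<u. \<psi> w - \<psi> (opp G w ((nxt G w ^^ Suc k) e))) \<le>
    B * int (card (inc G w)) - int (u div card (inc G w))"
proof -
  define d a b where "d = card (inc G w)" and "a = u div d" and "b = u mod d"
  define f where "f k = \<psi> w - \<psi> (opp G w ((nxt G w ^^ Suc k) e))" for k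
  have "d > 0" unfolding d_def using e finite_inc card_gt_0_iff by blast
  then have u: "u = a * d + b" "b \<le> d" by (auto simp: a_def b_def less_imp_le)
  have "f (a * d + k) = f k" for k
  proof -
    have "(nxt G w ^^ (Suc k + a * d)) e = (nxt G w ^^ Suc k) e"
      unfolding funpow_add comp_apply d_def nxt_full_turns[OF e] ..
    then show ?thesis by (simp only: f_def add_Suc_right add_Suc add.commute[of _ "a * d"])
  qed
  then have "(\<Sum>k<u. f k) = (\<Sum>k<a * d. f k) + (\<Sum>k<b. f k)"
    by (simp add: u(1) sum_lessThan_add)
  also have "(\<Sum>k<a * d. f k) = int a * lap \<psi> w"
    unfolding f_def d_def using sum_full_turns[OF e, of "\<lambda>e. \<psi> w - \<psi> (opp G w e)" a] inc_verts[OF e]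
    by (simp add: lap_def)
  also have "int a * lap \<psi> w \<le> int a * (-1)" using \<psi>(3) by (rule mult_left_mono) simp
  also have "(\<Sum>k<b. f k) \<le> (\<Sum>k<b. B)"
    using \<psi> by (intro sum_mono) (auto simp: f_def intro: order_trans[OF _ \<psi>(2)])
  also have "(\<Sum>k<b. B) = B * int b" by simp
  also have "B * int b \<le> B * int d" using u(2) \<psi>(1)[of w] \<psi>(2) by (intro mult_left_mono) auto
  finally show ?thesis unfolding f_def d_def a_def by simp
qed

text \<open>The last clause is the tree property with the chip as a second root: following rotors
  leads to the chip or to the sink. A step re-aims only the rotor under the chip, at the new
  position of the chip, so rotor paths that ended at the old position now continue to the new
  one.\<close>

lemma rotor_walk_invariant:
  assumes \<sigma>: "rotor_config q \<sigma>" and ld: "\<And>w. w \<in> verts G \<Longrightarrow> leads q \<sigma> w"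
    and v: "v \<in> verts G" and q: "q \<in> verts G"
    and nq: "\<And>m. m < n \<Longrightarrow> snd ((rotor_step G ^^ m) (\<sigma>, v)) \<noteq> q"
    and st: "(rotor_step G ^^ n) (\<sigma>, v) = (\<sigma>', v')"
  shows "\<exists>u. (\<forall>w. \<sigma>' w = (nxt G w ^^ u w) (\<sigma> w)) \<and> v' \<in> verts G \<and> (\<Sum>w\<in>verts G - {q}. u w) = n \<and>
    (\<forall>z. flow q \<sigma> u z = of_bool (v = z) - of_bool (v' = z)) \<and>
    (\<forall>w\<in>verts G. \<exists>k. (rotor_next q \<sigma>' ^^ k) w \<in> {v', q})"
  using nq st
proof (induction n arbitrary: \<sigma>' v')
  case 0
  then show ?case using v ld
    by (intro exI[of _ "\<lambda>_. 0"]) (auto simp: flow_def leads_def)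
next
  case (Suc n)
  obtain \<sigma>1 v1 where st1: "(rotor_step G ^^ n) (\<sigma>, v) = (\<sigma>1, v1)" by fastforce
  obtain u where u: "\<And>w. \<sigma>1 w = (nxt G w ^^ u w) (\<sigma> w)" "v1 \<in> verts G" "(\<Sum>w\<in>verts G - {q}. u w) = n"
    "\<And>z. flow q \<sigma> u z = of_bool (v = z) - of_bool (v1 = z)"
    "\<And>w. w \<in> verts G \<Longrightarrow> \<exists>k. (rotor_next q \<sigma>1 ^^ k) w \<in> {v1, q}"
    using Suc.IH[OF _ st1] Suc.prems(1) by (metis less_SucI)
  have v1: "v1 \<in> verts G - {q}" using Suc.prems(1)[of n] st1 u(2) by simp
  define e where "e = nxt G v1 (\<sigma>1 v1)"
  have e: "e \<in> inc G v1"
    using \<sigma> v1 u(1) nxt_inc nxt_funpow_inc unfolding e_def rotor_config_def by metis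
  have s: "\<sigma>' = \<sigma>1(v1 := e)" "v' = opp G v1 e"
    using Suc.prems(2) st1 by (auto simp: rotor_step_def Let_def e_def)
  define u' where "u' w = u w + of_bool (w = v1)" for w
  have "\<sigma>' w = (nxt G w ^^ u' w) (\<sigma> w)" for w
    using u(1) by (simp add: s u'_def e_def)
  moreover have "v' \<in> verts G" using opp_verts[OF e] s by simp
  moreover have "(\<Sum>w\<in>verts G - {q}. u' w) = Suc n"
    unfolding u'_def sum.distrib u(3) using v1 finite_verts by (simp add: of_bool_def)
  moreover have "flow q \<sigma> u' z = of_bool (v = z) - of_bool (v' = z)" for z
  proof -
    have "flow q \<sigma> u' z = flow q \<sigma> u z + flow q \<sigma>1 (\<lambda>w. of_bool (w = v1)) z"
      unfolding u'_def[abs_def] by (subst flow_add) (simp add: u(1)[symmetric])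
    then show ?thesis using u(4) flow_single[OF v1, of \<sigma>1 z] s by (simp add: move_def e_def)
  qed
  moreover have "\<exists>m. (rotor_next q \<sigma>' ^^ m) w \<in> {v', q}"
    if "(rotor_next q \<sigma>1 ^^ k) w \<in> {v1, q}" for k w
    using that
  proof (induction k arbitrary: w)
    case 0
    have "(rotor_next q \<sigma>' ^^ 1) v1 = v'" using v1 s by (simp add: rotor_next_def)
    moreover have "(rotor_next q \<sigma>' ^^ 0) q = q" by simp
    ultimately show ?case using 0 by (metis empty_iff funpow_0 insert_iff)
  next
    case (Suc k)
    show ?case
    proof (cases "w = v1")
      case True
      then have "(rotor_next q \<sigma>' ^^ 1) w = v'" using v1 s by (simp add: rotor_next_def)
      then show ?thesis by blast
    next
      case False
      have "\<exists>m. (rotor_next q \<sigma>' ^^ m) (rotor_next q \<sigma>1 w) \<in> {v', q}"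
        using Suc by (simp add: funpow_swap1)
      moreover have "rotor_next q \<sigma>1 w = rotor_next q \<sigma>' w" using False s by (simp add: rotor_next_def)
      ultimately obtain m where "(rotor_next q \<sigma>' ^^ Suc m) w \<in> {v', q}"
        by (auto simp: funpow_swap1)
      then show ?thesis by blast
    qed
  qed
  ultimately show ?case using u(5) by (intro exI[of _ u'] conjI allI ballI) (blast+)
qed

text \<open>The potential \<open>\<psi>\<close> at the chip stays between 0 and \<open>B\<close>,
  whereas by \<open>rotor_drift\<close> each full turn of a rotor raises it, up to a bounded error.
  So the total number of full turns is bounded.\<close>

lemma rotor_walk_terminates:
  assumes \<sigma>: "rotor_config q \<sigma>" and ld: "\<And>w. w \<in> verts G \<Longrightarrow> leads q \<sigma> w"
    and v: "v \<in> verts G" and q: "q \<in> verts G"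
  shows "\<exists>n. snd ((rotor_step G ^^ n) (\<sigma>, v)) = q"
proof (rule ccontr)
  assume "\<nexists>n. snd ((rotor_step G ^^ n) (\<sigma>, v)) = q"
  then have nq: "snd ((rotor_step G ^^ n) (\<sigma>, v)) \<noteq> q" for n by blast
  obtain \<psi> where \<psi>: "\<And>w. 0 \<le> \<psi> w" "\<And>w. w \<in> verts G - {q} \<Longrightarrow> lap \<psi> w \<le> -1"
    using exists_potential[OF q] by metis
  define B where "B = (\<Sum>w\<in>verts G. \<psi> w)"
  have B: "\<psi> w \<le> B" if "w \<in> verts G" for w
    unfolding B_def using that finite_verts \<psi>(1) by (intro member_le_sum) auto
  define V where "V = verts G - {q}"
  define C where "C = nat (B + (\<Sum>w\<in>V. B * int (card (inc G w))))"
  define M where "M = card (edges G)"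
  \<comment> \<open>A rotor with \<open>t\<close> full turns has made at most
    \<open>(t + 1) * M\<close> advances. So \<open>(C + card V) * M\<close> bounds the number of
    steps with at most \<open>C\<close> full turns in total, and \<open>n\<close> is one
    more.\<close>
  define n where "n = Suc ((C + card V) * M)"
  obtain \<sigma>' v' where "(rotor_step G ^^ n) (\<sigma>, v) = (\<sigma>', v')" by fastforce
  from rotor_walk_invariant[OF \<sigma> ld v q nq this] obtain u where
    u: "v' \<in> verts G" "(\<Sum>w\<in>V. u w) = n" "\<And>z. flow q \<sigma> u z = of_bool (v = z) - of_bool (v' = z)"
    unfolding V_def by blast
  have "(\<Sum>z\<in>verts G. \<psi> z * of_bool (x = z)) = \<psi> x" if "x \<in> verts G" for x
    using that finite_verts by (simp add: of_bool_def if_distrib cong: if_cong)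
  then have "\<psi> v - \<psi> v' = (\<Sum>z\<in>verts G. \<psi> z * flow q \<sigma> u z)"
    unfolding u(3) using u(1) v by (simp add: right_diff_distrib sum_subtractf)
  also have "\<dots> \<le> (\<Sum>w\<in>V. B * int (card (inc G w)) - int (u w div card (inc G w)))"
    unfolding weighted_flow[OF \<sigma>] V_def using \<sigma> \<psi> B
    by (intro sum_mono rotor_drift) (auto simp: rotor_config_def)
  finally have "int (\<Sum>w\<in>V. u w div card (inc G w)) \<le> B + (\<Sum>w\<in>V. B * int (card (inc G w)))"
    using B[OF u(1)] \<psi>(1)[of v] by (simp add: sum_subtractf)
  then have le: "(\<Sum>w\<in>V. u w div card (inc G w)) \<le> C" unfolding C_def by linarith
  have "u w \<le> (u w div card (inc G w) + 1) * M" if w: "w \<in> V" for w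
  proof -
    let ?d = "card (inc G w)"
    have "\<sigma> w \<in> inc G w" using \<sigma> w by (simp add: rotor_config_def V_def)
    then have d: "0 < ?d" using finite_inc card_gt_0_iff by blast
    have "u w mod ?d \<le> ?d" using d by (simp add: less_imp_le)
    then have "u w \<le> u w div ?d * ?d + ?d" using div_mult_mod_eq[of "u w" ?d] by linarith
    also have "\<dots> = (u w div ?d + 1) * ?d" by simp
    also have "\<dots> \<le> (u w div ?d + 1) * M"
      unfolding M_def by (intro mult_le_mono2 card_mono[OF finite_edges]) (auto simp: inc_def)
    finally show ?thesis .
  qed
  then have "n \<le> (\<Sum>w\<in>V. (u w div card (inc G w) + 1) * M)" unfolding u(2)[symmetric] by (rule sum_mono)
  also have "\<dots> = ((\<Sum>w\<in>V. u w div card (inc G w)) + card V) * M"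
    by (simp only: sum_distrib_right[symmetric] sum.distrib) simp
  also have "\<dots> \<le> (C + card V) * M" using le by (intro mult_le_mono1) simp
  finally show False by (simp add: n_def)
qed

lemma while_eq_funpow:
  assumes "\<not> b ((c ^^ n) s)" "\<And>m. m < n \<Longrightarrow> b ((c ^^ m) s)"
  shows "while b c s = (c ^^ n) s"
proof -
  have "(LEAST k. \<not> b ((c ^^ k) s)) = n"
    using assms by (intro Least_equality) (auto simp: not_less[symmetric])
  then show ?thesis unfolding while_def while_option_def using assms(1) by auto
qed

lemma route_routes:
  assumes T: "T \<in> spanning_trees G" and v: "v \<in> verts G" and q: "q \<in> verts G"
  shows "routes q T (\<lambda>z. of_bool (v = z) - of_bool (q = z)) (route G q v T)"
proof -
  let ?s = "tree_rotors G q T"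
  have \<sigma>: "rotor_config q ?s" and ld: "\<And>w. w \<in> verts G \<Longrightarrow> leads q ?s w"
    using tree_rotors_config tree_rotors_leads T q by auto
  define n where "n = (LEAST n. snd ((rotor_step G ^^ n) (?s, v)) = q)"
  have n: "snd ((rotor_step G ^^ n) (?s, v)) = q"
    unfolding n_def using rotor_walk_terminates[OF \<sigma> ld v q] by (rule LeastI_ex)
  have nq: "snd ((rotor_step G ^^ m) (?s, v)) \<noteq> q" if "m < n" for m
    using not_less_Least that unfolding n_def by blast
  obtain \<sigma>' where st: "(rotor_step G ^^ n) (?s, v) = (\<sigma>', q)" using n by (metis prod.collapse)
  obtain u where u: "\<And>w. \<sigma>' w = (nxt G w ^^ u w) (?s w)"
    "\<And>z. flow q ?s u z = of_bool (v = z) - of_bool (q = z)"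
    "\<And>w. w \<in> verts G \<Longrightarrow> \<exists>k. (rotor_next q \<sigma>' ^^ k) w \<in> {q, q}"
    using rotor_walk_invariant[OF \<sigma> ld v q nq st] by blast
  have "while (\<lambda>(\<sigma>, u). u \<noteq> q) (rotor_step G) (?s, v) = (\<sigma>', q)"
    using while_eq_funpow[where b = "\<lambda>(\<sigma>, u). u \<noteq> q" and c = "rotor_step G" and n = n and s = "(?s, v)"] st n nq
    by (simp add: case_prod_beta)
  then have r: "route G q v T = \<sigma>' ` (verts G - {q})" by (simp add: route_def)
  have \<sigma>': "rotor_config q \<sigma>'" using \<sigma> u(1) nxt_funpow_inc by (simp add: rotor_config_def)
  have "leads q \<sigma>' w" if "w \<in> verts G" for w using u(3)[OF that] by (auto simp: leads_def)
  note tr = leads_spanning_tree[OF \<sigma>' q this]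
  show ?thesis
    unfolding routes_def r using tr u(1,2) by (intro conjI exI[of _ u]) auto
qed

lemma fold_route_routes:
  assumes "T \<in> spanning_trees G" and q: "q \<in> verts G" and "set vs \<subseteq> verts G"
  shows "routes q T (\<lambda>z. \<Sum>v\<leftarrow>vs. of_bool (v = z) - of_bool (q = z)) (fold (route G q) vs T)"
  using assms(1,3)
proof (induction vs arbitrary: T)
  case Nil
  then show ?case using routes_refl by simp
next
  case (Cons v vs)
  have r: "routes q T (\<lambda>z. of_bool (v = z) - of_bool (q = z)) (route G q v T)"
    using route_routes Cons q by simp
  then have "route G q v T \<in> spanning_trees G" by (simp add: routes_def)
  with Cons have "routes q (route G q v T) (\<lambda>z. \<Sum>v\<leftarrow>vs. of_bool (v = z) - of_bool (q = z))
    (fold (route G q) vs (route G q v T))" by simp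
  from routes_trans[OF r this] show ?case by simp
qed

end


section \<open>Divisor classes and the two actions\<close>

context ribbon_graph
begin

text \<open>The final rotor fixes the number of advances modulo the degree, so the two vectors
  differ by full turns, whose flow is principal.\<close>

lemma flow_mod_principal:
  assumes \<sigma>: "rotor_config q \<sigma>" and q: "q \<in> verts G"
    and eq: "\<And>w. w \<in> verts G - {q} \<Longrightarrow> (nxt G w ^^ u w) (\<sigma> w) = (nxt G w ^^ u' w) (\<sigma> w)"
  shows "\<exists>\<phi>. \<forall>z. flow q \<sigma> u z = flow q \<sigma> u' z + lap \<phi> z"
proof -
  let ?d = "\<lambda>w. card (inc G w)"
  define a where "a v w = (if w = q then 0 else v w div ?d w)" for v w
  define b where "b v w = (if w = q then 0 else v w mod ?d w)" for v w
  have fl: "flow q \<sigma> v z = lap (\<lambda>w. int (a v w)) z + flow q \<sigma> (b v) z" for v z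
  proof -
    have "flow q \<sigma> v z = flow q \<sigma> (\<lambda>w. a v w * ?d w + b v w) z"
      by (rule flow_cong) (simp add: a_def b_def)
    then show ?thesis using flow_turns_add[OF \<sigma> q, of "a v" "b v" z] by (simp add: a_def)
  qed
  have "b u w = b u' w" if w: "w \<in> verts G - {q}" for w
  proof -
    have i: "\<sigma> w \<in> inc G w" using \<sigma> w by (simp add: rotor_config_def)
    then have "0 < ?d w" using finite_inc card_gt_0_iff by blast
    moreover have "(nxt G w ^^ (u w mod ?d w)) (\<sigma> w) = (nxt G w ^^ (u' w mod ?d w)) (\<sigma> w)"
      using eq[OF w] cyclic_on_funpow_mod[OF nxt_cyclic[OF i] i] by simp
    ultimately show ?thesis
      using cyclic_on_funpow_inj[OF nxt_cyclic[OF i] i, of "u w mod ?d w" "u' w mod ?d w"] w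
      by (simp add: b_def)
  qed
  then have "flow q \<sigma> (b u) z = flow q \<sigma> (b u') z" for z by (intro flow_cong) auto
  then have "flow q \<sigma> u z = flow q \<sigma> u' z + lap (\<lambda>w. int (a u w) - int (a u' w)) z" for z
    using fl[of u z] fl[of u' z] by (simp add: lap_diff)
  then show ?thesis by blast
qed

text \<open>The routing may turn all rotors many times. Modulo principal divisors it can be replaced
  by \<open>k\<close> advances at \<open>b\<close> and none elsewhere, since these produce the same
  final rotors.\<close>

lemma routes_one_rotor:
  assumes T: "T \<in> spanning_trees G" and q: "q \<in> verts G" and r: "routes q T D T'"
    and b: "b \<in> verts G - {q}"
    and eq: "\<And>w. w \<in> verts G - {q, b} \<Longrightarrow> tree_rotors G q T' w = tree_rotors G q T w"
    and k: "(nxt G b ^^ k) (tree_rotors G q T b) = tree_rotors G q T' b"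
  shows "\<exists>\<phi>. \<forall>z\<in>verts G. D z = (\<Sum>j<k. move b ((nxt G b ^^ Suc j) (tree_rotors G q T b)) z) + lap \<phi> z"
proof -
  let ?s = "tree_rotors G q T"
  obtain u where u: "\<And>w. w \<in> verts G - {q} \<Longrightarrow> tree_rotors G q T' w = (nxt G w ^^ u w) (?s w)"
    "\<And>z. z \<in> verts G \<Longrightarrow> flow q ?s u z = D z"
    using r by (auto simp: routes_def)
  define u' where "u' w = (if w = b then k else 0)" for w
  have "(nxt G w ^^ u w) (?s w) = (nxt G w ^^ u' w) (?s w)" if w: "w \<in> verts G - {q}" for w
    using u(1)[OF w] eq[of w] k w by (cases "w = b") (auto simp: u'_def)
  from flow_mod_principal[OF tree_rotors_config[OF T q] q this]
  obtain \<phi> where \<phi>: "\<And>z. flow q ?s u z = flow q ?s u' z + lap \<phi> z" by blast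
  have "flow q ?s u' z = (\<Sum>j<k. move b ((nxt G b ^^ Suc j) (?s b)) z)" for z
    unfolding flow_def using b finite_verts
    by (subst sum.remove[of _ b]) (auto simp: u'_def intro!: sum.neutral)
  then show ?thesis using \<phi> u(2) by (intro exI[of _ \<phi>]) auto
qed

section \<open>Coefficients of divisors and their classes\<close>

abbreviation coeff :: "('v \<Rightarrow>\<^sub>0 int) \<Rightarrow> 'v \<Rightarrow> int" where
  "coeff \<equiv> Poly_Mapping.lookup"

lemma keys_subset_iff: "Poly_Mapping.keys D \<subseteq> S \<longleftrightarrow> (\<forall>z. z \<notin> S \<longrightarrow> coeff D z = 0)"
  by (auto simp: in_keys_iff)

lemma coeff_laplacian: "coeff (laplacian G f) z = lap f z"
proof -
  have "coeff (laplacian G f) z =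
      (\<Sum>v\<in>verts G. (\<Sum>e\<in>inc G v. f v - f (opp G v e)) * (if z = v then 1 else 0))"
    by (simp add: laplacian_def lookup_sum)
  also have "\<dots> = (\<Sum>v\<in>verts G. if z = v then lap f z else 0)"
    by (intro sum.cong) (auto simp: lap_def)
  also have "\<dots> = lap f z" using finite_verts by (simp add: lap_def)
  finally show ?thesis .
qed

lemma laplacian_add: "laplacian G (\<lambda>w. f w + g w) = laplacian G f + laplacian G g"
  by (rule poly_mapping_eqI) (simp add: coeff_laplacian lookup_add lap_add)

lemma divisor_class_eq: "divisor_class G D = {laplacian G f + D | f. True}"
  by (auto simp: divisor_class_def r_coset_def Prin_def Div_def)

lemma divisor_class_eq_iff:
  assumes "Poly_Mapping.keys D \<subseteq> verts G" "Poly_Mapping.keys D' \<subseteq> verts G"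
  shows "divisor_class G D = divisor_class G D' \<longleftrightarrow> (\<exists>\<phi>. \<forall>z\<in>verts G. coeff D z = coeff D' z + lap \<phi> z)"
proof
  assume eq: "divisor_class G D = divisor_class G D'"
  have "laplacian G (\<lambda>_. 0) = 0" by (rule poly_mapping_eqI) (simp add: coeff_laplacian)
  then have "D \<in> divisor_class G D" unfolding divisor_class_eq by force
  then have "D \<in> divisor_class G D'" using eq by simp
  then obtain f where "D = laplacian G f + D'" unfolding divisor_class_eq by blast
  then have "coeff D z = coeff D' z + lap f z" for z
    by (simp add: lookup_add coeff_laplacian)
  then show "\<exists>\<phi>. \<forall>z\<in>verts G. coeff D z = coeff D' z + lap \<phi> z" by blast
next
  assume "\<exists>\<phi>. \<forall>z\<in>verts G. coeff D z = coeff D' z + lap \<phi> z"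
  then obtain \<phi> where \<phi>: "\<And>z. z \<in> verts G \<Longrightarrow> coeff D z = coeff D' z + lap \<phi> z" by blast
  have D: "D = laplacian G \<phi> + D'"
  proof (rule poly_mapping_eqI)
    fix z show "coeff D z = coeff (laplacian G \<phi> + D') z"
      using \<phi>[of z] assms unfolding keys_subset_iff
      by (cases "z \<in> verts G") (auto simp: lookup_add coeff_laplacian lap_def)
  qed
  have sub: "{laplacian G f + (laplacian G g + E) | f. True} \<subseteq> {laplacian G f + E | f. True}" for g E
  proof clarify
    fix f show "\<exists>f'. laplacian G f + (laplacian G g + E) = laplacian G f' + E \<and> True"
      by (intro exI[of _ "\<lambda>w. f w + g w"]) (simp add: laplacian_add add.assoc)
  qed
  have "laplacian G (\<lambda>w. - \<phi> w) + laplacian G \<phi> = 0"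
    by (rule poly_mapping_eqI) (simp add: coeff_laplacian lookup_add lap_minus)
  then have D': "D' = laplacian G (\<lambda>w. - \<phi> w) + D"
    by (subst D) (simp flip: add.assoc)
  show "divisor_class G D = divisor_class G D'"
    unfolding divisor_class_eq
    using sub[of \<phi> D', folded D] sub[of "\<lambda>w. - \<phi> w" D, folded D'] by (rule equalityI)
qed

lemma divisor_class_mult:
  "divisor_class G D \<otimes>\<^bsub>Pic G\<^esub> divisor_class G D' = divisor_class G (D + D')"
proof -
  have "{x + y | x y. x \<in> divisor_class G D \<and> y \<in> divisor_class G D'} = divisor_class G (D + D')"
  proof (intro equalityI subsetI)
    fix z assume "z \<in> {x + y | x y. x \<in> divisor_class G D \<and> y \<in> divisor_class G D'}"
    then obtain f g where "z = (laplacian G f + D) + (laplacian G g + D')"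
      unfolding divisor_class_eq by blast
    then have "z = laplacian G (\<lambda>w. f w + g w) + (D + D')"
      by (simp add: laplacian_add algebra_simps)
    then show "z \<in> divisor_class G (D + D')" unfolding divisor_class_eq by blast
  next
    fix z assume "z \<in> divisor_class G (D + D')"
    then obtain f where z: "z = (laplacian G f + D) + D'"
      unfolding divisor_class_eq by (auto simp: add.assoc)
    have "laplacian G (\<lambda>_. 0) = 0" by (rule poly_mapping_eqI) (simp add: coeff_laplacian)
    then have "D' \<in> divisor_class G D'" unfolding divisor_class_eq by force
    moreover have "laplacian G f + D \<in> divisor_class G D" unfolding divisor_class_eq by blast
    ultimately show "z \<in> {x + y | x y. x \<in> divisor_class G D \<and> y \<in> divisor_class G D'}"
      using z by blast
  qed
  moreover have "divisor_class G D \<otimes>\<^bsub>Pic G\<^esub> divisor_class G D' =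
      {x + y | x y. x \<in> divisor_class G D \<and> y \<in> divisor_class G D'}"
    by (auto simp: Pic_def FactGroup_def set_mult_def Div_def)
  ultimately show ?thesis by simp
qed

lemma deg_eq_sum:
  assumes "Poly_Mapping.keys D \<subseteq> verts G"
  shows "deg D = (\<Sum>z\<in>verts G. coeff D z)"
  unfolding deg_def using assms finite_verts
  by (intro sum.mono_neutral_left) (auto simp: in_keys_iff)

lemma divisor_class_in_Pic:
  assumes "Poly_Mapping.keys D \<subseteq> verts G" "(\<Sum>z\<in>verts G. coeff D z) = 0"
  shows "divisor_class G D \<in> Pic_deg G 0"
  unfolding Pic_deg_def using assms deg_eq_sum by (auto simp: Div_def)

lemma coeff_chip_list:
  "coeff (\<Sum>v\<leftarrow>vs. frag_of v - frag_of q) z = (\<Sum>v\<leftarrow>vs. of_bool (v = z) - of_bool (q = z))"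
  by (induction vs) (auto simp: lookup_add lookup_minus)

lemma chip_list_keys:
  assumes "set vs \<subseteq> verts G" "q \<in> verts G"
  shows "Poly_Mapping.keys (\<Sum>v\<leftarrow>vs. frag_of v - frag_of q) \<subseteq> verts G"
  unfolding keys_subset_iff coeff_chip_list
proof (intro allI impI)
  fix z assume "z \<notin> verts G"
  then show "(\<Sum>v\<leftarrow>vs. of_bool (v = z) - of_bool (q = z)) = (0 :: int)"
    using assms by (induction vs) auto
qed

text \<open>Here the definite description in \<open>rotor_action\<close> is resolved:
  \<open>exists_effective\<close> provides a list of chips in the class, and
  \<open>routes_unique\<close> shows that every such list leads to the same tree.\<close>

lemma rotor_action_routes:
  assumes T: "T \<in> spanning_trees G" and q: "q \<in> verts G"
    and D: "Poly_Mapping.keys D \<subseteq> verts G" "(\<Sum>z\<in>verts G. coeff D z) = 0"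
  obtains D' \<phi> where "routes q T D' (rotor_action G q (divisor_class G D) T)"
    "\<And>z. z \<in> verts G \<Longrightarrow> D' z = coeff D z + lap \<phi> z"
proof -
  let ?P = "\<lambda>T' vs. set vs \<subseteq> verts G \<and>
     divisor_class G (\<Sum>v\<leftarrow>vs. frag_of v - frag_of q) = divisor_class G D \<and> T' = fold (route G q) vs T"
  let ?D = "\<lambda>vs z. \<Sum>v\<leftarrow>vs. of_bool (v = z) - of_bool (q = z) :: int"
  have equiv: "\<exists>\<phi>. \<forall>z\<in>verts G. ?D vs z = coeff D z + lap \<phi> z" if "?P T' vs" for T' vs
  proof -
    have "\<exists>\<phi>. \<forall>z\<in>verts G. coeff (\<Sum>v\<leftarrow>vs. frag_of v - frag_of q) z = coeff D z + lap \<phi> z"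
      using that divisor_class_eq_iff[OF chip_list_keys[OF _ q] D(1)] by blast
    then show ?thesis unfolding coeff_chip_list .
  qed
  obtain vs \<phi> where vs: "set vs \<subseteq> verts G" "\<And>z. z \<in> verts G \<Longrightarrow> ?D vs z = coeff D z + lap \<phi> z"
    using exists_effective[OF q D(2)] by metis
  have P: "?P (fold (route G q) vs T) vs"
  proof -
    have "\<forall>z\<in>verts G. coeff (\<Sum>v\<leftarrow>vs. frag_of v - frag_of q) z = coeff D z + lap \<phi> z"
      unfolding coeff_chip_list using vs(2) by blast
    then show ?thesis
      using vs(1) divisor_class_eq_iff[OF chip_list_keys[OF vs(1) q] D(1)] by blast
  qed
  have uniq: "T' = fold (route G q) vs T" if P': "\<exists>vs'. ?P T' vs'" for T'
  proof -
    obtain vs' where vs': "?P T' vs'" using P' by (rule exE)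
    from equiv[OF vs'] obtain \<phi>' where \<phi>': "\<forall>z\<in>verts G. ?D vs' z = coeff D z + lap \<phi>' z"
      by (rule exE)
    have "?D vs' z - ?D vs z = lap (\<lambda>w. \<phi>' w - \<phi> w) z" if "z \<in> verts G" for z
      using bspec[OF \<phi>' that] vs(2)[OF that] by (simp add: lap_diff)
    moreover have "routes q T (?D vs') T'" using fold_route_routes[OF T q, of vs'] vs' by simp
    ultimately show ?thesis
      by (intro routes_unique[OF T q _ fold_route_routes[OF T q vs(1)]])
  qed
  have ex: "\<exists>vs'. ?P (fold (route G q) vs T) vs'" using P by (rule exI)
  have "rotor_action G q (divisor_class G D) T = fold (route G q) vs T"
    unfolding rotor_action_def by (rule the_equality) (rule ex, rule uniq)
  then show ?thesis using that[of "?D vs" \<phi>] fold_route_routes[OF T q vs(1)] vs(2) by simp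
qed

section \<open>Bernardi divisors and the hypothesis that the actions agree\<close>

lemma chip_position_verts:
  assumes "s \<in> halfedges"
  shows "chip_position G s T f \<in> verts G"
  unfolding chip_position_def using tour_halfedges[OF assms] halfedges_case inc_verts by blast

lemma coeff_bernardi_divisor:
  "coeff (bernardi_divisor G s T) z = (\<Sum>f\<in>edges G - T. of_bool (chip_position G s T f = z))"
  by (auto simp: bernardi_divisor_def lookup_sum intro!: sum.cong)

lemma bernardi_divisor_keys:
  assumes "s \<in> halfedges"
  shows "Poly_Mapping.keys (bernardi_divisor G s T) \<subseteq> verts G"
  unfolding keys_subset_iff coeff_bernardi_divisor
  using chip_position_verts[OF assms] by (auto intro!: sum.neutral)

lemma sum_bernardi_divisor:
  assumes "s \<in> halfedges"
  shows "(\<Sum>z\<in>verts G. coeff (bernardi_divisor G s T) z) = int (card (edges G - T))"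
proof -
  have "(\<Sum>z\<in>verts G. of_bool (x = z)) = (1 :: int)" if "x \<in> verts G" for x
    using that finite_verts by (simp add: of_bool_def)
  then show ?thesis unfolding coeff_bernardi_divisor
    by (subst sum.swap) (simp add: chip_position_verts[OF assms])
qed

text \<open>Applying the hypothesis to the class \<open>0\<close>, which acts trivially through \<open>rotor_action\<close>, shows that
  \<open>inv_into\<close> inverts the Bernardi map; its injectivity needs no separate proof.\<close>

lemma actions_agree_routes:
  assumes q: "q \<in> verts G" "inc G q \<noteq> {}"
    and T: "T \<in> spanning_trees G" "T' \<in> spanning_trees G" "card (edges G - T) = card (edges G - T')"
    and agree: "\<And>x T. x \<in> Pic_deg G 0 \<Longrightarrow> T \<in> spanning_trees G \<Longrightarrow>
      rotor_action G q x T = bernardi_action G q x T"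
  defines "s \<equiv> (q, SOME e. e \<in> inc G q)"
  obtains D \<phi> where "routes q T D T'"
    "\<And>z. z \<in> verts G \<Longrightarrow> D z =
      coeff (bernardi_divisor G s T') z - coeff (bernardi_divisor G s T) z + lap \<phi> z"
proof -
  have s: "s \<in> halfedges" using q some_in_eq[of "inc G q"] by (auto simp: s_def halfedges_iff)
  let ?b = "bernardi_divisor G s"
  let ?E = "?b T' - ?b T"
  have E: "Poly_Mapping.keys ?E \<subseteq> verts G" "(\<Sum>z\<in>verts G. coeff ?E z) = 0"
    using bernardi_divisor_keys[OF s] sum_bernardi_divisor[OF s] T(3) unfolding keys_subset_iff
    by (auto simp: lookup_minus sum_subtractf)
  have act: "bernardi_action G q (divisor_class G D) S =
      inv_into (spanning_trees G) (bernardi_class G s) (divisor_class G (D + ?b S))" for D S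
    by (simp add: bernardi_action_def bernardi_action_from_def s_def divisor_class_mult bernardi_class_def)
  have "rotor_action G q (divisor_class G 0) T' = T'"
  proof (rule rotor_action_routes[OF T(2) q(1), of 0])
    fix D' \<phi> assume "routes q T' D' (rotor_action G q (divisor_class G 0) T')"
      "\<And>z. z \<in> verts G \<Longrightarrow> D' z = coeff 0 z + lap \<phi> z"
    then show ?thesis using routes_unique[OF T(2) q(1) _ routes_refl[OF T(2)], of D' _ \<phi>] by simp
  qed auto
  moreover have "divisor_class G 0 \<in> Pic_deg G 0" by (rule divisor_class_in_Pic) auto
  ultimately have "inv_into (spanning_trees G) (bernardi_class G s) (divisor_class G (?b T')) = T'"
    using agree[of "divisor_class G 0" T'] act[of 0 T'] T(2) by simp
  then have "bernardi_action G q (divisor_class G ?E) T = T'" using act[of ?E T] by simp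
  then have "rotor_action G q (divisor_class G ?E) T = T'"
    using agree[OF divisor_class_in_Pic[OF E] T(1)] by simp
  then show ?thesis
    using rotor_action_routes[OF T(1) q(1) E] that by (auto simp: lookup_minus)
qed

end


section \<open>Trees that differ in one edge at a vertex\<close>

text \<open>Here \<open>U\<close> is a component of \<open>G - b\<close>, and \<open>F\<close> consists of a spanning tree of \<open>U\<close> and one of its
  complement. The tour starts at \<open>a\<close> with the edge \<open>e\<close>.\<close>

locale half_tree = ribbon_graph G for G :: "('v, 'e) ribbon_graph" +
  fixes U :: "'v set" and b :: 'v and F :: "'e set" and a :: 'v and e :: 'e
  assumes U: "U \<subseteq> verts G" and b: "b \<in> verts G" "b \<notin> U"
    and F: "forest F" "F \<subseteq> edges G"
    and F_sides: "\<And>f. f \<in> F \<Longrightarrow> ends G f \<subseteq> U \<or> ends G f \<inter> U = {}"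
    and edge_sides: "\<And>f. f \<in> edges G \<Longrightarrow>
      ends G f \<subseteq> U \<or> ends G f \<inter> U = {} \<or> (f \<in> inc G b \<and> opp G b f \<in> U)"
    and conn_U: "\<And>u w. u \<in> U \<Longrightarrow> w \<in> U \<Longrightarrow> conn F u w"
    and conn_compl: "\<And>u. u \<in> verts G - U \<Longrightarrow> conn F u b"
    and start: "a \<in> U" "e \<in> inc G a"
begin

text \<open>These need not be cut edges of \<open>G\<close>; the name refers to \<open>F\<close>,
  whose two sides each of them joins to a spanning tree.\<close>

definition bridges :: "'e set" where
  "bridges = {g \<in> inc G b. opp G b g \<in> U}"

abbreviation tip :: "'e \<Rightarrow> 'v" where
  "tip g \<equiv> opp G b g"

lemma bridges:
  assumes "g \<in> bridges"
  shows "g \<in> edges G" "g \<in> inc G b" "tip g \<in> U" "ends G g = {b, tip g}" "g \<in> inc G (tip g)"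
    "opp G (tip g) g = b" "g \<notin> F"
proof -
  show g: "g \<in> inc G b" "tip g \<in> U" using assms by (auto simp: bridges_def)
  then show en: "ends G g = {b, tip g}" "g \<in> edges G" "g \<in> inc G (tip g)" "opp G (tip g) g = b"
    using ends_opp inc_edges opp_inc opp_opp by auto
  show "g \<notin> F" using F_sides[of g] en g b by auto
qed

lemma finite_bridges: "finite bridges"
  using finite_inc by (simp add: bridges_def)

lemma not_conn_sides: "x \<in> U \<Longrightarrow> y \<notin> U \<Longrightarrow> \<not> conn F x y"
  using conn_closed F_sides by blast

lemma conn_bridge: "g \<in> bridges \<Longrightarrow> \<not> conn F b (tip g)"
  using not_conn_sides bridges b conn_sym by metis

lemma forest_bridge: "g \<in> bridges \<Longrightarrow> forest (insert g F)"
  using forest_insert[OF F(1) bridges(4) conn_bridge] .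

lemma tree_bridge:
  assumes "g \<in> bridges"
  shows "insert g F \<in> spanning_trees G"
proof -
  let ?T = "insert g F"
  have FT: "conn ?T x y" if "conn F x y" for x y using that by (rule conn_mono) auto
  have "conn ?T b (tip g)" by (rule conn_edge[of g]) (use bridges assms in auto)
  then have "conn ?T u b" if "u \<in> verts G" for u
    using that conn_U[of u "tip g"] bridges(3)[OF assms] conn_compl[of u] FT
    by (cases "u \<in> U") (metis conn_sym conn_trans, blast)
  then have "conn ?T u w" if "u \<in> verts G" "w \<in> verts G" for u w
    using that by (meson conn_sym conn_trans)
  then show ?thesis
    unfolding spanning_trees_iff using bridges(1)[OF assms] F forest_bridge[OF assms] by auto
qed

text \<open>The tour of \<open>F\<close> stays in \<open>U\<close> and passes over all bridges. It
  serves as a common clock for the tours of all the trees \<open>insert g F\<close>.\<close>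

abbreviation half_tour :: "nat \<Rightarrow> 'v \<times> 'e" where
  "half_tour n \<equiv> (tour_step G F ^^ n) (a, e)"

abbreviation full_tour :: "'e \<Rightarrow> nat \<Rightarrow> 'v \<times> 'e" where
  "full_tour g n \<equiv> (tour_step G (insert g F) ^^ n) (a, e)"

lemma start_halfedge: "(a, e) \<in> halfedges"
  using start by (simp add: halfedges_iff)

lemma half_tour_U: "half_tour n \<in> halfedges" "fst (half_tour n) \<in> U"
  using tour_halfedges[OF start_halfedge] tour_conn[OF start_halfedge, of F n] not_conn_sides start(1)
  by auto

lemma half_tour_reaches: "z \<in> halfedges \<Longrightarrow> fst z \<in> U \<Longrightarrow> \<exists>n. half_tour n = z"
  using tour_reaches[OF F start(2), of "snd z" "fst z"] conn_U start(1) halfedges_case[of z] by auto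

definition pos :: "'e \<Rightarrow> nat" where
  "pos g = (LEAST n. half_tour n = (tip g, g))"

lemma half_tour_pos:
  assumes "g \<in> bridges"
  shows "half_tour (pos g) = (tip g, g)"
proof -
  have "\<exists>n. half_tour n = (tip g, g)"
    by (rule half_tour_reaches) (use assms bridges in \<open>auto simp: halfedges_iff\<close>)
  then show ?thesis unfolding pos_def by (rule LeastI_ex)
qed

lemma pos_le: "half_tour n = (tip g, g) \<Longrightarrow> pos g \<le> n"
  unfolding pos_def by (rule Least_le)

lemma pos_inj: "g \<in> bridges \<Longrightarrow> g' \<in> bridges \<Longrightarrow> pos g = pos g' \<Longrightarrow> g = g'"
  using half_tour_pos by (metis snd_conv)

lemma halfedge_bridge:
  assumes "z \<in> halfedges" "snd z = g" "g \<in> bridges" "fst z \<in> U"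
  shows "z = (tip g, g)"
proof -
  have "fst z \<in> {b, tip g}" using assms bridges(4)[OF assms(3)] by (simp add: halfedges_case inc_def)
  then show ?thesis using assms b by (cases z) auto
qed

text \<open>Observed only while it is in \<open>U\<close>, the tour of \<open>insert g F\<close> is
  the tour of \<open>F\<close>: crossing \<open>g\<close> starts an excursion outside
  \<open>U\<close> that ends exactly where passing over \<open>g\<close> would have led.\<close>

lemma first_return:
  assumes z: "z \<in> halfedges" "fst z \<in> U" and g: "g \<in> bridges"
  shows "\<exists>L>0. (tour_step G (insert g F) ^^ L) z = tour_step G F z \<and>
    (\<forall>j. 0 < j \<and> j < L \<longrightarrow> fst ((tour_step G (insert g F) ^^ j) z) \<notin> U)"
proof (cases "snd z = g")
  case True
  note g' = bridges[OF g]
  have zg: "z = (tip g, g)" using halfedge_bridge z True g by blast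
  have "\<not> conn F (tip g) (opp G (tip g) g)" using conn_bridge[OF g] g' conn_sym by metis
  from tour_excursion[OF g'(5) this] obtain r where r: "0 < r"
    "(tour_step G (insert g F) ^^ Suc r) (tip g, g) = (tip g, nxt G (tip g) g)"
    "\<And>m. 0 < m \<Longrightarrow> m \<le> r \<Longrightarrow>
      (tour_step G (insert g F) ^^ m) (tip g, g) = (tour_step G F ^^ m) (b, g)"
    unfolding g'(6) by blast
  have "fst ((tour_step G F ^^ m) (b, g)) \<notin> U" for m
    using tour_conn[of "(b, g)" F m] g'(2) not_conn_sides b(2) conn_sym
    by (metis fst_conv halfedges_iff)
  then show ?thesis
    using r zg g'(7) by (intro exI[of _ "Suc r"]) (auto simp: tour_step_nontree simp del: funpow.simps)
next
  case False
  then have "tour_step G (insert g F) z = tour_step G F z" by (intro tour_step_cong) simp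
  then show ?thesis by (intro exI[of _ 1]) simp
qed

lemma half_tour_in_full_tour:
  assumes g: "g \<in> bridges"
  shows "\<exists>n. full_tour g n = half_tour k \<and>
    (\<forall>j<n. fst (full_tour g j) \<in> U \<longrightarrow> (\<exists>k'<k. full_tour g j = half_tour k'))"
proof (induction k)
  case 0
  then show ?case by (intro exI[of _ 0]) simp
next
  case (Suc k)
  then obtain n where n: "full_tour g n = half_tour k"
    "\<And>j. j < n \<Longrightarrow> fst (full_tour g j) \<in> U \<Longrightarrow> \<exists>k'<k. full_tour g j = half_tour k'" by blast
  obtain L where L: "L > 0" "(tour_step G (insert g F) ^^ L) (half_tour k) = half_tour (Suc k)"
    "\<And>j. 0 < j \<Longrightarrow> j < L \<Longrightarrow> fst ((tour_step G (insert g F) ^^ j) (half_tour k)) \<notin> U"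
    using first_return[OF half_tour_U g, of k] by auto
  have shift: "full_tour g (i + n) = (tour_step G (insert g F) ^^ i) (half_tour k)" for i
    unfolding funpow_add comp_apply n(1) ..
  show ?case
  proof (rule exI[of _ "L + n"], intro conjI allI impI)
    show "full_tour g (L + n) = half_tour (Suc k)" using shift L(2) by simp
    fix j assume j: "j < L + n" "fst (full_tour g j) \<in> U"
    consider "j < n" | "j = n" | "0 < j - n" "j - n < L" "j = (j - n) + n" using j(1) by linarith
    then show "\<exists>k'<Suc k. full_tour g j = half_tour k'"
    proof cases
      case 1
      then show ?thesis using n(2) j(2) less_SucI by blast
    next
      case 2
      then show ?thesis using n(1) by blast
    next
      case 3
      then show ?thesis using L(3) shift j(2) by metis
    qed
  qed
qed

section \<open>Chips on \<open>U\<close> of the trees through a bridge\<close>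

lemma chip_positionI:
  assumes "snd (full_tour g n) = f" "\<And>j. j < n \<Longrightarrow> snd (full_tour g j) \<noteq> f"
  shows "chip_position G (a, e) (insert g F) f = fst (full_tour g n)"
proof -
  have "(LEAST n. snd (full_tour g n) = f) = n"
    using assms by (intro Least_equality) (auto simp: not_less[symmetric])
  then show ?thesis by (simp add: chip_position_def)
qed

lemma full_tour_halfedge: "full_tour g n \<in> halfedges"
  using tour_halfedges start_halfedge by blast

lemma full_tour_ends: "snd (full_tour g n) = f \<Longrightarrow> fst (full_tour g n) \<in> ends G f"
  using full_tour_halfedge[of n g] by (auto simp: halfedges_case inc_def)

lemma chip_position_exists:
  assumes g: "g \<in> bridges" and f: "f \<in> edges G"
  obtains n where "snd (full_tour g n) = f" "\<And>j. j < n \<Longrightarrow> snd (full_tour g j) \<noteq> f"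
    "chip_position G (a, e) (insert g F) f = fst (full_tour g n)"
proof -
  obtain x where x: "f \<in> inc G x"
    using card_ends[OF f] f by (auto simp: inc_def card_2_iff)
  have "conn (insert g F) a x"
    using tree_bridge[OF g] x inc_verts start(2) unfolding spanning_trees_iff by blast
  then have "\<exists>n. full_tour g n = (x, f)"
    using tour_reaches[OF forest_bridge[OF g] _ start(2) x] F bridges(1)[OF g] by simp
  then have ex: "\<exists>n. snd (full_tour g n) = f" by (metis snd_conv)
  define n where "n = (LEAST n. snd (full_tour g n) = f)"
  have n: "snd (full_tour g n) = f" unfolding n_def using ex by (rule LeastI_ex)
  have least: "snd (full_tour g j) \<noteq> f" if "j < n" for j
    using that unfolding n_def by (rule not_less_Least)
  show ?thesis by (rule that[OF n least chip_positionI[OF n least]])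
qed

text \<open>The right-hand side does not mention \<open>g\<close>, so these chips cancel when two
  trees are compared.\<close>

lemma chip_inside:
  assumes g: "g \<in> bridges" and f: "f \<in> edges G" "ends G f \<subseteq> U"
  shows "chip_position G (a, e) (insert g F) f = fst (half_tour (LEAST k. snd (half_tour k) = f))"
proof -
  obtain x where x: "f \<in> inc G x" "x \<in> U"
    using card_ends[OF f(1)] f by (auto simp: inc_def card_2_iff)
  then have "\<exists>k. half_tour k = (x, f)" by (intro half_tour_reaches) (auto simp: halfedges_iff)
  then have ex: "\<exists>k. snd (half_tour k) = f" by (metis snd_conv)
  define k where "k = (LEAST k. snd (half_tour k) = f)"
  have k: "snd (half_tour k) = f" unfolding k_def using ex by (rule LeastI_ex)
  have least: "snd (half_tour k') \<noteq> f" if "k' < k" for k'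
    using that unfolding k_def by (rule not_less_Least)
  obtain n where n: "full_tour g n = half_tour k"
    "\<And>j. j < n \<Longrightarrow> fst (full_tour g j) \<in> U \<Longrightarrow> \<exists>k'<k. full_tour g j = half_tour k'"
    using half_tour_in_full_tour[OF g, of k] by blast
  have "snd (full_tour g j) \<noteq> f" if "j < n" for j
    using n(2)[OF that] full_tour_ends[of j g f] f(2) least by (metis subsetD)
  moreover have "snd (full_tour g n) = f" using n(1) k by simp
  ultimately show ?thesis using chip_positionI[of n g f] n(1) unfolding k_def by metis
qed

lemma chip_outside:
  assumes g: "g \<in> bridges" and f: "f \<in> edges G" "ends G f \<inter> U = {}"
  shows "chip_position G (a, e) (insert g F) f \<notin> U"
  using chip_position_exists[OF g f(1)] full_tour_ends f(2) by (metis disjoint_iff)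

lemma full_tour_before:
  assumes g: "g \<in> bridges" and n: "n \<le> pos g"
  shows "full_tour g n = half_tour n"
  using n
proof (induction n)
  case (Suc n)
  have "snd (half_tour n) \<noteq> g"
  proof
    assume "snd (half_tour n) = g"
    then have "half_tour n = (tip g, g)" using halfedge_bridge half_tour_U g by blast
    then show False using pos_le Suc.prems by fastforce
  qed
  then have "tour_step G (insert g F) (half_tour n) = tour_step G F (half_tour n)"
    by (intro tour_step_cong) simp
  then show ?case using Suc by simp
qed simp

lemma chip_bridge_before:
  assumes g: "g \<in> bridges" and f: "f \<in> bridges" and "pos f < pos g"
  shows "chip_position G (a, e) (insert g F) f = tip f"
proof -
  have "snd (half_tour j) \<noteq> f" if "j < pos f" for j
    using halfedge_bridge[OF half_tour_U(1) _ f half_tour_U(2), of j] pos_le[of j f] that by fastforce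
  then have least: "snd (full_tour g j) \<noteq> f" if "j < pos f" for j
    using full_tour_before[OF g less_imp_le[OF less_trans[OF that assms(3)]]] that by metis
  have at: "full_tour g (pos f) = (tip f, f)"
    using full_tour_before[OF g less_imp_le[OF assms(3)]] half_tour_pos[OF f] by metis
  then have s: "snd (full_tour g (pos f)) = f" by (simp only: snd_conv)
  have "chip_position G (a, e) (insert g F) f = fst (full_tour g (pos f))"
    by (rule chip_positionI) (rule s, rule least)
  then show ?thesis by (simp only: at fst_conv)
qed

text \<open>Once the tour has crossed \<open>g\<close>, it visits every half-edge outside
  \<open>U\<close>, among them \<open>(b, f)\<close>, before it returns to \<open>U\<close>. So
  \<open>f\<close> is first passed over from \<open>b\<close>.\<close>

lemma chip_bridge_after:
  assumes g: "g \<in> bridges" and f: "f \<in> bridges" and "pos g < pos f"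
  shows "chip_position G (a, e) (insert g F) f \<notin> U"
proof -
  note g' = bridges[OF g]
  let ?t = "tour_step G (insert g F)"
  have shift: "full_tour g (j + pos g) = (?t ^^ j) (tip g, g)" for j
    unfolding funpow_add comp_apply using full_tour_before[OF g, of "pos g"] half_tour_pos[OF g] by simp
  show ?thesis
  proof (rule tour_excursion_forest[OF forest_bridge[OF g] F(2) g'(7,5)], unfold g'(6))
    fix L assume L:
      "\<And>j. 0 < j \<Longrightarrow> j < L \<Longrightarrow> conn F b (fst ((?t ^^ j) (tip g, g)))"
      "\<And>z. z \<in> halfedges \<Longrightarrow> conn F b (fst z) \<Longrightarrow> \<exists>j>0. j < L \<and> (?t ^^ j) (tip g, g) = z"
    obtain j where j: "0 < j" "j < L" "full_tour g (j + pos g) = (b, f)"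
      using L(2)[of "(b, f)"] bridges(2)[OF f] shift by (auto simp: halfedges_iff)
    obtain n where n: "snd (full_tour g n) = f" "\<And>j. j < n \<Longrightarrow> snd (full_tour g j) \<noteq> f"
      "chip_position G (a, e) (insert g F) f = fst (full_tour g n)"
      using chip_position_exists[OF g bridges(1)[OF f]] by blast
    have "n \<le> j + pos g" by (rule leI) (use n(2)[of "j + pos g"] j(3) in auto)
    show ?thesis
    proof (cases "n \<le> pos g")
      case True
      then have "half_tour n = (tip f, f)"
        using full_tour_before[OF g] halfedge_bridge[OF half_tour_U(1) _ f half_tour_U(2)] n(1) by simp
      then show ?thesis using pos_le True assms(3) by fastforce
    next
      case False
      then have "conn F b (fst (full_tour g n))"
        using L(1)[of "n - pos g"] shift[of "n - pos g"] \<open>n \<le> j + pos g\<close> j(2) by simp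
      then show ?thesis using not_conn_sides b(2) n(3) conn_sym by metis
    qed
  qed
qed

lemma edges_split:
  assumes "g \<in> bridges"
  shows "edges G - insert g F = {f \<in> edges G - F. ends G f \<subseteq> U} \<union> {f \<in> edges G - F. ends G f \<inter> U = {}} \<union>
    (bridges - {g})"
proof -
  have "f \<notin> bridges" if "ends G f \<subseteq> U \<or> ends G f \<inter> U = {}" for f
    using that bridges[of f] b(2) by auto
  moreover have "f \<in> bridges" if "f \<in> edges G" "\<not> (ends G f \<subseteq> U)" "ends G f \<inter> U \<noteq> {}" for f
    using edge_sides[OF that(1)] that by (auto simp: bridges_def)
  ultimately show ?thesis using assms bridges by blast
qed

lemma coeff_bernardi_tree:
  assumes g: "g \<in> bridges" and w: "w \<in> U"
  shows "coeff (bernardi_divisor G (a, e) (insert g F)) w =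
    (\<Sum>f\<in>{f \<in> edges G - F. ends G f \<subseteq> U}. of_bool (fst (half_tour (LEAST k. snd (half_tour k) = f)) = w)) +
    (\<Sum>f\<in>{f \<in> bridges. pos f < pos g}. of_bool (tip f = w))"
proof -
  let ?c = "\<lambda>f. of_bool (chip_position G (a, e) (insert g F) f = w) :: int"
  let ?A = "{f \<in> edges G - F. ends G f \<subseteq> U}" and ?B = "{f \<in> edges G - F. ends G f \<inter> U = {}}"
  have fin: "finite ?A" "finite ?B" using finite_edges by auto
  have ne: "ends G f \<noteq> {}" if "f \<in> edges G" for f using card_ends[OF that] by auto
  have "coeff (bernardi_divisor G (a, e) (insert g F)) w = sum ?c (?A \<union> ?B \<union> (bridges - {g}))"
    unfolding coeff_bernardi_divisor edges_split[OF g] ..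
  also have "\<dots> = sum ?c ?A + sum ?c ?B + sum ?c (bridges - {g})"
  proof (subst sum.union_disjoint)
    show "(?A \<union> ?B) \<inter> (bridges - {g}) = {}"
      using bridges(3,4) b(2) by fastforce
    show "sum ?c (?A \<union> ?B) + sum ?c (bridges - {g}) = sum ?c ?A + sum ?c ?B + sum ?c (bridges - {g})"
      using ne fin by (subst sum.union_disjoint) auto
  qed (use fin finite_bridges in auto)
  also have "sum ?c ?B = 0" using chip_outside[OF g] w by (intro sum.neutral) auto
  also have "sum ?c ?A = (\<Sum>f\<in>?A. of_bool (fst (half_tour (LEAST k. snd (half_tour k) = f)) = w))"
    using chip_inside[OF g] by (intro sum.cong) auto
  also have "sum ?c (bridges - {g}) = (\<Sum>f\<in>{f \<in> bridges. pos f < pos g}. of_bool (tip f = w))"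
  proof (rule sum.mono_neutral_cong_right)
    show "\<forall>f\<in>bridges - {g} - {f \<in> bridges. pos f < pos g}. ?c f = 0"
    proof
      fix f assume f: "f \<in> bridges - {g} - {f \<in> bridges. pos f < pos g}"
      then have "pos g < pos f" using pos_inj[OF g, of f] by fastforce
      then show "?c f = 0" using chip_bridge_after[OF g, of f] f w by auto
    qed
  qed (use finite_bridges chip_bridge_before[OF g] in auto)
  finally show ?thesis by simp
qed

text \<open>The maximum over \<open>insert b U\<close> is attained in \<open>U\<close>. All
  neighbours of a vertex of \<open>U\<close> lie in this set, so \<open>lap \<phi> x \<le> 0\<close>
  at a maximal vertex forces its neighbours to be maximal too; the maximum spreads over
  \<open>U\<close> along \<open>F\<close>.\<close>

lemma maximum_principle:
  assumes sub: "\<And>w. w \<in> U \<Longrightarrow> lap \<phi> w \<le> 0" and ex: "w0 \<in> U" "\<phi> b \<le> \<phi> w0"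
    and w: "w \<in> U"
  shows "lap \<phi> w = 0"
proof -
  have fin: "finite U" using U finite_verts finite_subset by blast
  define m where "m = Max (\<phi> ` U)"
  have mx: "\<phi> x \<le> m" if "x \<in> U" for x unfolding m_def using fin that by simp
  have mb: "\<phi> b \<le> m" using ex mx order_trans by blast
  have "m \<in> \<phi> ` U" unfolding m_def using fin w by (intro Max_in) auto
  then obtain x0 where x0: "x0 \<in> U" "\<phi> x0 = m" by blast
  have nb: "opp G x f \<in> insert b U" if "x \<in> U" "f \<in> inc G x" for x f
  proof -
    have xf: "ends G f = {x, opp G x f}" "f \<in> edges G" using ends_opp inc_edges that by auto
    from edge_sides[OF xf(2)] show ?thesis
    proof (elim disjE conjE)
      assume "f \<in> inc G b" "opp G b f \<in> U"
      then show ?thesis using ends_opp[of f b] xf(1) that b by (auto simp: doubleton_eq_iff)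
    qed (use xf that in auto)
  qed
  have le: "\<phi> (opp G x f) \<le> m" if "x \<in> U" "f \<in> inc G x" for x f
    using nb[OF that] mx mb by auto
  have max0: "lap \<phi> x = 0 \<and> (\<forall>f\<in>inc G x. \<phi> (opp G x f) = m)" if x: "x \<in> U" "\<phi> x = m" for x
  proof -
    have nn: "0 \<le> \<phi> x - \<phi> (opp G x f)" if "f \<in> inc G x" for f using le[OF x(1) that] x(2) by simp
    have l: "lap \<phi> x = (\<Sum>f\<in>inc G x. \<phi> x - \<phi> (opp G x f))" using x U by (auto simp: lap_def)
    then have "lap \<phi> x = 0" using sub[OF x(1)] nn by (simp add: order_antisym sum_nonneg)
    then show ?thesis using l nn sum_nonneg_eq_0_iff[OF finite_inc, of x "\<lambda>f. \<phi> x - \<phi> (opp G x f)"] x(2)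
      by auto
  qed
  have "conn F x0 w" using conn_U x0 w by blast
  then have "w \<in> U \<and> \<phi> w = m"
  proof (induction rule: conn_induct)
    case (step x y f)
    have "f \<in> inc G x" "opp G x f = y" using step F ends_inc opp_eq by blast+
    moreover have "y \<in> U" using F_sides[OF step(2)] step by auto
    ultimately show ?case using max0[of x] step by blast
  qed (use x0 in simp)
  then show ?thesis using max0 by blast
qed

lemma lap_indicator:
  assumes "w \<in> U"
  shows "lap (\<lambda>x. of_bool (x \<in> U)) w = (\<Sum>h\<in>bridges. of_bool (tip h = w))"
proof -
  have "{f \<in> inc G w. opp G w f \<notin> U} = {h \<in> bridges. tip h = w}"
  proof (intro equalityI subsetI)
    fix f assume "f \<in> {f \<in> inc G w. opp G w f \<notin> U}"
    then have f: "f \<in> inc G w" "opp G w f \<notin> U" by auto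
    then have xf: "ends G f = {w, opp G w f}" "f \<in> edges G" using ends_opp inc_edges by auto
    then have "f \<in> inc G b \<and> opp G b f \<in> U" using edge_sides[OF xf(2)] assms f by auto
    then show "f \<in> {h \<in> bridges. tip h = w}"
      using ends_opp[of f b] xf(1) f(2) by (auto simp: bridges_def doubleton_eq_iff)
  next
    fix h assume "h \<in> {h \<in> bridges. tip h = w}"
    then show "h \<in> {f \<in> inc G w. opp G w f \<notin> U}" using bridges[of h] b(2) by auto
  qed
  moreover have "lap (\<lambda>x. of_bool (x \<in> U)) w = (\<Sum>f\<in>inc G w. of_bool (opp G w f \<notin> U))"
    using assms U by (auto simp: lap_def of_bool_def intro!: sum.cong)
  moreover have "(\<Sum>f\<in>inc G w. of_bool (opp G w f \<notin> U)) = int (card {f \<in> inc G w. opp G w f \<notin> U})"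
    using finite_inc by (simp add: of_bool_def sum.If_cases Int_def)
  moreover have "(\<Sum>h\<in>bridges. of_bool (tip h = w)) = int (card {h \<in> bridges. tip h = w})"
    using finite_bridges by (simp add: of_bool_def sum.If_cases Int_def)
  ultimately show ?thesis by simp
qed

text \<open>Such a \<open>\<phi>\<close> is larger on \<open>U\<close> than at \<open>b\<close> by the minimum principle; then \<open>\<phi>\<close> minus the indicator
  of \<open>U\<close> violates the maximum principle at a bridge outside \<open>S\<close>.\<close>

lemma not_principal:
  assumes S: "S \<subseteq> bridges" "S \<noteq> {}" "S \<noteq> bridges"
    and \<phi>: "\<And>w. w \<in> U \<Longrightarrow> lap \<phi> w = (\<Sum>h\<in>S. of_bool (tip h = w))"
  shows False
proof -
  have fS: "finite S" using S finite_bridges finite_subset by blast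
  have pos1: "1 \<le> (\<Sum>h\<in>S'. of_bool (tip h = tip h0) :: int)" if "finite S'" "h0 \<in> S'" for S' h0
  proof -
    have "of_bool (tip h0 = tip h0) \<le> (\<Sum>h\<in>S'. of_bool (tip h = tip h0) :: int)"
      using that by (intro member_le_sum) auto
    then show ?thesis by simp
  qed
  obtain h where h: "h \<in> S" using S by blast
  have gt: "\<phi> b < \<phi> w" if w: "w \<in> U" for w
  proof (rule ccontr)
    assume n: "\<not> \<phi> b < \<phi> w"
    have "lap (\<lambda>x. - \<phi> x) (tip h) = 0"
    proof (rule maximum_principle[of _ w])
      show "lap (\<lambda>x. - \<phi> x) x \<le> 0" if "x \<in> U" for x
        unfolding lap_minus \<phi>[OF that] by (simp add: sum_nonneg)
    qed (use n w h S bridges in auto)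
    then show False using pos1[OF fS h] \<phi>[of "tip h"] h S bridges by (auto simp: lap_minus)
  qed
  obtain h' where h': "h' \<in> bridges - S" using S by blast
  let ?\<psi> = "\<lambda>x. \<phi> x - of_bool (x \<in> U)"
  have l: "lap ?\<psi> w = - (\<Sum>h\<in>bridges - S. of_bool (tip h = w))" if "w \<in> U" for w
    unfolding lap_diff \<phi>[OF that] lap_indicator[OF that]
    using sum.subset_diff[OF S(1) finite_bridges, of "\<lambda>h. of_bool (tip h = w) :: int"] by simp
  have "lap ?\<psi> (tip h') = 0"
  proof (rule maximum_principle[of _ a])
    show "lap ?\<psi> x \<le> 0" if "x \<in> U" for x unfolding l[OF that] by (simp add: sum_nonneg)
    \<comment> \<open>The values are integers, so the strict inequality \<open>gt\<close> leaves
      room for the 1 subtracted on \<open>U\<close>.\<close>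
    show "?\<psi> b \<le> ?\<psi> a" using gt[OF start(1)] start b by simp
  qed (use start h' bridges in auto)
  then show False using l[of "tip h'"] pos1[of "bridges - S" h'] finite_bridges h' bridges by auto
qed

section \<open>Rotors of the trees through a bridge\<close>

lemma tree_rotors_bridge:
  assumes g: "g \<in> bridges"
  shows "tree_rotors G a (insert g F) b = g"
proof (rule tree_rotors_eqI[OF tree_bridge[OF g]])
  have "insert g F - {g} = F" using bridges(7)[OF g] by simp
  then show "conn (insert g F - {g}) (opp G b g) a" using conn_U bridges(3)[OF g] start by simp
qed (use bridges[OF g] in auto)

text \<open>From \<open>w\<close> in \<open>U\<close> the tree path to \<open>a\<close> stays in
  \<open>U\<close>. From any other \<open>w\<close> it first reaches \<open>b\<close> outside
  \<open>U\<close> and only then uses the bridge. In both cases its first edge lies in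
  \<open>F\<close> and is independent of the bridge.\<close>

lemma tree_rotors_off_bridge:
  assumes g: "g \<in> bridges" and g': "g' \<in> bridges" and w: "w \<in> verts G - {a, b}"
  shows "tree_rotors G a (insert g F) w = tree_rotors G a (insert g' F) w"
proof -
  define r where "r = (if w \<in> U then a else b)"
  have c: "conn F w r" "w \<noteq> r" using w conn_U start conn_compl by (auto simp: r_def)
  have wv: "w \<in> verts G" using w by simp
  obtain vs es where p: "path G (vs, es)" "distinct vs" "set es \<subseteq> F" "hd vs = w" "last vs = r"
    by (rule conn_simple_path[OF c(1) F(2) wv])
  have "es \<noteq> []" using p c(2) by (cases vs) (auto simp: path_def)
  note h = path_first_edge[OF p(1,3) this p(4,5)]
  have "tree_rotors G a (insert g F) w = hd es" if g: "g \<in> bridges" for g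
  proof (rule tree_rotors_eqI[OF tree_bridge[OF g]])
    show "hd es \<in> insert g F" "hd es \<in> inc G w" using h by auto
    have sub: "F - {hd es} \<subseteq> insert g F - {hd es}" by auto
    have 1: "conn (insert g F - {hd es}) (opp G w (hd es)) r" using h(3) sub by (rule conn_mono)
    show "conn (insert g F - {hd es}) (opp G w (hd es)) a"
    proof (cases "w \<in> U")
      case True
      then show ?thesis using 1 by (simp add: r_def)
    next
      case False
      have dis: "ends G (hd es) \<inter> U = {}"
        using F_sides[OF h(1)] h(2) False by (auto simp: inc_def)
      have "conn F (tip g) a" using conn_U bridges(3)[OF g] start by blast
      then have "a \<in> U \<and> conn (F - {hd es}) (tip g) a"
      proof (induction rule: conn_induct)
        case (step x y f)
        then have "f \<in> F - {hd es}" using dis by auto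
        from conn_edge[OF this step(3)] have "conn (F - {hd es}) (tip g) y"
          using step(4) conn_trans by blast
        moreover have "y \<in> U" using F_sides[OF step(2)] step by auto
        ultimately show ?case by blast
      qed (use bridges[OF g] in simp)
      then have 2: "conn (insert g F - {hd es}) (tip g) a" using conn_mono[OF _ sub] by blast
      have "g \<in> insert g F - {hd es}" using bridges(7)[OF g] h(1) by auto
      from conn_edge[OF this bridges(4)[OF g]] have "conn (insert g F - {hd es}) b a"
        using 2 by (rule conn_trans)
      moreover have "conn (insert g F - {hd es}) (opp G w (hd es)) b" using 1 False by (simp add: r_def)
      ultimately show ?thesis using conn_trans by blast
    qed
  qed
  then show ?thesis using g g' by simp
qed

end


section \<open>The order of the bridges\<close>

text \<open>Strict cyclic order. The bound \<open>card S\<close> keeps the count within one turn, so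
  the three elements are distinct if \<open>f\<close> is cyclic on \<open>S\<close> and
  \<open>x\<close> lies in \<open>S\<close>.\<close>

definition cyc3 :: "('a \<Rightarrow> 'a) \<Rightarrow> 'a set \<Rightarrow> 'a \<Rightarrow> 'a \<Rightarrow> 'a \<Rightarrow> bool" where
  "cyc3 f S x y z \<longleftrightarrow> (\<exists>k l. 0 < k \<and> k < l \<and> l < card S \<and> (f ^^ k) x = y \<and> (f ^^ l) x = z)"

lemma cyc3_rotate:
  assumes "cyclic_on f S" "x \<in> S" "cyc3 f S x y z"
  shows "cyc3 f S y z x"
proof -
  obtain k l where kl: "0 < k" "k < l" "l < card S" "(f ^^ k) x = y" "(f ^^ l) x = z"
    using assms(3) unfolding cyc3_def by blast
  have "(f ^^ (l - k)) y = (f ^^ (l - k + k)) x" unfolding funpow_add using kl by simp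
  then have 1: "(f ^^ (l - k)) y = z" using kl by simp
  have "(f ^^ (card S - k)) y = (f ^^ (card S - k + k)) x" unfolding funpow_add using kl by simp
  then have 2: "(f ^^ (card S - k)) y = x" using kl cyclic_on_funpow_card[OF assms(1,2)] by simp
  have "0 < l - k" "l - k < card S - k" "card S - k < card S" using kl by auto
  with 1 2 show ?thesis unfolding cyc3_def by blast
qed

text \<open>Cutting the cycle open at \<open>e\<close> falls into one of the three gaps, which
  leaves one of the three rotations of the linear order.\<close>

lemma cyc3_indices:
  assumes "cyclic_on f S" "e \<in> S" and c: "cyc3 f S ((f ^^ i) e) ((f ^^ j) e) ((f ^^ m) e)"
    and lt: "i < card S" "j < card S" "m < card S"
  shows "i < j \<and> j < m \<or> j < m \<and> m < i \<or> m < i \<and> i < j"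
proof -
  obtain k l where kl: "0 < k" "k < l" "l < card S"
    "(f ^^ k) ((f ^^ i) e) = (f ^^ j) e" "(f ^^ l) ((f ^^ i) e) = (f ^^ m) e"
    using c unfolding cyc3_def by blast
  have red: "n = (if p + i < card S then p + i else p + i - card S)"
    if "p < card S" "n < card S" "(f ^^ p) ((f ^^ i) e) = (f ^^ n) e" for p n
  proof -
    have eq: "(f ^^ ((p + i) mod card S)) e = (f ^^ n) e"
      unfolding that(3)[symmetric] cyclic_on_funpow_mod[OF assms(1,2), of "p + i"]
      by (simp only: funpow_add comp_apply)
    have "(p + i) mod card S < card S" using that(1) by simp
    from cyclic_on_funpow_inj[OF assms(1,2) this that(2) eq] have n: "n = (p + i) mod card S" ..
    show ?thesis
    proof (cases "p + i < card S")
      case False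
      then show ?thesis unfolding n using that(1) lt(1) by (simp add: le_mod_geq)
    qed (simp add: n)
  qed
  have "k < card S" using kl(2,3) by (rule less_trans)
  from red[OF this lt(2) kl(4)] have "j = (if k + i < card S then k + i else k + i - card S)" .
  moreover from red[OF kl(3) lt(3) kl(5)]
  have "m = (if l + i < card S then l + i else l + i - card S)" .
  ultimately have "j = k + i \<or> j + card S = k + i \<and> card S \<le> k + i"
    "m = l + i \<or> m + card S = l + i \<and> card S \<le> l + i"
    by simp_all
  then show ?thesis using kl(1-3) lt by arith
qed

context half_tree
begin

text \<open>The condition on \<open>e\<close> makes the tour start at the edge that
  \<open>bernardi_action\<close> chooses. The bridge \<open>M\<close> is the one not met from
  \<open>e0\<close> to \<open>f\<close>, as the maximum principle requires.\<close>

lemma ascending_pair_disagree: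
  assumes e: "e = (SOME e. e \<in> inc G a)"
    and br: "e0 \<in> bridges" "f \<in> bridges" "M \<in> bridges" "pos e0 < pos f" "pos f < pos M"
    and k: "0 < k" "(nxt G b ^^ k) e0 = f" "\<And>j. 0 < j \<Longrightarrow> j < k \<Longrightarrow> (nxt G b ^^ j) e0 \<notin> bridges"
  shows "\<exists>x\<in>Pic_deg G 0. \<exists>T\<in>spanning_trees G. rotor_action G a x T \<noteq> bernardi_action G a x T"
proof (rule ccontr)
  assume "\<not> ?thesis"
  then have agree: "\<And>x T. x \<in> Pic_deg G 0 \<Longrightarrow> T \<in> spanning_trees G \<Longrightarrow>
      rotor_action G a x T = bernardi_action G a x T" by blast
  let ?T = "insert e0 F" and ?T' = "insert f F"
  have av: "a \<in> verts G" "inc G a \<noteq> {}" using start U by auto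
  have card: "card (edges G - insert g F) = card (edges G) - Suc (card F)" if "g \<in> bridges" for g
    using bridges[OF that] F(2) finite_edges finite_subset[OF F(2)]
    by (subst card_Diff_subset) (auto simp: card_insert_if)
  have "card (edges G - ?T) = card (edges G - ?T')" using card br by simp
  from actions_agree_routes[OF av tree_bridge[OF br(1)] tree_bridge[OF br(2)] this agree]
  obtain D \<phi> where D: "routes a ?T D ?T'" "\<And>z. z \<in> verts G \<Longrightarrow> D z =
      coeff (bernardi_divisor G (a, e) ?T') z - coeff (bernardi_divisor G (a, e) ?T) z + lap \<phi> z"
    unfolding e by blast
  have "b \<in> verts G - {a}" using b start by auto
  moreover have "(nxt G b ^^ k) (tree_rotors G a ?T b) = tree_rotors G a ?T' b"
    using k(2) tree_rotors_bridge br by simp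
  ultimately obtain \<phi>' where \<phi>': "\<And>z. z \<in> verts G \<Longrightarrow>
      D z = (\<Sum>j<k. move b ((nxt G b ^^ Suc j) e0) z) + lap \<phi>' z"
    using routes_one_rotor[OF tree_bridge[OF br(1)] av(1) D(1)]
      tree_rotors_off_bridge[OF br(2,1)] tree_rotors_bridge[OF br(1)] by metis
  \<comment> \<open>The Bernardi divisors account for the bridges from \<open>e0\<close> up to but
    excluding \<open>f\<close>; the rotor chip sent along \<open>f\<close> supplies the missing
    one.\<close>
  define S where "S = {h \<in> bridges. pos e0 \<le> pos h \<and> pos h \<le> pos f}"
  have fin: "finite A" if "A \<subseteq> bridges" for A using that finite_bridges finite_subset by blast
  show False
  proof (rule not_principal)
    have "e0 \<in> S" "M \<notin> S" using br by (auto simp: S_def)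
    then show "S \<subseteq> bridges" "S \<noteq> {}" "S \<noteq> bridges" using br(3) by (auto simp: S_def)
    fix w assume w: "w \<in> U"
    then have wv: "w \<in> verts G" using U by blast
    have wb: "b \<noteq> w" using w b by blast
    let ?o = "\<lambda>h. of_bool (tip h = w) :: int"
    let ?A = "{h \<in> bridges. pos h < pos e0}" and ?B = "{h \<in> bridges. pos h < pos f}"
    \<comment> \<open>All advances before the last use edges that do not lead into
      \<open>U\<close>.\<close>
    have "move b ((nxt G b ^^ Suc j) e0) w = 0" if "j < k - 1" for j
    proof -
      have "(nxt G b ^^ Suc j) e0 \<notin> bridges" by (rule k(3)) (use that in auto)
      moreover have "(nxt G b ^^ Suc j) e0 \<in> inc G b" by (rule nxt_funpow_inc[OF bridges(2)[OF br(1)]])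
      ultimately have "tip ((nxt G b ^^ Suc j) e0) \<noteq> w" using w by (auto simp: bridges_def)
      then show ?thesis using wb by (simp add: move_def)
    qed
    then have z: "(\<Sum>j<k - 1. move b ((nxt G b ^^ Suc j) e0) w) = 0" by (intro sum.neutral) blast
    have k1: "Suc (k - 1) = k" using k(1) by simp
    have "(\<Sum>j<Suc (k - 1). move b ((nxt G b ^^ Suc j) e0) w) = move b f w"
      unfolding sum.lessThan_Suc z unfolding k1 k(2) by simp
    \<comment> \<open>The sign is negative because \<open>move\<close> counts losses and
      \<open>tip f\<close> gains a chip.\<close>
    then have mv: "(\<Sum>j<k. move b ((nxt G b ^^ Suc j) e0) w) = - ?o f"
      unfolding k1 using wb by (simp add: move_def)
    have BA: "sum ?o ?B = sum ?o ?A + sum ?o (?B - ?A)"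
      using br(4) by (subst sum.subset_diff[of ?A ?B]) (auto intro: fin)
    have SBA: "S = insert f (?B - ?A)" "f \<notin> ?B - ?A"
      using br pos_inj[OF _ br(2)] by (fastforce simp: S_def)+
    have "finite (?B - ?A)" by (rule fin) blast
    from sum.insert[OF this SBA(2)] have S: "sum ?o S = ?o f + sum ?o (?B - ?A)" unfolding SBA(1) .
    have "D w = sum ?o ?B - sum ?o ?A + lap \<phi> w"
      unfolding D(2)[OF wv] coeff_bernardi_tree[OF br(1) w] coeff_bernardi_tree[OF br(2) w] by simp
    then show "lap (\<lambda>x. \<phi>' x - \<phi> x) w = sum ?o S"
      using \<phi>'[OF wv] mv BA S by (simp add: lap_diff)
  qed
qed

text \<open>Read the bridges at \<open>b\<close> from the one that the tour meets last. Without an ascending pair of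
  neighbours, their positions decrease, so the tour meets them in the reverse of the cyclic order.\<close>

lemma ascending_pair_exists:
  assumes br: "g0 \<in> bridges" "g1 \<in> bridges" "g2 \<in> bridges" "pos g0 < pos g1" "pos g1 < pos g2"
    and c: "cyc3 (nxt G b) (inc G b) g0 g1 g2"
  obtains e0 f M k where "e0 \<in> bridges" "f \<in> bridges" "M \<in> bridges" "pos e0 < pos f" "pos f < pos M"
    "0 < k" "(nxt G b ^^ k) e0 = f" "\<And>j. 0 < j \<Longrightarrow> j < k \<Longrightarrow> (nxt G b ^^ j) e0 \<notin> bridges"
proof (rule ccontr)
  assume "\<not> thesis"
  note none = that[THEN notE[OF this]]
  let ?N = "nxt G b" and ?n = "card (inc G b)"
  have "Max (pos ` bridges) \<in> pos ` bridges" using br finite_bridges by (intro Max_in) auto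
  then obtain M where M: "M \<in> bridges" "pos M = Max (pos ` bridges)" by auto
  have Mle: "pos g \<le> pos M" if "g \<in> bridges" for g using that M finite_bridges by simp
  have cy: "cyclic_on ?N (inc G b)" and Mi: "M \<in> inc G b" using nxt_cyclic bridges(2)[OF M(1)] by auto
  have desc: "pos ((?N ^^ j) M) \<le> pos ((?N ^^ i) M)"
    if "i \<le> j" "j < ?n" "(?N ^^ i) M \<in> bridges" "(?N ^^ j) M \<in> bridges" for i j
    using that
  proof (induction j rule: less_induct)
    case (less j)
    show ?case
    proof (cases "i = j")
      case False
      let ?I = "{l. l < j \<and> (?N ^^ l) M \<in> bridges}"
      define i' where "i' = Max ?I"
      have I: "i \<in> ?I" "finite ?I" using False less.prems by auto
      then have i': "i' \<in> ?I" unfolding i'_def by (intro Max_in) auto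
      have ii': "i \<le> i'" unfolding i'_def using I by simp
      have top: "l \<le> i'" if "l \<in> ?I" for l unfolding i'_def using that I by simp
      have step: "(?N ^^ p) ((?N ^^ i') M) = (?N ^^ (p + i')) M" for p by (simp add: funpow_add)
      \<comment> \<open>\<open>M\<close> has index 0, so a later bridge is not \<open>M\<close> and
        is met strictly before it; an ascent from \<open>i'\<close> to \<open>j\<close> would
        therefore be a pair of the required kind.\<close>
      have "(?N ^^ j) M \<noteq> (?N ^^ 0) M"
        using cyclic_on_funpow_inj[OF cy Mi, of j 0] less.prems(1,2) False by fastforce
      then have "pos ((?N ^^ j) M) \<noteq> pos M" using pos_inj M(1) less.prems(4) by fastforce
      then have ltM: "pos ((?N ^^ j) M) < pos M" using Mle[OF less.prems(4)] by simp
      have "\<not> pos ((?N ^^ i') M) < pos ((?N ^^ j) M)"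
      proof
        assume asc: "pos ((?N ^^ i') M) < pos ((?N ^^ j) M)"
        show False
        proof (rule none[of "(?N ^^ i') M" "(?N ^^ j) M" M "j - i'"])
          show "(?N ^^ (j - i')) ((?N ^^ i') M) = (?N ^^ j) M" using step[of "j - i'"] i' by simp
          show "(?N ^^ p) ((?N ^^ i') M) \<notin> bridges" if "0 < p" "p < j - i'" for p
          proof -
            have "p + i' < j" using that by linarith
            then show ?thesis using top[of "p + i'"] step[of p] that(1) by auto
          qed
        qed (use i' less.prems M asc ltM in auto)
      qed
      moreover have "pos ((?N ^^ i') M) \<le> pos ((?N ^^ i) M)"
        using less.IH[of i'] i' ii' less.prems by auto
      ultimately show ?thesis by simp
    qed simp
  qed
  have idx: "\<exists>j<?n. (?N ^^ j) M = g" if "g \<in> bridges" for g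
    using cyclic_on_funpow_ex[OF cy Mi bridges(2)[OF that]] by metis
  obtain j0 j1 j2 where j: "j0 < ?n" "j1 < ?n" "j2 < ?n"
    "g0 = (?N ^^ j0) M" "g1 = (?N ^^ j1) M" "g2 = (?N ^^ j2) M"
    using idx[OF br(1)] idx[OF br(2)] idx[OF br(3)] by metis
  \<comment> \<open>Positions decrease with the index while \<open>g0\<close>, \<open>g1\<close>,
    \<open>g2\<close> have increasing positions. So their indices decrease, which is not a rotation
    of an increasing triple.\<close>
  have "\<not> j0 \<le> j1" "\<not> j1 \<le> j2" using desc[of j0 j1] desc[of j1 j2] br j by auto
  then show False
    using cyc3_indices[OF cy Mi c[unfolded j(4,5,6)] j(1,2,3)] by linarith
qed

text \<open>What the tour visits between reaching \<open>(a, d)\<close> and reaching the successor of \<open>d\<close> at \<open>a\<close>.\<close>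

definition block :: "'e \<Rightarrow> ('v \<times> 'e) set" where
  "block d = {z \<in> halfedges. z = (a, d) \<or> d \<in> F \<and> conn (F - {d}) (opp G a d) (fst z)}"

lemma block_disjoint:
  assumes "d \<in> inc G a" "d' \<in> inc G a" "z \<in> block d" "z \<in> block d'"
  shows "d = d'"
proof -
  have nc: "\<not> conn (F - {d}) (opp G a d) a" if "d \<in> inc G a" "d \<in> F" for d
    using forestD[OF F(1) that(2) ends_opp[OF that(1)]] conn_sym by blast
  show ?thesis
    using assms nc[of d] nc[of d'] forest_first_edge_unique[OF F(1), of d a "fst z" d']
    by (auto simp: block_def)
qed

text \<open>Turning around \<open>a\<close> cuts the tour into consecutive blocks, one for each edge
  at \<open>a\<close>; \<open>\<theta>\<close> is the time at which the first \<open>m\<close> of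
  them are completed.\<close>

lemma half_tour_blocks:
  "\<exists>\<theta>. half_tour \<theta> = (a, (nxt G a ^^ m) e) \<and>
    (\<forall>j<\<theta>. \<exists>m'<m. half_tour j \<in> block ((nxt G a ^^ m') e)) \<and>
    (\<forall>m'<m. \<forall>z\<in>block ((nxt G a ^^ m') e). \<exists>j<\<theta>. half_tour j = z)"
proof (induction m)
  case 0
  then show ?case by (intro exI[of _ 0]) simp
next
  case (Suc m)
  let ?d = "(nxt G a ^^ m) e"
  obtain \<theta> where \<theta>: "half_tour \<theta> = (a, ?d)"
    "\<And>j. j < \<theta> \<Longrightarrow> \<exists>m'<m. half_tour j \<in> block ((nxt G a ^^ m') e)"
    "\<And>m' z. m' < m \<Longrightarrow> z \<in> block ((nxt G a ^^ m') e) \<Longrightarrow> \<exists>j<\<theta>. half_tour j = z"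
    using Suc by blast
  have d: "?d \<in> inc G a" using nxt_funpow_inc start(2) .
  have shift: "half_tour (j + \<theta>) = (tour_step G F ^^ j) (a, ?d)" for j
    unfolding funpow_add comp_apply \<theta>(1) ..
  have "\<exists>L>0. half_tour (L + \<theta>) = (a, nxt G a ?d) \<and> (\<forall>j<L. half_tour (j + \<theta>) \<in> block ?d) \<and>
    (\<forall>z\<in>block ?d. \<exists>j<L. half_tour (j + \<theta>) = z)"
  proof (cases "?d \<in> F")
    case False
    then have "half_tour (1 + \<theta>) = (a, nxt G a ?d)" unfolding shift by (simp add: tour_step_nontree)
    moreover have "block ?d = {(a, ?d)}" using False d by (auto simp: block_def halfedges_iff)
    ultimately show ?thesis using \<theta>(1) by (intro exI[of _ 1]) auto
  next
    case True
    then have ins: "insert ?d (F - {?d}) = F" by blast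
    show ?thesis
    proof (rule tour_excursion_forest[of ?d "F - {?d}", OF _ _ _ d], unfold ins)
      fix L assume L: "0 < L" "(tour_step G F ^^ L) (a, ?d) = (a, nxt G a ?d)"
        "\<And>j. 0 < j \<Longrightarrow> j < L \<Longrightarrow> conn (F - {?d}) (opp G a ?d) (fst ((tour_step G F ^^ j) (a, ?d)))"
        "\<And>z. z \<in> halfedges \<Longrightarrow> conn (F - {?d}) (opp G a ?d) (fst z) \<Longrightarrow>
          \<exists>j>0. j < L \<and> (tour_step G F ^^ j) (a, ?d) = z"
      have "half_tour (j + \<theta>) \<in> block ?d" if "j < L" for j
        using L(3)[of j] that True half_tour_U(1)[of "j + \<theta>"] \<theta>(1) unfolding block_def shift
        by (cases "j = 0") auto
      moreover have "\<exists>j<L. half_tour (j + \<theta>) = z" if "z \<in> block ?d" for z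
      proof (cases "z = (a, ?d)")
        case True
        then show ?thesis using L(1) \<theta>(1) by (intro exI[of _ 0]) simp
      next
        case False
        then show ?thesis using L(4)[of z] that unfolding block_def shift by blast
      qed
      ultimately show ?thesis using L(1,2) shift[of L] by (intro exI[of _ L]) auto
    qed (use F in auto)
  qed
  then obtain L where L: "0 < L" "half_tour (L + \<theta>) = (a, nxt G a ?d)"
    "\<And>j. j < L \<Longrightarrow> half_tour (j + \<theta>) \<in> block ?d"
    "\<And>z. z \<in> block ?d \<Longrightarrow> \<exists>j<L. half_tour (j + \<theta>) = z" by blast
  show ?case
  proof (rule exI[of _ "L + \<theta>"], intro conjI allI impI ballI)
    show "half_tour (L + \<theta>) = (a, (nxt G a ^^ Suc m) e)" using L(2) by simp
    show "\<exists>m'<Suc m. half_tour j \<in> block ((nxt G a ^^ m') e)" if "j < L + \<theta>" for j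
    proof (cases "j < \<theta>")
      case True
      then show ?thesis using \<theta>(2) less_SucI by blast
    next
      case False
      then have "half_tour j \<in> block ?d" using L(3)[of "j - \<theta>"] that by simp
      then show ?thesis by blast
    qed
    show "\<exists>j<L + \<theta>. half_tour j = z" if m': "m' < Suc m" and z: "z \<in> block ((nxt G a ^^ m') e)" for m' z
    proof (cases "m' = m")
      case True
      then obtain j where "j < L" "half_tour (j + \<theta>) = z" using L(4) z by blast
      then show ?thesis by (intro exI[of _ "j + \<theta>"]) simp
    next
      case False
      then have "m' < m" using m' by simp
      then obtain j where "j < \<theta>" "half_tour j = z" using \<theta>(3) z by blast
      then show ?thesis by (intro exI[of _ j]) simp
    qed
  qed
qed

lemma pos_less:
  assumes g: "g \<in> bridges" "(tip g, g) \<in> block ((nxt G a ^^ m) e)"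
    and g': "g' \<in> bridges" "(tip g', g') \<in> block ((nxt G a ^^ m') e)"
    and m: "m < m'" "m' < card (inc G a)"
  shows "pos g < pos g'"
proof -
  obtain \<theta> where \<theta>: "\<And>j. j < \<theta> \<Longrightarrow> \<exists>l<m'. half_tour j \<in> block ((nxt G a ^^ l) e)"
    "\<And>l z. l < m' \<Longrightarrow> z \<in> block ((nxt G a ^^ l) e) \<Longrightarrow> \<exists>j<\<theta>. half_tour j = z"
    using half_tour_blocks[of m'] by blast
  obtain j where j: "j < \<theta>" "half_tour j = (tip g, g)" using \<theta>(2)[OF m(1) g(2)] by blast
  then have "pos g < \<theta>" using pos_le le_less_trans by blast
  moreover have "\<not> pos g' < \<theta>"
  proof
    assume "pos g' < \<theta>"
    then obtain l where l: "l < m'" "(tip g', g') \<in> block ((nxt G a ^^ l) e)"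
      using \<theta>(1) half_tour_pos[OF g'(1)] by metis
    have "(nxt G a ^^ l) e = (nxt G a ^^ m') e"
      using block_disjoint[OF nxt_funpow_inc nxt_funpow_inc l(2) g'(2)] start(2) by blast
    then show False
      using cyclic_on_funpow_inj[OF nxt_cyclic[OF start(2)] start(2), of l m'] l(1) m(2) by simp
  qed
  ultimately show ?thesis by simp
qed

end


section \<open>Theta subgraphs\<close>

context ribbon_graph
begin

text \<open>\<open>F\<close> is a spanning forest, containing \<open>Y\<close>, of the edges other
  than those between \<open>b\<close> and \<open>U\<close>. Vertices outside \<open>U\<close> remain
  joined to \<open>b\<close>, because a walk can enter or leave \<open>U\<close> only through
  \<open>b\<close>.\<close>

lemma half_tree_exists:
  assumes ab: "a \<noteq> b" "a \<in> verts G" "b \<in> verts G" and e: "e \<in> inc G a"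
    and Y: "forest Y" "Y \<subseteq> edges G - inc G b"
  obtains F where "half_tree G {w. conn (edges G - inc G b) a w} b F a e" "Y \<subseteq> F"
proof -
  let ?E = "edges G - inc G b"
  define U where "U = {w. conn ?E a w}"
  define E' where "E' = {f \<in> edges G. \<not> (f \<in> inc G b \<and> opp G b f \<in> U)}"
  have "f \<in> ?E \<Longrightarrow> ends G f \<subseteq> {b} \<or> ends G f \<inter> {b} = {}" for f by (auto simp: inc_def)
  then have bU: "b \<notin> U" using conn_closed[of ?E a b "{b}"] ab(1) by (auto simp: U_def)
  have Uv: "U \<subseteq> verts G" using conn_verts[of ?E a] ab(2) by (auto simp: U_def)
  have ex: "\<exists>x y. ends G f = {x, y}" if "f \<in> edges G" for f using card_ends[OF that] by (meson card_2_iff)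
  have E_sides: "ends G f \<subseteq> U \<or> ends G f \<inter> U = {}" if f: "f \<in> E'" for f
  proof (cases "f \<in> inc G b")
    case True
    then show ?thesis using f ends_opp[OF True] bU by (auto simp: E'_def)
  next
    case False
    then have fE: "f \<in> ?E" using f by (simp add: E'_def)
    then obtain x y where xy: "ends G f = {x, y}" using ex by blast
    then have c: "conn ?E x y" using conn_edge[OF fE] by blast
    then have "x \<in> U \<longleftrightarrow> y \<in> U" unfolding U_def mem_Collect_eq using conn_trans conn_sym by meson
    then show ?thesis using xy by auto
  qed
  have "Y \<subseteq> E'" using Y(2) by (auto simp: E'_def)
  moreover have "E' \<subseteq> edges G" by (auto simp: E'_def)
  ultimately show ?thesis
  proof (rule forest_extend[OF Y(1)])
    fix F assume F: "forest F" "Y \<subseteq> F" "F \<subseteq> E'" "\<And>u w. conn E' u w \<Longrightarrow> conn F u w"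
    have "?E \<subseteq> E'" by (auto simp: E'_def)
    then have inU: "conn F a u" if "u \<in> U" for u
      using that F(4) conn_mono[of ?E a u E'] by (simp add: U_def)
    have "half_tree G U b F a e"
    proof (unfold_locales)
      show "conn F u w" if "u \<in> U" "w \<in> U" for u w using inU that conn_sym conn_trans by meson
      show "conn F u b" if u: "u \<in> verts G - U" for u
      proof -
        have "conn (edges G) b u" using conn_edges ab(3) u by blast
        then have "u \<in> U \<or> conn E' b u"
        proof (induction rule: conn_induct)
          case (step x y f)
          show ?case
          proof (cases "f \<in> E'")
            case True
            from step.IH show ?thesis
            proof
              assume "x \<in> U"
              then have "y \<in> U" using E_sides[OF True] step(3) by auto
              then show ?thesis ..
            next
              assume "conn E' b x"
              then show ?thesis using conn_edge[OF True step(3)] conn_trans by blast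
            qed
          next
            case False
            then have "f \<in> inc G b" "opp G b f \<in> U" using step(2) by (auto simp: E'_def)
            then show ?thesis using ends_opp[of f b] step(3) by (auto simp: doubleton_eq_iff)
          qed
        qed simp
        then show ?thesis using u F(4) conn_sym by blast
      qed
      show "ends G f \<subseteq> U \<or> ends G f \<inter> U = {} \<or> f \<in> inc G b \<and> opp G b f \<in> U" if "f \<in> edges G" for f
        using E_sides[of f] that by (auto simp: E'_def)
      show "ends G f \<subseteq> U \<or> ends G f \<inter> U = {}" if "f \<in> F" for f
        using E_sides F(3) that by blast
      show "a \<in> U" by (simp add: U_def)
    qed (use Uv bU ab e F(1,3) in \<open>auto simp: E'_def\<close>)
    then show ?thesis using that F(2) unfolding U_def by blast
  qed
qed

text \<open>A connection from \<open>a\<close> to \<open>b\<close> with first edge \<open>d\<close> and last edge \<open>g\<close> whose remaining edges \<open>Z\<close>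
  live on the interior vertices \<open>W\<close>; for \<open>d = g\<close> it is a single edge.\<close>

definition leg :: "'v \<Rightarrow> 'v \<Rightarrow> 'e \<Rightarrow> 'e \<Rightarrow> 'v set \<Rightarrow> 'e set \<Rightarrow> bool" where
  "leg a b d g W Z \<longleftrightarrow> d \<in> inc G a \<and> g \<in> inc G b \<and> a \<notin> W \<and> b \<notin> W \<and> Z \<subseteq> edges G \<and>
     (\<forall>z\<in>Z. ends G z \<subseteq> W) \<and>
     (d = g \<or> opp G a d \<in> W \<and> opp G b g \<in> W \<and> conn Z (opp G a d) (opp G b g))"

text \<open>The interiors \<open>W i\<close> are disjoint, so each first edge \<open>d i\<close>
  leads from \<open>a\<close> into a part that is not yet attached and closes no cycle. The last
  edges meet \<open>b\<close> and stay out; a leg of a single edge contributes nothing.\<close>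

lemma legs_forest:
  assumes "finite I" "a \<noteq> b"
    and leg: "\<And>i. i \<in> I \<Longrightarrow> leg a b (d i) (g i) (W i) (Z i)"
    and disj: "\<And>i j. i \<in> I \<Longrightarrow> j \<in> I \<Longrightarrow> i \<noteq> j \<Longrightarrow> W i \<inter> W j = {}"
  obtains Y where "forest Y" "Y \<subseteq> edges G - inc G b"
    "\<And>i. i \<in> I \<Longrightarrow> d i \<noteq> g i \<Longrightarrow> d i \<in> Y \<and> conn (Y - {d i}) (opp G a (d i)) (opp G b (g i))"
proof -
  let ?Z = "\<Union>i\<in>I. Z i"
  have Zw: "ends G z \<subseteq> W i" if "i \<in> I" "z \<in> Z i" for i z using leg[OF that(1)] that(2) by (auto simp: leg_def)
  have Wab: "a \<notin> W i" "b \<notin> W i" if "i \<in> I" for i using leg[OF that] by (auto simp: leg_def)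
  have de: "ends G (d i) = {a, opp G a (d i)}" "d i \<in> edges G" if "i \<in> I" for i
    using leg[OF that] ends_opp inc_edges by (auto simp: leg_def)
  have dW: "opp G a (d i) \<in> W i" if "i \<in> I" "d i \<noteq> g i" for i using leg[OF that(1)] that(2) by (auto simp: leg_def)
  have "forest {}" by (simp add: forest_def)
  moreover have "{} \<subseteq> ?Z" by simp
  moreover have "?Z \<subseteq> edges G" using leg by (auto simp: leg_def)
  ultimately show ?thesis
  proof (rule forest_extend)
    fix F assume F: "forest F" "F \<subseteq> ?Z" "\<And>u w. conn ?Z u w \<Longrightarrow> conn F u w"
    define Y where "Y J = F \<union> d ` {i \<in> J. d i \<noteq> g i}" for J
    have "J \<subseteq> I \<Longrightarrow> forest (Y J)" if "finite J" for J
      using that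
    proof (induction J rule: finite_induct)
      case empty
      then show ?case using F(1) by (simp add: Y_def)
    next
      case (insert i J)
      then have iI: "i \<in> I" and fY: "forest (Y J)" by auto
      show ?case
      proof (cases "d i = g i")
        case True
        then have "Y (insert i J) = Y J" by (auto simp: Y_def)
        then show ?thesis using fY by simp
      next
        case False
        have "ends G f \<subseteq> W i \<or> ends G f \<inter> W i = {}" if f: "f \<in> Y J" for f
        proof (cases "f \<in> F")
          case True
          then obtain j where j: "j \<in> I" "f \<in> Z j" using F(2) by blast
          then show ?thesis using Zw[OF j] disj[OF iI j(1)] by (cases "i = j") auto
        next
          case False
          then obtain j where j: "j \<in> J" "d j \<noteq> g j" "f = d j" using f by (auto simp: Y_def)
          then have "j \<in> I" "j \<noteq> i" using insert by auto
          then show ?thesis using de(1)[of j] dW[of j] j disj[OF iI, of j] Wab(1)[OF iI] by auto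
        qed
        then have "\<not> conn (Y J) a (opp G a (d i))"
          using conn_closed[of "Y J" a _ "W i"] dW[OF iI False] Wab(1)[OF iI] by blast
        from forest_insert[OF fY de(1)[OF iI] this] have "forest (insert (d i) (Y J))" .
        moreover have "insert (d i) (Y J) = Y (insert i J)" using False by (auto simp: Y_def)
        ultimately show ?thesis by simp
      qed
    qed
    then have "forest (Y I)" using assms(1) by blast
    moreover have "Y I \<subseteq> edges G - inc G b"
    proof
      fix f assume f: "f \<in> Y I"
      show "f \<in> edges G - inc G b"
      proof (cases "f \<in> F")
        case True
        then obtain j where j: "j \<in> I" "f \<in> Z j" using F(2) by blast
        then have "f \<in> edges G" using leg[OF j(1)] by (auto simp: leg_def)
        then show ?thesis using Zw[OF j] Wab(2)[OF j(1)] by (auto simp: inc_def)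
      next
        case False
        then obtain j where j: "j \<in> I" "d j \<noteq> g j" "f = d j" using f by (auto simp: Y_def)
        then show ?thesis using de[OF j(1)] dW[OF j(1,2)] Wab(2)[OF j(1)] assms(2) by (auto simp: inc_def)
      qed
    qed
    moreover have "d i \<in> Y I \<and> conn (Y I - {d i}) (opp G a (d i)) (opp G b (g i))"
      if i: "i \<in> I" "d i \<noteq> g i" for i
    proof
      show "d i \<in> Y I" using i by (auto simp: Y_def)
      have "d i \<notin> F"
      proof
        assume "d i \<in> F"
        then obtain j where j: "j \<in> I" "d i \<in> Z j" using F(2) by blast
        then show False using Zw[OF j] de(1)[OF i(1)] Wab(1)[OF j(1)] by auto
      qed
      then have sub: "F \<subseteq> Y I - {d i}" by (auto simp: Y_def)
      have "conn (Z i) (opp G a (d i)) (opp G b (g i))" using leg[OF i(1)] i(2) by (auto simp: leg_def)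
      then have "conn ?Z (opp G a (d i)) (opp G b (g i))" by (rule conn_mono) (use i in auto)
      from conn_mono[OF F(3)[OF this] sub] show "conn (Y I - {d i}) (opp G a (d i)) (opp G b (g i))" .
    qed
    ultimately show ?thesis using that by blast
  qed
qed

abbreviation actions_differ :: "'v \<Rightarrow> bool" where
  "actions_differ q \<equiv>
    \<exists>x\<in>Pic_deg G 0. \<exists>T\<in>spanning_trees G. rotor_action G q x T \<noteq> bernardi_action G q x T"

text \<open>Deleting \<open>b\<close> leaves the legs in one component \<open>U\<close>; the tour of a tree of \<open>U\<close> that contains them
  meets \<open>g 0\<close>, \<open>g 1\<close>, \<open>g 2\<close> in the order of the legs at \<open>a\<close>.\<close>

lemma sorted_legs_disagree:
  assumes ab: "a \<noteq> b"
    and leg: "\<And>i. i < 3 \<Longrightarrow> leg a b (d i) (g i) (W i) (Z i)"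
    and disj: "\<And>i j. i < 3 \<Longrightarrow> j < 3 \<Longrightarrow> i \<noteq> j \<Longrightarrow> W i \<inter> W j = {}"
    and d: "\<And>i. i < 3 \<Longrightarrow> d i = (nxt G a ^^ m i) (SOME e. e \<in> inc G a)"
    and m: "m 0 < m 1" "m 1 < m 2" "m 2 < card (inc G a)"
    and c: "cyc3 (nxt G b) (inc G b) (g 0) (g 1) (g (2 :: nat))"
  shows "actions_differ a"
proof -
  define e where "e = (SOME e. e \<in> inc G a)"
  have dg: "d i \<in> inc G a" "g i \<in> inc G b" if "i < 3" for i using leg[OF that] by (auto simp: leg_def)
  have "d 0 \<in> inc G a" using dg by simp
  then have e: "e \<in> inc G a" unfolding e_def by (rule someI)
  have abv: "a \<in> verts G" "b \<in> verts G" using dg[of 0] inc_verts by auto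
  have lg: "i \<in> {..<3} \<Longrightarrow> leg a b (d i) (g i) (W i) (Z i)" for i using leg by simp
  have dj: "i \<in> {..<3} \<Longrightarrow> j \<in> {..<3} \<Longrightarrow> i \<noteq> j \<Longrightarrow> W i \<inter> W j = {}" for i j using disj by simp
  show ?thesis
  proof (rule legs_forest[OF finite_lessThan ab lg dj])
    fix Y assume Y: "forest Y" "Y \<subseteq> edges G - inc G b"
      "\<And>i. i \<in> {..<3} \<Longrightarrow> d i \<noteq> g i \<Longrightarrow> d i \<in> Y \<and> conn (Y - {d i}) (opp G a (d i)) (opp G b (g i))"
    obtain F where h: "half_tree G {w. conn (edges G - inc G b) a w} b F a e" and YF: "Y \<subseteq> F"
      using half_tree_exists[OF ab abv e Y(1,2)] by blast
    interpret half_tree G "{w. conn (edges G - inc G b) a w}" b F a e by (rule h)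
    have br: "g i \<in> bridges" and bl: "(opp G b (g i), g i) \<in> block ((nxt G a ^^ m i) e)" if i: "i < 3" for i
    proof -
      have gi: "(opp G b (g i), g i) \<in> halfedges" using opp_inc[OF dg(2)[OF i]] halfedges_iff by blast
      have de: "d i = (nxt G a ^^ m i) e" using d[OF i] e_def by simp
      have both: "g i \<in> bridges \<and> (opp G b (g i), g i) \<in> block (d i)"
      proof (cases "d i = g i")
        case True
        then have "ends G (g i) = {a, opp G a (g i)}" "ends G (g i) = {b, opp G b (g i)}"
          using ends_opp[OF dg(1)[OF i]] ends_opp[OF dg(2)[OF i]] by simp_all
        then have "opp G b (g i) = a" using ab by (auto simp: doubleton_eq_iff)
        then show ?thesis using gi True dg[OF i] by (simp add: bridges_def block_def)
      next
        case False
        have Yi: "d i \<in> Y" "conn (Y - {d i}) (opp G a (d i)) (opp G b (g i))" using Y(3)[of i] i False by auto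
        have "conn Y a (opp G a (d i))" using conn_opp Yi(1) dg[OF i] by blast
        moreover have "conn Y (opp G a (d i)) (opp G b (g i))" using Yi(2) by (rule conn_mono) auto
        ultimately have "conn Y a (opp G b (g i))" using conn_trans by blast
        then have "conn (edges G - inc G b) a (opp G b (g i))" using Y(2) by (rule conn_mono)
        moreover have "conn (F - {d i}) (opp G a (d i)) (opp G b (g i))"
          using Yi(2) by (rule conn_mono) (use YF in auto)
        ultimately show ?thesis using gi dg[OF i] Yi(1) YF by (auto simp: bridges_def block_def)
      qed
      then show "g i \<in> bridges" "(opp G b (g i), g i) \<in> block ((nxt G a ^^ m i) e)" using de by auto
    qed
    have p: "pos (g 0) < pos (g 1)" "pos (g 1) < pos (g 2)"
      using pos_less[OF br bl br bl, of 0 1] pos_less[OF br bl br bl, of 1 2] m by auto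
    show ?thesis
    proof (rule ascending_pair_exists[OF br br br p c])
      fix e0 f M k assume "e0 \<in> bridges" "f \<in> bridges" "M \<in> bridges" "pos e0 < pos f" "pos f < pos M"
        "0 < k" "(nxt G b ^^ k) e0 = f" "\<And>j. 0 < j \<Longrightarrow> j < k \<Longrightarrow> (nxt G b ^^ j) e0 \<notin> bridges"
      then show ?thesis by (rule ascending_pair_disagree[OF e_def])
    qed auto
  qed
qed

text \<open>The first edge of the tour may cut the cyclic order at \<open>a\<close> in any gap.
  Rotating the three legs simultaneously sorts them at \<open>a\<close> and preserves their cyclic
  order at \<open>b\<close>.\<close>

lemma legs_disagree:
  assumes ab: "a \<noteq> b"
    and leg: "leg a b d0 g0 W0 Z0" "leg a b d1 g1 W1 Z1" "leg a b d2 g2 W2 Z2"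
    and disj: "W0 \<inter> W1 = {}" "W1 \<inter> W2 = {}" "W2 \<inter> W0 = {}"
    and ca: "cyc3 (nxt G a) (inc G a) d0 d1 d2" and cb: "cyc3 (nxt G b) (inc G b) g0 g1 g2"
  shows "actions_differ a"
proof -
  define e where "e = (SOME e. e \<in> inc G a)"
  have d: "d0 \<in> inc G a" "d1 \<in> inc G a" "d2 \<in> inc G a" and g: "g0 \<in> inc G b" "g1 \<in> inc G b"
    using leg by (auto simp: leg_def)
  from d(1) have e: "e \<in> inc G a" unfolding e_def by (rule someI)
  note cy = nxt_cyclic[OF e] and cyb = nxt_cyclic[OF g(1)]
  have idx: "\<exists>i<card (inc G a). d = (nxt G a ^^ i) e" if "d \<in> inc G a" for d
    using cyclic_on_funpow_ex[OF cy e that] by metis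
  obtain i j m where i: "i < card (inc G a)" "d0 = (nxt G a ^^ i) e"
    and j: "j < card (inc G a)" "d1 = (nxt G a ^^ j) e" and m: "m < card (inc G a)" "d2 = (nxt G a ^^ m) e"
    using idx[OF d(1)] idx[OF d(2)] idx[OF d(3)] by blast
  have sorted: "actions_differ a"
    if leg: "leg a b d0 g0 W0 Z0" "leg a b d1 g1 W1 Z1" "leg a b d2 g2 W2 Z2"
      and disj: "W0 \<inter> W1 = {}" "W1 \<inter> W2 = {}" "W2 \<inter> W0 = {}"
      and cb: "cyc3 (nxt G b) (inc G b) g0 g1 g2"
      and dd: "d0 = (nxt G a ^^ i) e" "d1 = (nxt G a ^^ j) e" "d2 = (nxt G a ^^ m) e"
      and lt: "i < j" "j < m" "m < card (inc G a)"
    for d0 d1 d2 g0 g1 g2 W0 W1 W2 Z0 Z1 Z2 i j m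
  proof -
    let ?p = "\<lambda>x y z (n :: nat). if n = 0 then x else if n = 1 then y else z"
    have three: "n = 0 \<or> n = 1 \<or> n = 2" if "n < 3" for n :: nat using that by auto
    show ?thesis
    proof (rule sorted_legs_disagree[OF ab, where d = "?p d0 d1 d2" and g = "?p g0 g1 g2"
          and W = "?p W0 W1 W2" and Z = "?p Z0 Z1 Z2" and m = "?p i j m"])
      fix n :: nat assume "n < 3"
      with three have n: "n = 0 \<or> n = 1 \<or> n = 2" by blast
      show "leg a b (?p d0 d1 d2 n) (?p g0 g1 g2 n) (?p W0 W1 W2 n) (?p Z0 Z1 Z2 n)"
        using n leg by auto
      show "?p d0 d1 d2 n = (nxt G a ^^ ?p i j m n) (SOME e. e \<in> inc G a)"
        using n dd by (auto simp: e_def)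
    next
      fix n n' :: nat assume "n < 3" "n' < 3" "n \<noteq> n'"
      with three[of n] three[of n'] show "?p W0 W1 W2 n \<inter> ?p W0 W1 W2 n' = {}"
        using disj by auto
    qed (use lt cb in auto)
  qed
  from cyc3_indices[OF cy e ca[unfolded i(2) j(2) m(2)] i(1) j(1) m(1)]
  show ?thesis
  proof (elim disjE conjE)
    assume "i < j" "j < m"
    then show ?thesis using sorted[OF leg disj cb i(2) j(2) m(2)] m(1) by blast
  next
    assume "j < m" "m < i"
    then show ?thesis
      using sorted[OF leg(2,3,1) disj(2,3,1) cyc3_rotate[OF cyb g(1) cb] j(2) m(2) i(2)] i(1) by blast
  next
    assume "m < i" "i < j"
    then show ?thesis
      using sorted[OF leg(3,1,2) disj(3,1,2)
          cyc3_rotate[OF cyb g(2) cyc3_rotate[OF cyb g(1) cb]] m(2) i(2) j(2)] j(1) by blast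
  qed
qed

section \<open>From a witness pair to three legs\<close>

lemma walk_conn:
  assumes "p \<le> r" "\<And>k. p \<le> k \<Longrightarrow> k < r \<Longrightarrow> ends G (es k) = {vs k, vs (Suc k)}"
  shows "conn (es ` {p..<r}) (vs p) (vs r)"
  using assms
proof (induction r rule: dec_induct)
  case (step n)
  have "conn (es ` {p..<n}) (vs p) (vs n)" using step by simp
  then have "conn (es ` {p..<Suc n}) (vs p) (vs n)" by (rule conn_mono) auto
  moreover have "conn (es ` {p..<Suc n}) (vs n) (vs (Suc n))"
    using step by (intro conn_edge[of "es n"]) auto
  ultimately show ?case using conn_trans by blast
qed simp

lemma leg_of_walk:
  assumes m: "0 < m" and en: "\<And>k. k < m \<Longrightarrow> es k \<in> edges G \<and> ends G (es k) = {vs k, vs (Suc k)}"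
    and int: "\<And>k. 0 < k \<Longrightarrow> k < m \<Longrightarrow> vs k \<noteq> vs 0 \<and> vs k \<noteq> vs m"
  shows "leg (vs 0) (vs m) (es 0) (es (m - 1)) (vs ` {1..<m}) (es ` {1..<m - 1})"
proof -
  have 0: "ends G (es 0) = {vs 0, vs 1}" "es 0 \<in> edges G" using en[OF m] by auto
  have l: "ends G (es (m - 1)) = {vs m, vs (m - 1)}" "es (m - 1) \<in> edges G"
    using en[of "m - 1"] m by (auto simp: insert_commute)
  have o: "opp G (vs 0) (es 0) = vs 1" "opp G (vs m) (es (m - 1)) = vs (m - 1)"
    using opp_eq 0 l by auto
  have "es 0 = es (m - 1) \<or> vs 1 \<in> vs ` {1..<m} \<and> vs (m - 1) \<in> vs ` {1..<m} \<and>
      conn (es ` {1..<m - 1}) (vs 1) (vs (m - 1))"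
  proof (cases "m = 1")
    case False
    then have "conn (es ` {1..<m - 1}) (vs 1) (vs (m - 1))"
      using m en by (intro walk_conn) auto
    then show ?thesis using False m by auto
  qed simp
  moreover have "ends G (es k) \<subseteq> vs ` {1..<m}" "es k \<in> edges G" if "k \<in> {1..<m - 1}" for k
    using en[of k] that by auto
  moreover have "vs 0 \<notin> vs ` {1..<m}" "vs m \<notin> vs ` {1..<m}"
    using int by (auto simp: image_iff) (metis less_eq_Suc_le)+
  ultimately show ?thesis
    unfolding leg_def o using 0 l ends_inc by (auto simp: subset_iff)
qed

lemma interval_cyc3:
  assumes p: "p \<in> interval G v e0 e1" "p \<noteq> e0" "p \<noteq> e1" and e: "e0 \<in> inc G v" "e1 \<in> inc G v"
  shows "cyc3 (nxt G v) (inc G v) e0 p e1"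
proof -
  define L where "L = (LEAST k. (nxt G v ^^ k) e0 = e1)"
  obtain k where k: "k < card (inc G v)" "(nxt G v ^^ k) e0 = e1"
    using cyclic_on_funpow_ex[OF nxt_cyclic[OF e(1)] e] by blast
  have L: "(nxt G v ^^ L) e0 = e1" "L \<le> k"
    unfolding L_def using k(2) by (rule LeastI, rule Least_le)
  obtain l where l: "l \<le> L" "p = (nxt G v ^^ l) e0" using p(1) unfolding interval_def L_def by auto
  have "l \<noteq> 0" using l(2) p(2) by (metis funpow_0)
  moreover have "l \<noteq> L" using l(2) p(3) L(1) by metis
  ultimately have "0 < l" "l < L" "L < card (inc G v)" using l(1) L(2) k(1) by auto
  then show ?thesis unfolding cyc3_def using l(2) L(1) by blast
qed

text \<open>The legs are the forward arc of the cycle from \<open>a\<close> to \<open>b\<close>, the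
  path, and the backward arc. At \<open>a\<close> the arcs use the outgoing and the incoming edge,
  and the path starts on the left, between them in this order. At \<open>b\<close> the forward arc
  arrives on the incoming edge and the backward arc on the outgoing one, and the path arrives from
  the right, again between them in this order. So the cyclic orders of the legs agree.\<close>

lemma crossing_disagree:
  assumes c: "oriented_cycle G (vs, es)" and P: "crosses G (pvs, pes) (vs, es)"
    and ab: "hd pvs \<noteq> last pvs"
  shows "actions_differ (hd pvs)"
proof -
  define n where "n = length es"
  let ?a = "hd pvs" and ?b = "last pvs"
  have C: "length vs = n" "2 \<le> n" "distinct vs" "distinct es" "set es \<subseteq> edges G"
    "\<And>i. i < n \<Longrightarrow> ends G (es ! i) = {vs ! i, vs ! (Suc i mod n)}"
    using c by (auto simp: oriented_cycle_def n_def)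
  have pp: "path G (pvs, pes)" "pes \<noteq> []" "meets_only_in_endpoints (pvs, pes) (set vs, set es)"
    "left_of G (vs, es) ?a (hd pes)" "right_of G (vs, es) ?b (last pes)"
    using P by (auto simp: crosses_def underlying_def)
  define m where "m = length pes"
  have Pt: "length pvs = Suc m" "set pes \<subseteq> edges G" "\<And>i. i < m \<Longrightarrow> ends G (pes ! i) = {pvs ! i, pvs ! Suc i}"
    "0 < m" using pp(1,2) by (auto simp: path_def m_def)
  have ends_P: "pvs ! 0 = ?a" "pvs ! m = ?b" "pes ! 0 = hd pes" "pes ! (m - 1) = last pes"
    using Pt pp(2) by (auto simp: hd_conv_nth last_conv_nth m_def)
      (metis hd_conv_nth last_conv_nth length_0_conv nat.distinct(1) diff_Suc_1)+
  have meet: "set pes \<inter> set es = {}" "\<And>k. 0 < k \<Longrightarrow> k < m \<Longrightarrow> pvs ! k \<notin> set vs"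
    "?a \<in> set vs" "?b \<in> set vs"
    using pp(3) Pt(1) ends_P(1,2) unfolding meets_only_in_endpoints_def by auto
  obtain i where i: "i < n" "vs ! i = ?a" "hd pes \<in> interval G ?a (es ! i) (es ! ((i + n - 1) mod n))"
    using pp(4) C(1) by (auto simp: left_of_def out_edge_def in_edge_def n_def)
  obtain j where j: "j < n" "vs ! j = ?b" "last pes \<in> interval G ?b (es ! ((j + n - 1) mod n)) (es ! j)"
    using pp(5) C(1) by (auto simp: right_of_def out_edge_def in_edge_def n_def)
  have ij: "i \<noteq> j" using i j ab by auto
  \<comment> \<open>The cycle is read again starting at \<open>a\<close>: both \<open>v' 0\<close>
    and \<open>v' n\<close> are \<open>a\<close>, and \<open>r\<close> steps forward lead to
    \<open>b\<close>.\<close>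
  define v' where "v' k = vs ! ((i + k) mod n)" for k
  define e' where "e' k = es ! ((i + k) mod n)" for k
  define r where "r = (if i < j then j - i else j + n - i)"
  have r: "0 < r" "r < n" using i j ij by (auto simp: r_def)
  have e': "e' k \<in> edges G" "e' k \<in> set es" "ends G (e' k) = {v' k, v' (Suc k)}" for k
  proof -
    have k: "(i + k) mod n < n" using i by simp
    then show "e' k \<in> set es" by (simp add: e'_def n_def)
    then show "e' k \<in> edges G" using C(5) by blast
    show "ends G (e' k) = {v' k, v' (Suc k)}"
      using C(6)[OF k] by (simp add: e'_def v'_def mod_Suc_eq)
  qed
  have v'_inj: "k = l" if "v' k = v' l" "k < n" "l < n" for k l
  proof -
    have "(i + k) mod n = (i + l) mod n"
      using that(1) C(1,3) i unfolding v'_def by (subst (asm) nth_eq_iff_index_eq) auto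
    moreover have "(i + x) mod n = (if i + x < n then i + x else i + x - n)" if "x < n" for x
      using that i(1) by (simp add: le_mod_geq)
    ultimately show ?thesis using that(2,3) i(1) by (auto split: if_splits)
  qed
  have v'_set: "v' k \<in> set vs" for k using C(1) i by (simp add: v'_def)
  have v'_ends: "v' 0 = ?a" "v' n = ?a" "v' r = ?b"
    using i j C(2) by (auto simp: v'_def r_def)
  have at_a: "e' 0 = es ! i" "e' (n - 1) = es ! ((i + n - 1) mod n)"
    using i C(2) by (auto simp: e'_def)
  have at_b: "e' r = es ! j" "e' (r - 1) = es ! ((j + n - 1) mod n)"
  proof -
    show "e' r = es ! j" using i j by (auto simp: e'_def r_def)
    have "(i + (r - 1)) mod n = (j + n - 1) mod n"
    proof (cases "i < j")
      case True
      then have "j + n - 1 = i + (r - 1) + n" using r by (simp add: r_def)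
      then show ?thesis by simp
    next
      case False
      then have "j + n - 1 = i + (r - 1)" using r i by (simp add: r_def)
      then show ?thesis by simp
    qed
    then show "e' (r - 1) = es ! ((j + n - 1) mod n)" by (simp add: e'_def)
  qed
  \<comment> \<open>The backward arc is indexed by the distance from \<open>a\<close>, beginning at
    \<open>v' n\<close> rather than \<open>v' 0\<close>, so that natural subtraction never
    truncates.\<close>
  let ?W0 = "v' ` {1..<r}" and ?W1 = "(\<lambda>k. pvs ! k) ` {1..<m}" and ?W2 = "(\<lambda>k. v' (n - k)) ` {1..<n - r}"
  have l0: "leg ?a ?b (e' 0) (e' (r - 1)) ?W0 (e' ` {1..<r - 1})"
    using leg_of_walk[of r e' v'] r e' v'_inj v'_ends by (metis less_nat_zero_code less_trans nat_neq_iff)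
  have l1: "leg ?a ?b (hd pes) (last pes) ?W1 ((\<lambda>k. pes ! k) ` {1..<m - 1})"
  proof -
    have "leg (pvs ! 0) (pvs ! m) (pes ! 0) (pes ! (m - 1)) ?W1 ((\<lambda>k. pes ! k) ` {1..<m - 1})"
    proof (rule leg_of_walk)
      show "pes ! k \<in> edges G \<and> ends G (pes ! k) = {pvs ! k, pvs ! Suc k}" if "k < m" for k
        using Pt that by (auto simp: m_def)
      show "pvs ! k \<noteq> pvs ! 0 \<and> pvs ! k \<noteq> pvs ! m" if "0 < k" "k < m" for k
        using meet(2)[OF that] meet(3,4) ends_P by auto
    qed (rule Pt(4))
    then show ?thesis unfolding ends_P .
  qed
  have l2: "leg ?a ?b (e' (n - 1)) (e' r) ?W2 ((\<lambda>k. e' (n - 1 - k)) ` {1..<n - r - 1})"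
  proof -
    have "leg (v' (n - 0)) (v' (n - (n - r))) (e' (n - 1 - 0)) (e' (n - 1 - (n - r - 1))) ?W2
        ((\<lambda>k. e' (n - 1 - k)) ` {1..<n - r - 1})"
    proof (rule leg_of_walk)
      show "0 < n - r" using r by simp
      show "e' (n - 1 - k) \<in> edges G \<and> ends G (e' (n - 1 - k)) = {v' (n - k), v' (n - Suc k)}"
        if "k < n - r" for k
      proof -
        have "Suc (n - 1 - k) = n - k" "n - 1 - k = n - Suc k" using that by auto
        then show ?thesis using e'(1,3)[of "n - 1 - k"] by (simp add: insert_commute)
      qed
      show "v' (n - k) \<noteq> v' (n - 0) \<and> v' (n - k) \<noteq> v' (n - (n - r))" if k: "0 < k" "k < n - r" for k
      proof -
        have nk: "n - k < n" "0 < n" "n - k \<noteq> 0" "n - k \<noteq> r" using k by auto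
        then have "v' (n - k) \<noteq> v' 0" using v'_inj[of "n - k" 0] by auto
        moreover have "v' (n - k) \<noteq> v' r" using v'_inj[of "n - k" r] nk r by auto
        ultimately show ?thesis using v'_ends r by simp
      qed
    qed
    moreover have "n - (n - r) = r" "n - 1 - (n - r - 1) = r" using r by auto
    ultimately show ?thesis using v'_ends by simp
  qed
  have "?W1 \<inter> set vs = {}" using meet(2) by auto
  moreover have "?W0 \<subseteq> set vs" "?W2 \<subseteq> set vs" using v'_set by blast+
  ultimately have W01: "?W0 \<inter> ?W1 = {}" and W12: "?W1 \<inter> ?W2 = {}" by blast+
  have W20: "?W2 \<inter> ?W0 = {}"
  proof -
    have False if "v' (n - k) = v' l" "k \<in> {1..<n - r}" "l \<in> {1..<r}" for k l
      using v'_inj[OF that(1)] that(2,3) r by auto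
    then show ?thesis by blast
  qed
  have ca: "cyc3 (nxt G ?a) (inc G ?a) (e' 0) (hd pes) (e' (n - 1))"
  proof (rule interval_cyc3)
    show "hd pes \<noteq> e' 0" "hd pes \<noteq> e' (n - 1)" using meet(1) e'(2) pp(2) by (metis disjoint_iff hd_in_set)+
  qed (use i(3) at_a l0 l2 in \<open>auto simp: leg_def\<close>)
  have cb: "cyc3 (nxt G ?b) (inc G ?b) (e' (r - 1)) (last pes) (e' r)"
  proof (rule interval_cyc3)
    show "last pes \<noteq> e' (r - 1)" "last pes \<noteq> e' r" using meet(1) e'(2) pp(2) by (metis disjoint_iff last_in_set)+
  qed (use j(3) at_b l0 l2 in \<open>auto simp: leg_def\<close>)
  show ?thesis by (rule legs_disagree[OF ab l0 l1 l2 W01 W12 W20 ca cb])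
qed

end

theorem theorem6p2:
  fixes G :: "('v, 'e) ribbon_graph"
  assumes "ribbon_graph G"
    and "nonplanar G"
    and "\<exists>C P. proper_witness_pair G C P"
  shows "\<exists>q \<in> verts G. \<exists>x \<in> Pic_deg G 0. \<exists>T \<in> spanning_trees G.
           rotor_action G q x T \<noteq> bernardi_action G q x T"
proof -
  interpret ribbon_graph G by fact
  obtain C P where CP: "proper_witness_pair G C P" using assms(3) by blast
  obtain pvs pes where P: "P = (pvs, pes)" by fastforce
  obtain c where c: "orientation_of G c C" "crosses G P c"
    using CP by (auto simp: proper_witness_pair_def witness_pair_def)
  obtain vs es where v: "c = (vs, es)" by fastforce
  have "actions_differ (hd pvs)"
    using crossing_disagree[of vs es pvs pes] c CP
    by (auto simp: P v orientation_of_def proper_witness_pair_def)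
  moreover have "hd pvs \<in> verts G"
    using c(2) by (cases pvs) (auto simp: P crosses_def path_def)
  ultimately show ?thesis by blast
qed

end
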